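(* Let $\sigma$ be a finite relational signature, P a numerical predicate collection and $d,k,\ell,r,w\in\mathbb{N}$. There is an algorithm $\mathfrak{L}^d_{con}$ which, with only local access to a finite $\sigma$-structure $\mathcal{B}$ of degree at most $d$, receives a training sequence $T\in(U(\mathcal{B})^k\times\{0,1\})^t$ as input, such that, with $n=|\mathcal{B}|$ and $t=|T|$: (1) If $\mathfrak{L}^d_{con}$ returns a hypothesis, then it is of the form $(\phi^*(\bar{x};\bar{y}),\bar{v}^* )$, where $\phi^*$ is a first-order formula that is a Boolean combination of sphere formulas with locality radius smaller than $(2w+1)^r$, $\bar{v}^*\in U(\mathcal{B})^\ell$, and $[\![\phi^*(\bar{x};\bar{v}^* )]\!]^{\mathcal{B}}$ is consistent with $T$. (2) If there are an FOCN(P)-formula $\phi(\bar{x};\bar{y},\bar{\kappa})$ with $\mathrm{br}(\phi)\le r$, $\mathrm{bw}(\phi)\le w$ and parameter tuples $\bar{v}\in U(\mathcal{B})^\ell$, $\bar{\lambda}\in\{0,\dots,n\}^{|\bar{\kappa}|}$ such that $[\![\phi(\bar{x};\bar{v},\bar{\lambda})]\!]^{\mathcal{B}}$ is consistent with $T$, then $\mathfrak{L}^d_{con}$ returns a hypothesis. (3) $\mathfrak{L}^d_{con}$ runs in time $(\log n+t)^{O(1)}$ with only local access to $\mathcal{B}$. (4) The returned hypothesis can be evaluated in time $(\log n)^{O(1)}$ with only local access to $\mathcal{B}$.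
   Context: All structures are finite. For a $\sigma$-structure $\mathcal{A}$, the Gaifman graph has vertex set $U(\mathcal{A})$ and an edge between distinct elements occurring together in a tuple of some relation; the degree of $\mathcal{A}$ is its maximum degree. $N_s^{\mathcal{A}}(\bar{u})$ is the set of elements at Gaifman distance $\le s$ from some entry of $\bar{u}$; $\mathcal{N}_s^{\mathcal{A}}(\bar{u})=(\mathcal{A}[N_s^{\mathcal{A}}(\bar{u})],\bar{u})$ (centers as constants; isomorphisms respect centers). For an $s$-type $\tau$ (a structure $(\mathcal{A},a_1,\dots,a_m)$ with $U(\mathcal{A})=N_s^{\mathcal{A}}(a_1,\dots,a_m)$), a sphere formula $\mathrm{sph}_\tau(\bar{z})$ is a first-order formula with $\mathcal{B}\models\mathrm{sph}_\tau(\bar{b})$ iff $\mathcal{N}_s^{\mathcal{B}}(\bar{b})\cong\tau$; its locality radius is $s$. A numerical predicate collection P consists of names $P$ with arity $\mathrm{ar}(P)\ge1$ and semantics $[\![P]\!]\subseteq\mathbb{Z}^{\mathrm{ar}(P)}$. FOCN(P) extends first-order logic by counting terms $\#(x_1,\dots,x_s).\psi$ (number of satisfying tuples), integers, number variables, $+$, $\cdot$, atoms $P(t_1,\dots,t_{\mathrm{ar}(P)})$ on counting terms and $\exists\kappa$ for number variables ranging over $\{0,\dots,|U(\mathcal{A})|\}$; $\mathrm{br}$ is the maximal nesting depth of $\exists x,\forall x$ (structure variables) and $\#\bar{x}$; $\mathrm{bw}$ is the maximal length of $\bar{x}$ in a term $\#\bar{x}.\psi$, and if there is none, $1$ if there is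 a quantifier over a structure variable and $0$ otherwise. A training sequence is $T=((\bar{u}_1,c_1),\dots,(\bar{u}_t,c_t))$ with $\bar{u}_i\in U(\mathcal{B})^k$, $c_i\in\{0,1\}$. For $\phi(\bar{x};\bar{y},\bar{\kappa})$ ($\bar{x}$ a $k$-tuple, $\bar{y}$ an $\ell$-tuple of structure variables, $\bar{\kappa}$ number variables), $[\![\phi(\bar{x};\bar{v},\bar{\lambda})]\!]^{\mathcal{B}}:U(\mathcal{B})^k\to\{0,1\}$ maps $\bar{u}$ to $1$ iff $\mathcal{B}\models\phi(\bar{u};\bar{v},\bar{\lambda})$; a hypothesis $H$ is consistent with $T$ if $H(\bar{u}_i)=c_i$ for all $i$. Only local access: $\mathcal{B}$ is accessed only by queries "is $\bar{a}\in R(\mathcal{B})$?" and "list all Gaifman neighbors of $u$". *)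

theory Defs
  imports Complex_Main
begin

section \<open>Structures, Gaifman graph, spheres\<close>

text \<open>
  A finite relational signature is a list of natural numbers: its relation symbols are the indices
  \<open>i < length \<sigma>\<close>, and symbol \<open>i\<close> has arity \<open>\<sigma> ! i\<close>.
\<close>

type_synonym signature = "nat list"

record 'a struct =
  univ :: "'a set"
  interp :: "nat \<Rightarrow> 'a list set"

definition is_struct :: "signature \<Rightarrow> 'a struct \<Rightarrow> bool" where
  "is_struct \<sigma> A \<longleftrightarrow> finite (univ A) \<and> univ A \<noteq> {} \<and>
     (\<forall>i<length \<sigma>. \<forall>us\<in>interp A i. length us = \<sigma> ! i \<and> set us \<subseteq> univ A) \<and>
     (\<forall>i\<ge>length \<sigma>. interp A i = {})"

definition gaifman :: "'a struct \<Rightarrow> ('a \<times> 'a) set" where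
  "gaifman A = {(u, v). u \<noteq> v \<and> (\<exists>i. \<exists>us\<in>interp A i. u \<in> set us \<and> v \<in> set us)}"

definition gaifman_nbrs :: "'a struct \<Rightarrow> 'a \<Rightarrow> 'a set" where
  "gaifman_nbrs A u = {v. (u, v) \<in> gaifman A}"

definition max_degree :: "'a struct \<Rightarrow> nat" where
  "max_degree A = Max ((\<lambda>u. card (gaifman_nbrs A u)) ` univ A)"

definition nbhd :: "'a struct \<Rightarrow> nat \<Rightarrow> 'a list \<Rightarrow> 'a set" where
  "nbhd A s us = {v \<in> univ A. \<exists>u\<in>set us. \<exists>m\<le>s. (u, v) \<in> gaifman A ^^ m}"

definition induced :: "'a struct \<Rightarrow> 'a set \<Rightarrow> 'a struct" where
  "induced A X = \<lparr>univ = X, interp = (\<lambda>i. {us \<in> interp A i. set us \<subseteq> X})\<rparr>"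

definition sphere :: "'a struct \<Rightarrow> nat \<Rightarrow> 'a list \<Rightarrow> 'a struct \<times> 'a list" where
  "sphere A s us = (induced A (nbhd A s us), us)"

definition isomorphic :: "'a struct \<times> 'a list \<Rightarrow> 'b struct \<times> 'b list \<Rightarrow> bool" where
  "isomorphic \<A> \<B> \<longleftrightarrow>
     (\<exists>f. bij_betw f (univ (fst \<A>)) (univ (fst \<B>)) \<and>
        (\<forall>i us. set us \<subseteq> univ (fst \<A>) \<longrightarrow>
           (us \<in> interp (fst \<A>) i \<longleftrightarrow> map f us \<in> interp (fst \<B>) i)) \<and>
        map f (snd \<A>) = snd \<B>)"

text \<open>
  Since all structures are finite, natural numbers suffice as elements of types.
\<close>

definition is_type :: "signature \<Rightarrow> nat \<Rightarrow> nat struct \<times> nat list \<Rightarrow> bool" where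
  "is_type \<sigma> s \<tau> \<longleftrightarrow> is_struct \<sigma> (fst \<tau>) \<and> set (snd \<tau>) \<subseteq> univ (fst \<tau>) \<and>
     univ (fst \<tau>) = nbhd (fst \<tau>) s (snd \<tau>)"


section \<open>First-order logic with counting\<close>

record 'p num_preds =
  pred_names :: "'p set"
  pred_arity :: "'p \<Rightarrow> nat"
  pred_sem :: "'p \<Rightarrow> int list set"

definition is_num_preds :: "'p num_preds \<Rightarrow> bool" where
  "is_num_preds P \<longleftrightarrow>
     (\<forall>p\<in>pred_names P. pred_arity P p \<ge> 1 \<and> (\<forall>zs\<in>pred_sem P p. length zs = pred_arity P p))"

text \<open>
  Structure variables and number variables are two separate copies of \<^typ>\<open>nat\<close>:
  \<open>FEx\<close> and \<open>TCount\<close> bind structure variables, \<open>FNumEx\<close> binds number variables.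
  Conjunction, universal quantification etc. are the usual abbreviations, which change
  neither the nesting depth nor the widths defined below. The primitive truth constant
  serves as the empty Boolean combination.
\<close>

datatype 'p fm =
    FTrue
  | FEq nat nat
  | FRel nat "nat list"
  | FNeg "'p fm"
  | FOr "'p fm" "'p fm"
  | FEx nat "'p fm"
  | FPred 'p "'p tm list"
  | FNumEx nat "'p fm"
and 'p tm =
    TCount "nat list" "'p fm"
  | TInt int
  | TNumVar nat
  | TPlus "'p tm" "'p tm"
  | TTimes "'p tm" "'p tm"

fun wf_fm :: "signature \<Rightarrow> 'p num_preds \<Rightarrow> 'p fm \<Rightarrow> bool"
  and wf_tm :: "signature \<Rightarrow> 'p num_preds \<Rightarrow> 'p tm \<Rightarrow> bool" where
  "wf_fm \<sigma> P FTrue = True"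
| "wf_fm \<sigma> P (FEq x y) = True"
| "wf_fm \<sigma> P (FRel i xs) = (i < length \<sigma> \<and> length xs = \<sigma> ! i)"
| "wf_fm \<sigma> P (FNeg \<phi>) = wf_fm \<sigma> P \<phi>"
| "wf_fm \<sigma> P (FOr \<phi> \<psi>) = (wf_fm \<sigma> P \<phi> \<and> wf_fm \<sigma> P \<psi>)"
| "wf_fm \<sigma> P (FEx x \<phi>) = wf_fm \<sigma> P \<phi>"
| "wf_fm \<sigma> P (FPred p ts) =
     (p \<in> pred_names P \<and> length ts = pred_arity P p \<and> (\<forall>t\<in>set ts. wf_tm \<sigma> P t))"
| "wf_fm \<sigma> P (FNumEx \<kappa> \<phi>) = wf_fm \<sigma> P \<phi>"
| "wf_tm \<sigma> P (TCount xs \<phi>) = (xs \<noteq> [] \<and> distinct xs \<and> wf_fm \<sigma> P \<phi>)"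
| "wf_tm \<sigma> P (TInt z) = True"
| "wf_tm \<sigma> P (TNumVar \<kappa>) = True"
| "wf_tm \<sigma> P (TPlus s t) = (wf_tm \<sigma> P s \<and> wf_tm \<sigma> P t)"
| "wf_tm \<sigma> P (TTimes s t) = (wf_tm \<sigma> P s \<and> wf_tm \<sigma> P t)"

fun first_order :: "'p fm \<Rightarrow> bool" where
  "first_order FTrue = True"
| "first_order (FEq x y) = True"
| "first_order (FRel i xs) = True"
| "first_order (FNeg \<phi>) = first_order \<phi>"
| "first_order (FOr \<phi> \<psi>) = (first_order \<phi> \<and> first_order \<psi>)"
| "first_order (FEx x \<phi>) = first_order \<phi>"
| "first_order (FPred p ts) = False"
| "first_order (FNumEx \<kappa> \<phi>) = False"

definition upds :: "(nat \<Rightarrow> 'v) \<Rightarrow> nat list \<Rightarrow> 'v list \<Rightarrow> nat \<Rightarrow> 'v" where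
  "upds \<beta> xs as = (\<lambda>x. case map_of (zip xs as) x of Some a \<Rightarrow> a | None \<Rightarrow> \<beta> x)"

fun sat :: "'p num_preds \<Rightarrow> 'a struct \<Rightarrow> (nat \<Rightarrow> 'a) \<Rightarrow> (nat \<Rightarrow> nat) \<Rightarrow> 'p fm \<Rightarrow> bool"
  and tval :: "'p num_preds \<Rightarrow> 'a struct \<Rightarrow> (nat \<Rightarrow> 'a) \<Rightarrow> (nat \<Rightarrow> nat) \<Rightarrow> 'p tm \<Rightarrow> int" where
  "sat P A \<beta> \<nu> FTrue = True"
| "sat P A \<beta> \<nu> (FEq x y) = (\<beta> x = \<beta> y)"
| "sat P A \<beta> \<nu> (FRel i xs) = (map \<beta> xs \<in> interp A i)"
| "sat P A \<beta> \<nu> (FNeg \<phi>) = (\<not> sat P A \<beta> \<nu> \<phi>)"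
| "sat P A \<beta> \<nu> (FOr \<phi> \<psi>) = (sat P A \<beta> \<nu> \<phi> \<or> sat P A \<beta> \<nu> \<psi>)"
| "sat P A \<beta> \<nu> (FEx x \<phi>) = (\<exists>a\<in>univ A. sat P A (\<beta>(x := a)) \<nu> \<phi>)"
| "sat P A \<beta> \<nu> (FPred p ts) = (map (tval P A \<beta> \<nu>) ts \<in> pred_sem P p)"
| "sat P A \<beta> \<nu> (FNumEx \<kappa> \<phi>) = (\<exists>m\<le>card (univ A). sat P A \<beta> (\<nu>(\<kappa> := m)) \<phi>)"
| "tval P A \<beta> \<nu> (TCount xs \<phi>) =
     int (card {as. length as = length xs \<and> set as \<subseteq> univ A \<and> sat P A (upds \<beta> xs as) \<nu> \<phi>})"
| "tval P A \<beta> \<nu> (TInt z) = z"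
| "tval P A \<beta> \<nu> (TNumVar \<kappa>) = int (\<nu> \<kappa>)"
| "tval P A \<beta> \<nu> (TPlus s t) = tval P A \<beta> \<nu> s + tval P A \<beta> \<nu> t"
| "tval P A \<beta> \<nu> (TTimes s t) = tval P A \<beta> \<nu> s * tval P A \<beta> \<nu> t"

fun svars :: "'p fm \<Rightarrow> nat set" and svars_tm :: "'p tm \<Rightarrow> nat set" where
  "svars FTrue = {}"
| "svars (FEq x y) = {x, y}"
| "svars (FRel i xs) = set xs"
| "svars (FNeg \<phi>) = svars \<phi>"
| "svars (FOr \<phi> \<psi>) = svars \<phi> \<union> svars \<psi>"
| "svars (FEx x \<phi>) = svars \<phi> - {x}"
| "svars (FPred p ts) = (\<Union>t\<in>set ts. svars_tm t)"
| "svars (FNumEx \<kappa> \<phi>) = svars \<phi>"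
| "svars_tm (TCount xs \<phi>) = svars \<phi> - set xs"
| "svars_tm (TInt z) = {}"
| "svars_tm (TNumVar \<kappa>) = {}"
| "svars_tm (TPlus s t) = svars_tm s \<union> svars_tm t"
| "svars_tm (TTimes s t) = svars_tm s \<union> svars_tm t"

fun nvars :: "'p fm \<Rightarrow> nat set" and nvars_tm :: "'p tm \<Rightarrow> nat set" where
  "nvars FTrue = {}"
| "nvars (FEq x y) = {}"
| "nvars (FRel i xs) = {}"
| "nvars (FNeg \<phi>) = nvars \<phi>"
| "nvars (FOr \<phi> \<psi>) = nvars \<phi> \<union> nvars \<psi>"
| "nvars (FEx x \<phi>) = nvars \<phi>"
| "nvars (FPred p ts) = (\<Union>t\<in>set ts. nvars_tm t)"
| "nvars (FNumEx \<kappa> \<phi>) = nvars \<phi> - {\<kappa>}"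
| "nvars_tm (TCount xs \<phi>) = nvars \<phi>"
| "nvars_tm (TInt z) = {}"
| "nvars_tm (TNumVar \<kappa>) = {\<kappa>}"
| "nvars_tm (TPlus s t) = nvars_tm s \<union> nvars_tm t"
| "nvars_tm (TTimes s t) = nvars_tm s \<union> nvars_tm t"

text \<open>Binding rank: number quantifiers do not count.\<close>

fun br :: "'p fm \<Rightarrow> nat" and br_tm :: "'p tm \<Rightarrow> nat" where
  "br FTrue = 0"
| "br (FEq x y) = 0"
| "br (FRel i xs) = 0"
| "br (FNeg \<phi>) = br \<phi>"
| "br (FOr \<phi> \<psi>) = max (br \<phi>) (br \<psi>)"
| "br (FEx x \<phi>) = Suc (br \<phi>)"
| "br (FPred p ts) = Max (insert 0 (br_tm ` set ts))"
| "br (FNumEx \<kappa> \<phi>) = br \<phi>"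
| "br_tm (TCount xs \<phi>) = Suc (br \<phi>)"
| "br_tm (TInt z) = 0"
| "br_tm (TNumVar \<kappa>) = 0"
| "br_tm (TPlus s t) = max (br_tm s) (br_tm t)"
| "br_tm (TTimes s t) = max (br_tm s) (br_tm t)"

fun count_widths :: "'p fm \<Rightarrow> nat set" and count_widths_tm :: "'p tm \<Rightarrow> nat set" where
  "count_widths FTrue = {}"
| "count_widths (FEq x y) = {}"
| "count_widths (FRel i xs) = {}"
| "count_widths (FNeg \<phi>) = count_widths \<phi>"
| "count_widths (FOr \<phi> \<psi>) = count_widths \<phi> \<union> count_widths \<psi>"
| "count_widths (FEx x \<phi>) = count_widths \<phi>"
| "count_widths (FPred p ts) = (\<Union>t\<in>set ts. count_widths_tm t)"
| "count_widths (FNumEx \<kappa> \<phi>) = count_widths \<phi>"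
| "count_widths_tm (TCount xs \<phi>) = insert (length xs) (count_widths \<phi>)"
| "count_widths_tm (TInt z) = {}"
| "count_widths_tm (TNumVar \<kappa>) = {}"
| "count_widths_tm (TPlus s t) = count_widths_tm s \<union> count_widths_tm t"
| "count_widths_tm (TTimes s t) = count_widths_tm s \<union> count_widths_tm t"

fun has_quant :: "'p fm \<Rightarrow> bool" and has_quant_tm :: "'p tm \<Rightarrow> bool" where
  "has_quant FTrue = False"
| "has_quant (FEq x y) = False"
| "has_quant (FRel i xs) = False"
| "has_quant (FNeg \<phi>) = has_quant \<phi>"
| "has_quant (FOr \<phi> \<psi>) = (has_quant \<phi> \<or> has_quant \<psi>)"
| "has_quant (FEx x \<phi>) = True"
| "has_quant (FPred p ts) = (\<exists>t\<in>set ts. has_quant_tm t)"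
| "has_quant (FNumEx \<kappa> \<phi>) = has_quant \<phi>"
| "has_quant_tm (TCount xs \<phi>) = has_quant \<phi>"
| "has_quant_tm (TInt z) = False"
| "has_quant_tm (TNumVar \<kappa>) = False"
| "has_quant_tm (TPlus s t) = (has_quant_tm s \<or> has_quant_tm t)"
| "has_quant_tm (TTimes s t) = (has_quant_tm s \<or> has_quant_tm t)"

definition bw :: "'p fm \<Rightarrow> nat" where
  "bw \<phi> = (if count_widths \<phi> \<noteq> {} then Max (count_widths \<phi>)
           else if has_quant \<phi> then 1 else 0)"

text \<open>
  \<open>holds P A \<phi> xs us ks ns\<close> is \<open>A \<Turnstile> \<phi>(us; ns)\<close> for the formula \<open>\<phi>(xs; ks)\<close> with structure
  variables \<open>xs\<close> and number variables \<open>ks\<close>; the value \<^const>\<open>undefined\<close> of all other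
  variables is irrelevant, as these do not occur free.
\<close>

definition holds ::
  "'p num_preds \<Rightarrow> 'a struct \<Rightarrow> 'p fm \<Rightarrow> nat list \<Rightarrow> 'a list \<Rightarrow> nat list \<Rightarrow> nat list \<Rightarrow> bool" where
  "holds P A \<phi> xs us ks ns =
     sat P A (upds (\<lambda>_. undefined) xs us) (upds (\<lambda>_. undefined) ks ns) \<phi>"

definition sphere_formula ::
  "signature \<Rightarrow> 'p num_preds \<Rightarrow> nat \<Rightarrow> nat struct \<times> nat list \<Rightarrow> nat list \<Rightarrow> 'p fm \<Rightarrow> bool" where
  "sphere_formula \<sigma> P s \<tau> zs \<psi> \<longleftrightarrow>
     first_order \<psi> \<and> wf_fm \<sigma> P \<psi> \<and> svars \<psi> \<subseteq> set zs \<and>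
     distinct zs \<and> length zs = length (snd \<tau>) \<and>
     (\<forall>(B :: nat struct) bs.
        is_struct \<sigma> B \<longrightarrow> length bs = length zs \<longrightarrow> set bs \<subseteq> univ B \<longrightarrow>
        (holds P B \<psi> zs bs [] [] \<longleftrightarrow> isomorphic (sphere B s bs) \<tau>))"

definition sphere_formulas ::
  "signature \<Rightarrow> 'p num_preds \<Rightarrow> nat \<Rightarrow> nat set \<Rightarrow> 'p fm set" where
  "sphere_formulas \<sigma> P R X =
     {\<psi>. \<exists>s \<tau> zs. s < R \<and> is_type \<sigma> s \<tau> \<and> set zs \<subseteq> X \<and> sphere_formula \<sigma> P s \<tau> zs \<psi>}"

inductive bool_comb :: "'p fm set \<Rightarrow> 'p fm \<Rightarrow> bool" for S where
  bc_true: "bool_comb S FTrue"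
| bc_base: "\<psi> \<in> S \<Longrightarrow> bool_comb S \<psi>"
| bc_neg: "bool_comb S \<phi> \<Longrightarrow> bool_comb S (FNeg \<phi>)"
| bc_or: "bool_comb S \<phi> \<Longrightarrow> bool_comb S \<psi> \<Longrightarrow> bool_comb S (FOr \<phi> \<psi>)"


section \<open>Training sequences\<close>

type_synonym training = "(nat list \<times> bool) list"

definition tuples :: "'a struct \<Rightarrow> nat \<Rightarrow> 'a list set" where
  "tuples B k = {us. length us = k \<and> set us \<subseteq> univ B}"

definition is_training :: "nat struct \<Rightarrow> nat \<Rightarrow> training \<Rightarrow> bool" where
  "is_training B k T \<longleftrightarrow> (\<forall>(us, c)\<in>set T. us \<in> tuples B k)"

definition consistent :: "(nat list \<Rightarrow> bool) \<Rightarrow> training \<Rightarrow> bool" where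
  "consistent H T \<longleftrightarrow> (\<forall>(us, c)\<in>set T. H us = c)"


section \<open>Algorithms with local access\<close>

text \<open>
  Algorithms are programs of Jones' WHILE language, whose data are binary trees, extended by
  two commands for the two kinds of queries to the structure. Unlike in Jones' unit-cost
  measure, evaluating a (sub)expression costs the size of its value. Every step can thus be
  simulated by a (multitape, with the same queries) Turing machine in time polynomial in its cost, and
  conversely, so the notion of polynomial running time agrees with that for Turing machines
  and for random access machines with logarithmic cost.
\<close>

datatype dat = Nl | Pr dat dat

fun dsize :: "dat \<Rightarrow> nat" where
  "dsize Nl = 1"
| "dsize (Pr a b) = Suc (dsize a + dsize b)"

fun dhd :: "dat \<Rightarrow> dat" where
  "dhd Nl = Nl"
| "dhd (Pr a b) = a"

fun dtl :: "dat \<Rightarrow> dat" where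
  "dtl Nl = Nl"
| "dtl (Pr a b) = b"

definition enc_bool :: "bool \<Rightarrow> dat" where
  "enc_bool b = (if b then Pr Nl Nl else Nl)"

text \<open>Binary representation, least significant bit first.\<close>

fun enc_nat :: "nat \<Rightarrow> dat" where
  "enc_nat n = (if n = 0 then Nl else Pr (enc_bool (odd n)) (enc_nat (n div 2)))"

declare enc_nat.simps [simp del]

fun enc_list :: "('a \<Rightarrow> dat) \<Rightarrow> 'a list \<Rightarrow> dat" where
  "enc_list f [] = Nl"
| "enc_list f (x # xs) = Pr (f x) (enc_list f xs)"

definition enc_tuple :: "nat list \<Rightarrow> dat" where
  "enc_tuple us = enc_list enc_nat us"

definition enc_training :: "training \<Rightarrow> dat" where
  "enc_training T = enc_list (\<lambda>(us, c). Pr (enc_tuple us) (enc_bool c)) T"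

text \<open>Only first-order formulas are encoded; the last two equations are dummies.\<close>

fun enc_fm :: "'p fm \<Rightarrow> dat" where
  "enc_fm FTrue = Pr (enc_nat 0) Nl"
| "enc_fm (FEq x y) = Pr (enc_nat 1) (Pr (enc_nat x) (enc_nat y))"
| "enc_fm (FRel i xs) = Pr (enc_nat 2) (Pr (enc_nat i) (enc_tuple xs))"
| "enc_fm (FNeg \<phi>) = Pr (enc_nat 3) (enc_fm \<phi>)"
| "enc_fm (FOr \<phi> \<psi>) = Pr (enc_nat 4) (Pr (enc_fm \<phi>) (enc_fm \<psi>))"
| "enc_fm (FEx x \<phi>) = Pr (enc_nat 5) (Pr (enc_nat x) (enc_fm \<phi>))"
| "enc_fm (FPred p ts) = Nl"
| "enc_fm (FNumEx \<kappa> \<phi>) = Nl"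

definition enc_hypothesis :: "'p fm \<Rightarrow> nat list \<Rightarrow> dat" where
  "enc_hypothesis \<phi> vs = Pr (enc_fm \<phi>) (enc_tuple vs)"

text \<open>The output of a learner that does not return a hypothesis.\<close>

definition no_hypothesis :: dat where
  "no_hypothesis = Nl"

datatype expr =
    EVar nat
  | EQuote dat
  | ECons expr expr
  | EHd expr
  | ETl expr
  | EEq expr expr

type_synonym state = "nat \<Rightarrow> dat"

primrec evale :: "expr \<Rightarrow> state \<Rightarrow> dat" where
  "evale (EVar x) s = s x"
| "evale (EQuote a) s = a"
| "evale (ECons e e') s = Pr (evale e s) (evale e' s)"
| "evale (EHd e) s = dhd (evale e s)"
| "evale (ETl e) s = dtl (evale e s)"
| "evale (EEq e e') s = enc_bool (evale e s = evale e' s)"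

primrec ecost :: "expr \<Rightarrow> state \<Rightarrow> nat" where
  "ecost (EVar x) s = dsize (s x)"
| "ecost (EQuote a) s = dsize a"
| "ecost (ECons e e') s = ecost e s + ecost e' s + dsize (evale (ECons e e') s)"
| "ecost (EHd e) s = ecost e s + dsize (evale (EHd e) s)"
| "ecost (ETl e) s = ecost e s + dsize (evale (ETl e) s)"
| "ecost (EEq e e') s = ecost e s + ecost e' s + dsize (evale (EEq e e') s)"

text \<open>
  \<open>CAskRel x i e\<close> asks whether the tuple \<open>e\<close> belongs to relation \<open>i\<close>, and \<open>CAskNbrs x e\<close>
  asks for a list of the Gaifman neighbors of the element \<open>e\<close>; the answer is stored in \<open>x\<close>.
\<close>

datatype com =
    CSkip
  | CAssign nat expr
  | CSeq com com
  | CIf expr com com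
  | CWhile expr com
  | CAskRel nat nat expr
  | CAskNbrs nat expr

record access =
  ask_rel :: "nat \<Rightarrow> nat list \<Rightarrow> bool"
  ask_nbrs :: "nat \<Rightarrow> nat list"

text \<open>
  \<open>exec \<Omega> c s m s'\<close>: with answers to queries given by \<open>\<Omega>\<close>, program \<open>c\<close> started in state \<open>s\<close> terminates in state
  \<open>s'\<close> at total cost \<open>m\<close>. Malformed queries have no successor state.
\<close>

inductive exec :: "access \<Rightarrow> com \<Rightarrow> state \<Rightarrow> nat \<Rightarrow> state \<Rightarrow> bool" for \<Omega> where
  exec_skip: "exec \<Omega> CSkip s 1 s"
| exec_assign: "exec \<Omega> (CAssign x e) s (1 + ecost e s) (s(x := evale e s))"
| exec_seq: "exec \<Omega> c s m s' \<Longrightarrow> exec \<Omega> c' s' m' s'' \<Longrightarrow>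
    exec \<Omega> (CSeq c c') s (1 + m + m') s''"
| exec_if_true: "evale e s \<noteq> Nl \<Longrightarrow> exec \<Omega> c s m s' \<Longrightarrow>
    exec \<Omega> (CIf e c c') s (1 + ecost e s + m) s'"
| exec_if_false: "evale e s = Nl \<Longrightarrow> exec \<Omega> c' s m s' \<Longrightarrow>
    exec \<Omega> (CIf e c c') s (1 + ecost e s + m) s'"
| exec_while_true: "evale e s \<noteq> Nl \<Longrightarrow> exec \<Omega> c s m s' \<Longrightarrow>
    exec \<Omega> (CWhile e c) s' m' s'' \<Longrightarrow>
    exec \<Omega> (CWhile e c) s (1 + ecost e s + m + m') s''"
| exec_while_false: "evale e s = Nl \<Longrightarrow> exec \<Omega> (CWhile e c) s (1 + ecost e s) s"
| exec_ask_rel: "evale e s = enc_tuple us \<Longrightarrow> a = enc_bool (ask_rel \<Omega> i us) \<Longrightarrow>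
    exec \<Omega> (CAskRel x i e) s (1 + ecost e s + dsize a) (s(x := a))"
| exec_ask_nbrs: "evale e s = enc_nat u \<Longrightarrow> a = enc_tuple (ask_nbrs \<Omega> u) \<Longrightarrow>
    exec \<Omega> (CAskNbrs x e) s (1 + ecost e s + dsize a) (s(x := a))"

text \<open>The input and the output are the initial and the final value of variable \<open>0\<close>.\<close>

definition runs :: "access \<Rightarrow> com \<Rightarrow> dat \<Rightarrow> nat \<Rightarrow> dat \<Rightarrow> bool" where
  "runs \<Omega> c inp m out \<longleftrightarrow> (\<exists>s. exec \<Omega> c ((\<lambda>_. Nl)(0 := inp)) m s \<and> s 0 = out)"

text \<open>
  The order in which neighbors are listed is arbitrary, and nothing is known about the answer
  to a neighbor query for a number that is not an element.
\<close>

definition local_access :: "nat struct \<Rightarrow> access \<Rightarrow> bool" where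
  "local_access B \<Omega> \<longleftrightarrow>
     (\<forall>i us. ask_rel \<Omega> i us \<longleftrightarrow> us \<in> interp B i) \<and>
     (\<forall>u\<in>univ B. distinct (ask_nbrs \<Omega> u) \<and> set (ask_nbrs \<Omega> u) = gaifman_nbrs B u)"


subsection \<open>Encodings are unambiguous and programs are deterministic\<close>

lemma enc_bool_inject [simp]: "enc_bool a = enc_bool b \<longleftrightarrow> a = b"
  by (simp add: enc_bool_def)

lemma enc_nat_inject [simp]: "enc_nat m = enc_nat n \<longleftrightarrow> m = n"
proof
  show "enc_nat m = enc_nat n \<Longrightarrow> m = n"
  proof (induction m arbitrary: n rule: less_induct)
    case (less m)
    show ?case
    proof (cases "m = 0 \<or> n = 0")
      case True
      then show ?thesis
        using less.prems by (auto simp: enc_nat.simps[of m] enc_nat.simps[of n] split: if_splits)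
    next
      case False
      then have "odd m = odd n" "enc_nat (m div 2) = enc_nat (n div 2)"
        using less.prems by (simp_all add: enc_nat.simps[of m] enc_nat.simps[of n])
      moreover from this have "m div 2 = n div 2"
        using less.IH False by simp
      ultimately show ?thesis
        by (metis bit_eq_rec)
    qed
  qed
qed simp

lemma enc_list_inject:
  assumes "inj f"
  shows "enc_list f xs = enc_list f ys \<longleftrightarrow> xs = ys"
proof
  show "enc_list f xs = enc_list f ys \<Longrightarrow> xs = ys"
  proof (induction xs arbitrary: ys)
    case Nil
    then show ?case by (cases ys) auto
  next
    case (Cons x xs)
    then show ?case using assms by (cases ys) (auto dest: injD)
  qed
qed simp

lemma enc_tuple_inject [simp]: "enc_tuple us = enc_tuple vs \<longleftrightarrow> us = vs"
  by (simp add: enc_tuple_def enc_list_inject inj_def)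

lemma enc_training_inject: "enc_training S = enc_training T \<longleftrightarrow> S = T"
  unfolding enc_training_def by (rule enc_list_inject) (auto simp: inj_def)

lemma enc_fm_inject:
  "first_order \<phi> \<Longrightarrow> first_order \<psi> \<Longrightarrow> enc_fm \<phi> = enc_fm \<psi> \<longleftrightarrow> \<phi> = \<psi>"
proof (induction \<phi> arbitrary: \<psi> rule: first_order.induct)
  case 1
  then show ?case by (cases \<psi>) auto
next
  case (2 x y)
  then show ?case by (cases \<psi>) auto
next
  case (3 i xs)
  then show ?case by (cases \<psi>) auto
next
  case (4 \<phi>)
  then show ?case by (cases \<psi>) auto
next
  case (5 \<phi> \<phi>')
  then show ?case by (cases \<psi>) auto
next
  case (6 x \<phi>)
  then show ?case by (cases \<psi>) auto
next
  case (7 p ts)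
  then show ?case by (cases \<psi>) auto
next
  case (8 \<kappa> \<phi>)
  then show ?case by (cases \<psi>) auto
qed

lemma enc_hypothesis_inject:
  "first_order \<phi> \<Longrightarrow> first_order \<psi> \<Longrightarrow>
     enc_hypothesis \<phi> us = enc_hypothesis \<psi> vs \<longleftrightarrow> \<phi> = \<psi> \<and> us = vs"
  by (simp add: enc_hypothesis_def enc_fm_inject)

lemma enc_hypothesis_neq: "enc_hypothesis \<phi> vs \<noteq> no_hypothesis"
  by (simp add: enc_hypothesis_def no_hypothesis_def)

lemma exec_deterministic:
  "exec \<Omega> c s m s' \<Longrightarrow> exec \<Omega> c s n t' \<Longrightarrow> m = n \<and> s' = t'"
proof (induction arbitrary: n t' rule: exec.induct)
  case exec_skip
  then show ?case by (cases rule: exec.cases) auto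
next
  case exec_assign
  then show ?case by (cases rule: exec.cases) auto
next
  case exec_seq
  from exec_seq.prems exec_seq.IH show ?case by (cases rule: exec.cases) blast+
next
  case exec_if_true
  from exec_if_true.prems exec_if_true.IH exec_if_true.hyps show ?case
    by (cases rule: exec.cases) blast+
next
  case exec_if_false
  from exec_if_false.prems exec_if_false.IH exec_if_false.hyps show ?case
    by (cases rule: exec.cases) blast+
next
  case exec_while_true
  from exec_while_true.prems exec_while_true.IH exec_while_true.hyps show ?case
    by (cases rule: exec.cases) blast+
next
  case exec_while_false
  from exec_while_false.prems exec_while_false.hyps show ?case by (cases rule: exec.cases) auto
next
  case exec_ask_rel
  from exec_ask_rel.prems exec_ask_rel.hyps show ?case by (cases rule: exec.cases) auto
next
  case exec_ask_nbrs
  from exec_ask_nbrs.prems exec_ask_nbrs.hyps show ?case by (cases rule: exec.cases) auto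
qed

lemma runs_deterministic:
  "runs \<Omega> c inp m out \<Longrightarrow> runs \<Omega> c inp m' out' \<Longrightarrow> m = m' \<and> out = out'"
  unfolding runs_def using exec_deterministic by blast

end

(*
  A formula of FOCN(P) of binding rank at most r and binding width at most w does not distinguish
  tuples of one structure whose neighbourhoods of radius (2w+1)^r - 1 are isomorphic.  In the
  induction on the formula a block of m <= w counted variables costs only m (2s+1) + s instead of
  the 3^m growth of adding the variables one by one: for two tuples with isomorphic neighbourhoods
  of that radius and every type of radius s, equally many m-tuples extend the one and the other to
  that type.  If part of the m-tuple is linked to the given tuple, it lies inside the isomorphic
  neighbourhoods and induction applies to the rest; the extensions with nothing linked are counted
  by subtracting the linked ones from all m-tuples of the type.

  Hence only the types of the examples together with the parameters matter.  Parameters far from all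
  examples and from the other parameters never help to distinguish examples and can be replaced by
  the element 0, so the learner finds parameters by searching small neighbourhoods of the examples.
  In degree at most d there are finitely many types, and for each type a formula whose quantifiers
  are bounded to neighbourhoods, so all relevant hypotheses can be hardwired into the programs and
  evaluated by following neighbour lists.
*)
theory Submission
  imports Defs "HOL-Library.FuncSet"
begin

text \<open>The predicates in \<open>P\<close> are arbitrary, possibly undecidable, so no counting
  formula is ever evaluated. A consistent one is used only through its inability to tell apart
  tuples of the same type, so it suffices that the learner separates the types of positive examples
  from those of negative ones. The radius arises as follows: around centres more than 2 s + 1 apart,
  balls of radius s neither meet nor touch. A chain of w variables with gaps of at most 2 s + 1,
  plus a ball at its end, needs radius w (2 s + 1) + s. Iterating this r times from 0 stays within
  (2 w + 1)^r - 1. Both programs must be chosen before the structure. Hence the number of types, the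
  search radius and all exponents have to be bounded uniformly over the structures of degree at most
  d, and only the length of element names, about log n, and the number of examples remain in the
  running time. A sphere formula, on the other hand, has to define its type in every finite
  structure, whatever its degree. Formulas and programs are therefore built side by side from the
  same closure properties, but with separate correctness conditions.\<close>

section \<open>Programs running in polynomial time\<close>

text \<open>\<open>wsize\<close> is the quantity in which running times are measured. It is
  independent of the structure, so that the learner and the evaluator can be run on one structure
  with different measures.\<close>

record world =
  wstr :: "nat struct"
  wacc :: access
  wsize :: nat

fun assigned :: "com \<Rightarrow> nat set" where
  "assigned CSkip = {}"
| "assigned (CAssign x e) = {x}"
| "assigned (CSeq c c') = assigned c \<union> assigned c'"
| "assigned (CIf e c c') = assigned c \<union> assigned c'"
| "assigned (CWhile e c) = assigned c"
| "assigned (CAskRel x i e) = {x}"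
| "assigned (CAskNbrs x e) = {x}"

lemma finite_assigned [simp]: "finite (assigned c)"
  by (induction c) auto

lemma exec_frame: "exec \<Omega> c s m s' \<Longrightarrow> y \<notin> assigned c \<Longrightarrow> s' y = s y"
  by (induction rule: exec.induct) auto

lemma fresh_variable:
  assumes "finite X"
  obtains y :: nat where "y \<noteq> 0" "y \<notin> X"
  using ex_new_if_finite[of "insert 0 X"] assms by auto

text \<open>The one loop from which all programs are built. On values of the form
  \<open>enc_bool\<close> it decides a bounded existential quantifier, on encoded hypotheses it is a
  search. \<open>Nl\<close> means false in the first use and no result in the second, in accordance
  with \<open>no_hypothesis\<close>.\<close>

fun first_hit :: "('b \<Rightarrow> dat) \<Rightarrow> 'b list \<Rightarrow> dat" where
  "first_hit f [] = Nl"
| "first_hit f (x # xs) = (if f x \<noteq> Nl then f x else first_hit f xs)"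

lemma first_hit_eq_Nl_iff: "first_hit f xs = Nl \<longleftrightarrow> (\<forall>x\<in>set xs. f x = Nl)"
  by (induction xs) auto

lemma first_hit_hits: "first_hit f xs \<noteq> Nl \<Longrightarrow> \<exists>x\<in>set xs. first_hit f xs = f x"
  by (induction xs) (auto split: if_splits)

lemma enc_bool_eq_Nl [simp]: "enc_bool b = Nl \<longleftrightarrow> \<not> b"
  by (simp add: enc_bool_def)

lemma first_hit_bool: "first_hit (\<lambda>x. enc_bool (Q x)) xs = enc_bool (\<exists>x\<in>set xs. Q x)"
  by (induction xs) (auto simp: enc_bool_def)

lemma dsize_pos [simp]: "0 < dsize a"
  by (cases a) auto

lemma dsize_enc_bool: "dsize (enc_bool b) \<le> 3"
  by (simp add: enc_bool_def)

lemma length_le_dsize: "length xs \<le> dsize (enc_list e xs)"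
  by (induction xs) auto

lemma dsize_enc_list: "(\<And>x. x \<in> set xs \<Longrightarrow> dsize (e x) \<le> b) \<Longrightarrow> dsize (enc_list e xs) \<le> 1 + length xs * (b + 1)"
proof (induction xs)
  case (Cons x xs)
  have "dsize (e x) \<le> b" "dsize (enc_list e xs) \<le> 1 + length xs * (b + 1)"
    using Cons by auto
  then show ?case by simp
qed simp

lemma dsize_enc_list_member: "x \<in> set xs \<Longrightarrow> dsize (e x) \<le> dsize (enc_list e xs)"
  by (induction xs) auto

text \<open>Each bit costs one \<open>Pr\<close> node and at most 3 for the encoded bit
  itself.\<close>

lemma dsize_enc_nat: "u < 2 ^ b \<Longrightarrow> dsize (enc_nat u) \<le> 4 * b + 1"
proof (induction b arbitrary: u)
  case 0
  then show ?case by (simp add: enc_nat.simps)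
next
  case (Suc b)
  show ?case
  proof (cases "u = 0")
    case False
    have "dsize (enc_nat (u div 2)) \<le> 4 * b + 1"
      using Suc.prems by (intro Suc.IH) auto
    then show ?thesis
      using False dsize_enc_bool[of "odd u"] by (simp add: enc_nat.simps[of u])
  qed (simp add: enc_nat.simps)
qed

section \<open>Worlds with local access, and bounds polynomial in their size\<close>

locale small_degree =
  fixes \<sigma> :: signature and d :: nat
begin

text \<open>The element 0 is the default parameter, nameable without any query. The lower bound 2 on
  \<open>wsize\<close> lets powers absorb constants and sums. The exponent 3 leaves room for the
  constant factor in the size of encoded elements.\<close>

definition valid :: "world \<Rightarrow> bool" where
  "valid w \<longleftrightarrow> is_struct \<sigma> (wstr w) \<and> 0 \<in> univ (wstr w) \<and>
     (\<forall>u\<in>univ (wstr w). card (gaifman_nbrs (wstr w) u) \<le> d) \<and>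
     local_access (wstr w) (wacc w) \<and> 2 \<le> wsize w \<and>
     (\<forall>u\<in>univ (wstr w). dsize (enc_nat u) \<le> wsize w ^ 3)"

text \<open>A pure power without coefficient suffices because \<open>valid\<close> keeps the base at
  least 2: a constant n is at most 2^n, and a sum costs a larger exponent. The exponent is uniform
  over all valid worlds, hence over all structures and all access oracles.\<close>

definition poly_bounded :: "(world \<Rightarrow> 'a \<Rightarrow> bool) \<Rightarrow> (world \<Rightarrow> 'a \<Rightarrow> nat) \<Rightarrow> bool" where
  "poly_bounded I f \<longleftrightarrow> (\<exists>p. \<forall>w a. valid w \<longrightarrow> I w a \<longrightarrow> f w a \<le> wsize w ^ p)"

lemma valid_size: "valid w \<Longrightarrow> 2 \<le> wsize w"
  by (simp add: valid_def)

lemma poly_bounded_const [intro]: "poly_bounded I (\<lambda>w a. n)"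
  unfolding poly_bounded_def
proof (intro exI[of _ n] allI impI)
  fix w assume "valid w"
  have "n \<le> 2 ^ n" using less_exp[of n] by simp
  also have "\<dots> \<le> wsize w ^ n" using valid_size[OF \<open>valid w\<close>] by (intro power_mono) auto
  finally show "n \<le> wsize w ^ n" .
qed

lemma poly_bounded_mono:
  assumes "poly_bounded J g"
    and le: "\<And>w a. valid w \<Longrightarrow> I w a \<Longrightarrow> J w (h w a) \<and> f w a \<le> g w (h w a)"
  shows "poly_bounded I f"
proof -
  obtain p where "\<And>w a. valid w \<Longrightarrow> J w a \<Longrightarrow> g w a \<le> wsize w ^ p"
    using assms(1) unfolding poly_bounded_def by blast
  then have "f w a \<le> wsize w ^ p" if "valid w" "I w a" for w a
    using le[OF that] that(1) order_trans by blast
  then show ?thesis unfolding poly_bounded_def by blast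
qed

lemma poly_bounded_le:
  assumes "poly_bounded I g" and "\<And>w a. valid w \<Longrightarrow> I w a \<Longrightarrow> f w a \<le> g w a"
  shows "poly_bounded I f"
  by (rule poly_bounded_mono[OF assms(1), where h = "\<lambda>w a. a"]) (use assms(2) in blast)

lemma poly_bounded_mult [intro]:
  assumes "poly_bounded I f" "poly_bounded I g"
  shows "poly_bounded I (\<lambda>w a. f w a * g w a)"
proof -
  obtain p q where p: "\<And>w a. valid w \<Longrightarrow> I w a \<Longrightarrow> f w a \<le> wsize w ^ p"
    and q: "\<And>w a. valid w \<Longrightarrow> I w a \<Longrightarrow> g w a \<le> wsize w ^ q"
    using assms unfolding poly_bounded_def by meson
  then show ?thesis
    unfolding poly_bounded_def
    by (intro exI[of _ "p + q"]) (auto simp: power_add intro!: mult_le_mono)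
qed

lemma poly_bounded_add [intro]:
  assumes "poly_bounded I f" "poly_bounded I g"
  shows "poly_bounded I (\<lambda>w a. f w a + g w a)"
proof -
  have "poly_bounded I (\<lambda>w a. (f w a + 1) * (g w a + 1))"
  proof -
    obtain p q where p: "\<And>w a. valid w \<Longrightarrow> I w a \<Longrightarrow> f w a \<le> wsize w ^ p"
      and q: "\<And>w a. valid w \<Longrightarrow> I w a \<Longrightarrow> g w a \<le> wsize w ^ q"
      using assms unfolding poly_bounded_def by meson
    have suc: "x + 1 \<le> wsize w ^ Suc p" if "valid w" "x \<le> wsize w ^ p" for w x p
    proof -
      have "x + 1 \<le> wsize w ^ p + wsize w ^ p"
        using that valid_size[OF that(1)] by (intro add_mono) (auto simp: Suc_le_eq)
      also have "\<dots> \<le> wsize w * wsize w ^ p"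
        using valid_size[OF that(1)] by (metis mult_2 mult_le_mono1)
      finally show ?thesis by simp
    qed
    then show ?thesis
      unfolding poly_bounded_def
      by (intro exI[of _ "Suc p + Suc q"] allI impI, subst power_add, intro mult_le_mono suc p q)
  qed
  then show ?thesis by (rule poly_bounded_le) simp
qed

lemma poly_bounded_Suc [intro]:
  assumes "poly_bounded I f"
  shows "poly_bounded I (\<lambda>w a. Suc (f w a))"
  using poly_bounded_add[OF poly_bounded_const[of I 1] assms] by simp

lemma poly_bounded_power [intro]: "poly_bounded I (\<lambda>w a. wsize w ^ p)"
  unfolding poly_bounded_def by blast

text \<open>The two bounds are known only on the inputs that take the respective branch, so each is
  first extended by 0 to the other inputs and then they are added.\<close>

lemma poly_bounded_if [intro]:
  assumes "poly_bounded (\<lambda>w a. I w a \<and> Q w a) f" "poly_bounded (\<lambda>w a. I w a \<and> \<not> Q w a) g"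
  shows "poly_bounded I (\<lambda>w a. if Q w a then f w a else g w a)"
proof -
  have "poly_bounded I (\<lambda>w a. if Q w a then f w a else 0)"
    using assms(1) unfolding poly_bounded_def by (elim exE) (intro exI allI impI, auto)
  moreover have "poly_bounded I (\<lambda>w a. if Q w a then 0 else g w a)"
    using assms(2) unfolding poly_bounded_def by (elim exE) (intro exI allI impI, auto)
  ultimately have "poly_bounded I (\<lambda>w a. (if Q w a then f w a else 0) + (if Q w a then 0 else g w a))"
    by (rule poly_bounded_add)
  then show ?thesis by (rule poly_bounded_le) simp
qed

text \<open>
  Only variable \<open>0\<close> is specified: the program must work whatever the other variables contain, so
  that programs can be composed after saving values in variables that they do not assign.
\<close>

definition computable :: "(world \<Rightarrow> 'a \<Rightarrow> bool) \<Rightarrow> (world \<Rightarrow> 'a \<Rightarrow> dat) \<Rightarrow> (world \<Rightarrow> 'a \<Rightarrow> dat) \<Rightarrow> bool" where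
  "computable I inp out \<longleftrightarrow>
     poly_bounded I (\<lambda>w a. dsize (inp w a)) \<and> poly_bounded I (\<lambda>w a. dsize (out w a)) \<and>
     (\<exists>c T. poly_bounded I T \<and> (\<forall>w a s. valid w \<longrightarrow> I w a \<longrightarrow> s 0 = inp w a \<longrightarrow>
        (\<exists>m s'. exec (wacc w) c s m s' \<and> s' 0 = out w a \<and> m \<le> T w a)))"

section \<open>Closure properties of the maps computable in polynomial time\<close>

lemma computableE:
  assumes "computable I inp out"
  obtains c T where "poly_bounded I (\<lambda>w a. dsize (inp w a))" "poly_bounded I (\<lambda>w a. dsize (out w a))"
    "poly_bounded I T"
    "\<And>w a s. valid w \<Longrightarrow> I w a \<Longrightarrow> s 0 = inp w a \<Longrightarrow>
        \<exists>m s'. exec (wacc w) c s m s' \<and> s' 0 = out w a \<and> m \<le> T w a"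
proof -
  obtain c T where T: "poly_bounded I T" and c: "\<forall>w a s. valid w \<longrightarrow> I w a \<longrightarrow> s 0 = inp w a \<longrightarrow>
        (\<exists>m s'. exec (wacc w) c s m s' \<and> s' 0 = out w a \<and> m \<le> T w a)"
    using assms unfolding computable_def by (elim conjE exE)
  show ?thesis
    by (rule that[of T c]) (use assms T c in \<open>simp_all add: computable_def\<close>)
qed

lemma computableI:
  assumes "poly_bounded I (\<lambda>w a. dsize (inp w a))" "poly_bounded I (\<lambda>w a. dsize (out w a))"
    "poly_bounded I T"
    "\<And>w a s. valid w \<Longrightarrow> I w a \<Longrightarrow> s 0 = inp w a \<Longrightarrow>
        \<exists>m s'. exec (wacc w) c s m s' \<and> s' 0 = out w a \<and> m \<le> T w a"
  shows "computable I inp out"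
  unfolding computable_def by (intro conjI assms exI[of _ c] exI[of _ T] allI impI)

text \<open>The program does not change: the abstract argument only indexes the inputs, so the same
  program serves for any other index set that \<open>h\<close> maps to the original one.\<close>

lemma computable_reindex:
  assumes "computable J inp out" "\<And>w a. valid w \<Longrightarrow> I w a \<Longrightarrow> J w (h w a)"
    and "\<And>w a. valid w \<Longrightarrow> I w a \<Longrightarrow> inp' w a = inp w (h w a)"
    and "\<And>w a. valid w \<Longrightarrow> I w a \<Longrightarrow> out' w a = out w (h w a)"
  shows "computable I inp' out'"
proof -
  obtain c T where 1: "poly_bounded J (\<lambda>w a. dsize (inp w a))" "poly_bounded J (\<lambda>w a. dsize (out w a))"
    "poly_bounded J T" and 2:
    "\<And>w a s. valid w \<Longrightarrow> J w a \<Longrightarrow> s 0 = inp w a \<Longrightarrow>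
        \<exists>m s'. exec (wacc w) c s m s' \<and> s' 0 = out w a \<and> m \<le> T w a"
    by (rule computableE[OF assms(1)]) (rule that, assumption+)
  show ?thesis
  proof (rule computableI[where T = "\<lambda>w a. T w (h w a)" and c = c])
    show "poly_bounded I (\<lambda>w a. dsize (inp' w a))"
      by (rule poly_bounded_mono[OF 1(1), of I h]) (simp add: assms)
    show "poly_bounded I (\<lambda>w a. dsize (out' w a))"
      by (rule poly_bounded_mono[OF 1(2), of I h]) (simp add: assms)
    show "poly_bounded I (\<lambda>w a. T w (h w a))"
      by (rule poly_bounded_mono[OF 1(3), of I h]) (simp add: assms)
  qed (use assms(2-) 2 in auto)
qed

lemma computable_cong:
  assumes "computable I inp out"
    and "\<And>w a. valid w \<Longrightarrow> I' w a \<Longrightarrow> I w a \<and> inp' w a = inp w a \<and> out' w a = out w a"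
  shows "computable I' inp' out'"
  by (rule computable_reindex[OF assms(1), where h = "\<lambda>w a. a"]) (use assms(2) in auto)

lemma computable_sizes:
  assumes "computable I inp out"
  shows "poly_bounded I (\<lambda>w a. dsize (inp w a))" "poly_bounded I (\<lambda>w a. dsize (out w a))"
  using assms unfolding computable_def by auto

lemma computable_assign:
  assumes "poly_bounded I (\<lambda>w a. dsize (inp w a))" "poly_bounded I (\<lambda>w a. dsize (out w a))"
    "poly_bounded I K"
    "\<And>w a s. valid w \<Longrightarrow> I w a \<Longrightarrow> s 0 = inp w a \<Longrightarrow> evale e s = out w a \<and> ecost e s \<le> K w a"
  shows "computable I inp out"
proof (rule computableI[where T = "\<lambda>w a. 1 + K w a" and c = "CAssign 0 e"])
  fix w a and s :: state assume *: "valid w" "I w a" "s 0 = inp w a"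
  show "\<exists>m s'. exec (wacc w) (CAssign 0 e) s m s' \<and> s' 0 = out w a \<and> m \<le> 1 + K w a"
    by (rule exI[of _ "1 + ecost e s"], rule exI, rule conjI, rule exec_assign) (use assms(4)[of w a s] * in auto)
qed (use assms in auto)

lemma computable_id:
  assumes "poly_bounded I (\<lambda>w a. dsize (inp w a))"
  shows "computable I inp inp"
  by (rule computable_assign[where e = "EVar 0", OF assms assms assms]) auto

lemma computable_const:
  assumes "poly_bounded I (\<lambda>w a. dsize (inp w a))"
  shows "computable I inp (\<lambda>w a. b)"
  by (rule computable_assign[where e = "EQuote b" and K = "\<lambda>w a. dsize b", OF assms]) auto

lemma computable_trans:
  assumes "computable I inp mid" "computable I mid out"
  shows "computable I inp out"
proof -
  obtain c1 T1 where "poly_bounded I (\<lambda>w a. dsize (inp w a))" "poly_bounded I (\<lambda>w a. dsize (mid w a))"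
    and 1: "poly_bounded I T1"
    "\<And>w a s. valid w \<Longrightarrow> I w a \<Longrightarrow> s 0 = inp w a \<Longrightarrow>
        \<exists>m s'. exec (wacc w) c1 s m s' \<and> s' 0 = mid w a \<and> m \<le> T1 w a"
    by (rule computableE[OF assms(1)]) (rule that, assumption+)
  obtain c2 T2 where "poly_bounded I (\<lambda>w a. dsize (mid w a))" "poly_bounded I (\<lambda>w a. dsize (out w a))"
    and 2: "poly_bounded I T2"
    "\<And>w a s. valid w \<Longrightarrow> I w a \<Longrightarrow> s 0 = mid w a \<Longrightarrow>
        \<exists>m s'. exec (wacc w) c2 s m s' \<and> s' 0 = out w a \<and> m \<le> T2 w a"
    by (rule computableE[OF assms(2)]) (rule that, assumption+)
  show ?thesis
  proof (rule computableI[where T = "\<lambda>w a. 1 + T1 w a + T2 w a" and c = "CSeq c1 c2"])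
    fix w a and s :: state assume *: "valid w" "I w a" "s 0 = inp w a"
    then obtain m1 s1 where e1: "exec (wacc w) c1 s m1 s1" "s1 0 = mid w a" "m1 \<le> T1 w a"
      using 1(2) by blast
    then obtain m2 s2 where e2: "exec (wacc w) c2 s1 m2 s2" "s2 0 = out w a" "m2 \<le> T2 w a"
      using 2(2) * by blast
    show "\<exists>m s'. exec (wacc w) (CSeq c1 c2) s m s' \<and> s' 0 = out w a \<and> m \<le> 1 + T1 w a + T2 w a"
      using exec_seq[OF e1(1) e2(1)] e1(3) e2(2,3) by (intro exI[of _ "1 + m1 + m2"] exI[of _ s2]) simp
  qed (use computable_sizes[OF assms(1)] computable_sizes[OF assms(2)] 1(1) 2(1) in auto)
qed

lemma computable_hd:
  assumes "computable I inp f"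
  shows "computable I inp (\<lambda>w a. dhd (f w a))"
proof -
  have le: "dsize (dhd x) \<le> dsize x" for x by (cases x) auto
  note f = computable_sizes(2)[OF assms]
  have "computable I f (\<lambda>w a. dhd (f w a))"
    by (rule computable_assign[where e = "EHd (EVar 0)" and K = "\<lambda>w a. dsize (f w a) + dsize (f w a)", OF f])
      (use f le in \<open>auto intro: poly_bounded_le\<close>)
  with assms show ?thesis by (rule computable_trans)
qed

lemma computable_tl:
  assumes "computable I inp f"
  shows "computable I inp (\<lambda>w a. dtl (f w a))"
proof -
  have le: "dsize (dtl x) \<le> dsize x" for x by (cases x) auto
  note f = computable_sizes(2)[OF assms]
  have "computable I f (\<lambda>w a. dtl (f w a))"
    by (rule computable_assign[where e = "ETl (EVar 0)" and K = "\<lambda>w a. dsize (f w a) + dsize (f w a)", OF f])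
      (use f le in \<open>auto intro: poly_bounded_le\<close>)
  with assms show ?thesis by (rule computable_trans)
qed

lemma computable_pair:
  assumes "computable I inp f" "computable I inp g"
  shows "computable I inp (\<lambda>w a. Pr (f w a) (g w a))"
proof -
  obtain c1 T1 where 1: "poly_bounded I (\<lambda>w a. dsize (inp w a))" "poly_bounded I (\<lambda>w a. dsize (f w a))"
    "poly_bounded I T1" and e1:
    "\<And>w a s. valid w \<Longrightarrow> I w a \<Longrightarrow> s 0 = inp w a \<Longrightarrow>
        \<exists>m s'. exec (wacc w) c1 s m s' \<and> s' 0 = f w a \<and> m \<le> T1 w a"
    by (rule computableE[OF assms(1)]) (rule that, assumption+)
  obtain c2 T2 where "poly_bounded I (\<lambda>w a. dsize (inp w a))" and 2: "poly_bounded I (\<lambda>w a. dsize (g w a))"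
    "poly_bounded I T2" and e2:
    "\<And>w a s. valid w \<Longrightarrow> I w a \<Longrightarrow> s 0 = inp w a \<Longrightarrow>
        \<exists>m s'. exec (wacc w) c2 s m s' \<and> s' 0 = g w a \<and> m \<le> T2 w a"
    by (rule computableE[OF assms(2)]) (rule that, assumption+)
  obtain y where y: "y \<noteq> 0" "y \<notin> assigned c1 \<union> assigned c2"
    by (rule fresh_variable[of "assigned c1 \<union> assigned c2"]) auto
  obtain z where z: "z \<noteq> 0" "z \<notin> insert y (assigned c1 \<union> assigned c2)"
    by (rule fresh_variable[of "insert y (assigned c1 \<union> assigned c2)"]) auto
  \<comment> \<open>\<open>y\<close> preserves the input across \<open>c1\<close> for the second
    program, \<open>z\<close> preserves the first result across \<open>c2\<close>.\<close>
  let ?c = "CSeq (CAssign y (EVar 0)) (CSeq c1 (CSeq (CAssign z (EVar 0))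
     (CSeq (CAssign 0 (EVar y)) (CSeq c2 (CAssign 0 (ECons (EVar z) (EVar 0)))))))"
  let ?T = "\<lambda>w a. 9 + T1 w a + T2 w a + 2 * dsize (inp w a) + 3 * dsize (f w a) + 2 * dsize (g w a) + 1"
  show ?thesis
  proof (rule computableI[where T = ?T and c = ?c])
    fix w a and s :: state assume *: "valid w" "I w a" "s 0 = inp w a"
    let ?s0 = "s(y := inp w a)"
    obtain m1 s1 where x1: "exec (wacc w) c1 ?s0 m1 s1" "s1 0 = f w a" "m1 \<le> T1 w a"
      using e1[OF *(1,2), of ?s0] *(3) y(1) by auto
    have s1: "s1 y = inp w a" using exec_frame[OF x1(1), of y] y by simp
    let ?s2 = "s1(z := f w a, 0 := inp w a)"
    obtain m2 s3 where x2: "exec (wacc w) c2 ?s2 m2 s3" "s3 0 = g w a" "m2 \<le> T2 w a"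
      using e2[OF *(1,2), of ?s2] by auto
    have s3: "s3 z = f w a" using exec_frame[OF x2(1), of z] z by simp
    have p: "exec (wacc w) ?c s (1 + (1 + ecost (EVar 0) s) + (1 + m1 + (1 + (1 + ecost (EVar 0) s1) +
       (1 + (1 + ecost (EVar y) (s1(z := evale (EVar 0) s1))) + (1 + m2 + (1 + ecost (ECons (EVar z) (EVar 0)) s3))))))
       (s3(0 := evale (ECons (EVar z) (EVar 0)) s3))"
      apply (rule exec_seq[OF exec_assign])
      apply (rule exec_seq[where s' = s1])
       apply (simp add: *(3) x1(1))
      apply (rule exec_seq[OF exec_assign])
      apply (rule exec_seq[OF exec_assign])
      apply (rule exec_seq[OF _ exec_assign])
      using x2(1) z y s1 x1(2) by simp
    show "\<exists>m s'. exec (wacc w) ?c s m s' \<and> s' 0 = Pr (f w a) (g w a) \<and> m \<le> ?T w a"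
      apply (rule exI, rule exI, rule conjI, rule p)
      using *(3) x1(2,3) x2(2,3) s3 s1 z y by auto
  next
    have "poly_bounded I (\<lambda>w a. 1 + dsize (f w a) + dsize (g w a))"
      using 1 2 by (intro poly_bounded_add poly_bounded_const)
    then show "poly_bounded I (\<lambda>w a. dsize (Pr (f w a) (g w a)))" by (rule poly_bounded_le) simp
    show "poly_bounded I ?T"
      using 1 2 by (intro poly_bounded_add poly_bounded_mult poly_bounded_const)
  qed (use 1 in auto)
qed

lemma computable_eq:
  assumes "computable I inp f" "computable I inp g"
  shows "computable I inp (\<lambda>w a. enc_bool (f w a = g w a))"
proof -
  let ?h = "\<lambda>w a. Pr (f w a) (g w a)"
  have p: "computable I inp ?h" using assms by (rule computable_pair)
  note h = computable_sizes(2)[OF p]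
  have "computable I ?h (\<lambda>w a. enc_bool (f w a = g w a))"
  proof (rule computable_assign[where e = "EEq (EHd (EVar 0)) (ETl (EVar 0))" and
       K = "\<lambda>w a. 4 * dsize (?h w a) + 3", OF h])
    show "poly_bounded I (\<lambda>w a. 4 * dsize (?h w a) + 3)"
      by (intro poly_bounded_add poly_bounded_mult poly_bounded_const h)
    fix w a and s :: state assume *: "valid w" "I w a" "s 0 = ?h w a"
    show "evale (EEq (EHd (EVar 0)) (ETl (EVar 0))) s = enc_bool (f w a = g w a) \<and>
        ecost (EEq (EHd (EVar 0)) (ETl (EVar 0))) s \<le> 4 * dsize (?h w a) + 3"
      using *(3) dsize_enc_bool[of "f w a = g w a"] by simp
  qed (rule poly_bounded_le[OF poly_bounded_const[of _ 3]], rule dsize_enc_bool)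
  with p show ?thesis by (rule computable_trans)
qed

text \<open>Each branch has to be computable only on the inputs that reach it, so time and output
  size are joined by \<open>poly_bounded_if\<close>.\<close>

lemma computable_if:
  assumes "computable I inp b" "computable (\<lambda>w a. I w a \<and> b w a \<noteq> Nl) inp f"
    "computable (\<lambda>w a. I w a \<and> \<not> b w a \<noteq> Nl) inp g"
  shows "computable I inp (\<lambda>w a. if b w a \<noteq> Nl then f w a else g w a)"
proof -
  obtain c0 T0 where 0: "poly_bounded I (\<lambda>w a. dsize (inp w a))" "poly_bounded I (\<lambda>w a. dsize (b w a))"
    "poly_bounded I T0" and e0:
    "\<And>w a s. valid w \<Longrightarrow> I w a \<Longrightarrow> s 0 = inp w a \<Longrightarrow>
        \<exists>m s'. exec (wacc w) c0 s m s' \<and> s' 0 = b w a \<and> m \<le> T0 w a"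
    by (rule computableE[OF assms(1)]) (rule that, assumption+)
  obtain c1 T1 where "poly_bounded (\<lambda>w a. I w a \<and> b w a \<noteq> Nl) (\<lambda>w a. dsize (inp w a))"
    and 1: "poly_bounded (\<lambda>w a. I w a \<and> b w a \<noteq> Nl) (\<lambda>w a. dsize (f w a))"
    "poly_bounded (\<lambda>w a. I w a \<and> b w a \<noteq> Nl) T1" and e1:
    "\<And>w a s. valid w \<Longrightarrow> I w a \<and> b w a \<noteq> Nl \<Longrightarrow> s 0 = inp w a \<Longrightarrow>
        \<exists>m s'. exec (wacc w) c1 s m s' \<and> s' 0 = f w a \<and> m \<le> T1 w a"
    by (rule computableE[OF assms(2)]) (rule that, assumption+)
  obtain c2 T2 where "poly_bounded (\<lambda>w a. I w a \<and> \<not> b w a \<noteq> Nl) (\<lambda>w a. dsize (inp w a))"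
    and 2: "poly_bounded (\<lambda>w a. I w a \<and> \<not> b w a \<noteq> Nl) (\<lambda>w a. dsize (g w a))"
    "poly_bounded (\<lambda>w a. I w a \<and> \<not> b w a \<noteq> Nl) T2" and e2:
    "\<And>w a s. valid w \<Longrightarrow> I w a \<and> \<not> b w a \<noteq> Nl \<Longrightarrow> s 0 = inp w a \<Longrightarrow>
        \<exists>m s'. exec (wacc w) c2 s m s' \<and> s' 0 = g w a \<and> m \<le> T2 w a"
    by (rule computableE[OF assms(3)]) (rule that, assumption+)
  obtain y where y: "y \<noteq> 0" "y \<notin> assigned c0"
    by (rule fresh_variable[of "assigned c0"]) auto
  obtain z where z: "z \<noteq> 0" "z \<notin> {y}"
    by (rule fresh_variable[of "{y}"]) auto
  let ?c = "CSeq (CAssign y (EVar 0)) (CSeq c0 (CSeq (CAssign z (EVar 0))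
     (CSeq (CAssign 0 (EVar y)) (CIf (EVar z) c1 c2))))"
  let ?R = "\<lambda>w a. if b w a \<noteq> Nl then T1 w a else T2 w a"
  let ?T = "\<lambda>w a. 8 + T0 w a + 2 * dsize (inp w a) + 2 * dsize (b w a) + ?R w a"
  have R: "poly_bounded I ?R" using 1 2 by (intro poly_bounded_if)
  show ?thesis
  proof (rule computableI[where T = ?T and c = ?c])
    fix w a and s :: state assume *: "valid w" "I w a" "s 0 = inp w a"
    let ?s0 = "s(y := inp w a)"
    obtain m1 s1 where x1: "exec (wacc w) c0 ?s0 m1 s1" "s1 0 = b w a" "m1 \<le> T0 w a"
      using e0[OF *(1,2), of ?s0] *(3) y(1) by auto
    have s1: "s1 y = inp w a" using exec_frame[OF x1(1), of y] y by simp
    let ?s2 = "s1(z := b w a, 0 := inp w a)"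
    have "\<exists>m s3. exec (wacc w) (CIf (EVar z) c1 c2) ?s2 m s3 \<and> s3 0 = (if b w a \<noteq> Nl then f w a else g w a)
       \<and> m \<le> 1 + dsize (b w a) + ?R w a"
    proof (cases "b w a = Nl")
      case False
      then obtain m2 s3 where x2: "exec (wacc w) c1 ?s2 m2 s3" "s3 0 = f w a" "m2 \<le> T1 w a"
        using e1[OF *(1), of a ?s2] * by auto
      show ?thesis
        by (intro exI conjI, rule exec_if_true[OF _ x2(1)]) (use False x2 z in auto)
    next
      case True
      then obtain m2 s3 where x2: "exec (wacc w) c2 ?s2 m2 s3" "s3 0 = g w a" "m2 \<le> T2 w a"
        using e2[OF *(1), of a ?s2] * by auto
      show ?thesis
        by (intro exI conjI, rule exec_if_false[OF _ x2(1)]) (use True x2 z in auto)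
    qed
    then obtain m2 s3 where x2: "exec (wacc w) (CIf (EVar z) c1 c2) ?s2 m2 s3"
      "s3 0 = (if b w a \<noteq> Nl then f w a else g w a)" "m2 \<le> 1 + dsize (b w a) + ?R w a"
      by blast
    have p: "exec (wacc w) ?c s (1 + (1 + ecost (EVar 0) s) + (1 + m1 + (1 + (1 + ecost (EVar 0) s1) +
       (1 + (1 + ecost (EVar y) (s1(z := evale (EVar 0) s1))) + m2)))) s3"
      apply (rule exec_seq[OF exec_assign])
      apply (rule exec_seq[where s' = s1])
       apply (simp add: *(3) x1(1))
      apply (rule exec_seq[OF exec_assign])
      apply (rule exec_seq[OF exec_assign])
      using x2(1) z y s1 x1(2) by simp
    show "\<exists>m s'. exec (wacc w) ?c s m s' \<and> s' 0 = (if b w a \<noteq> Nl then f w a else g w a) \<and> m \<le> ?T w a"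
      by (rule exI, rule exI, rule conjI, rule p) (use *(3) x1(2,3) x2(2,3) s1 z y in auto)
  next
    have "poly_bounded I (\<lambda>w a. if b w a \<noteq> Nl then dsize (f w a) else dsize (g w a))"
      using 1 2 by (intro poly_bounded_if)
    then show "poly_bounded I (\<lambda>w a. dsize (if b w a \<noteq> Nl then f w a else g w a))"
      by (rule poly_bounded_le) simp
    show "poly_bounded I ?T"
      using 0 R by (intro poly_bounded_add poly_bounded_mult poly_bounded_const)
  qed (use 0 in auto)
qed

section \<open>Queries to the structure and loops over computed lists\<close>

lemma computable_ask_rel:
  assumes "computable I inp (\<lambda>w a. enc_tuple (us w a))"
  shows "computable I inp (\<lambda>w a. enc_bool (us w a \<in> interp (wstr w) i))"
proof -
  let ?h = "\<lambda>w a. enc_tuple (us w a)"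
  note h = computable_sizes(2)[OF assms]
  have "computable I ?h (\<lambda>w a. enc_bool (us w a \<in> interp (wstr w) i))"
  proof (rule computableI[where T = "\<lambda>w a. 1 + dsize (?h w a) + 3" and c = "CAskRel 0 i (EVar 0)"])
    show "poly_bounded I (\<lambda>w a. dsize (enc_bool (us w a \<in> interp (wstr w) i)))"
      by (rule poly_bounded_le[OF poly_bounded_const[of _ 3]]) (rule dsize_enc_bool)
    fix w a and s :: state assume *: "valid w" "I w a" "s 0 = ?h w a"
    show "\<exists>m s'. exec (wacc w) (CAskRel 0 i (EVar 0)) s m s' \<and> s' 0 = enc_bool (us w a \<in> interp (wstr w) i) \<and>
        m \<le> 1 + dsize (?h w a) + 3"
      apply (intro exI conjI)
        apply (rule exec_ask_rel)
         apply (simp add: *)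
        apply (rule refl)
      using * dsize_enc_bool by (auto simp: valid_def local_access_def)
  qed (use h in auto)
  with assms show ?thesis by (rule computable_trans)
qed

lemma poly_bounded_enc_nat:
  assumes "\<And>w a. valid w \<Longrightarrow> I w a \<Longrightarrow> u w a \<in> univ (wstr w)"
  shows "poly_bounded I (\<lambda>w a. dsize (enc_nat (u w a)))"
  unfolding poly_bounded_def using assms by (auto simp: valid_def intro!: exI[of _ 3])

lemma poly_bounded_enc_list:
  assumes "poly_bounded I (\<lambda>w a. length (us w a))" and "poly_bounded I b"
    and "\<And>w a x. valid w \<Longrightarrow> I w a \<Longrightarrow> x \<in> set (us w a) \<Longrightarrow> dsize (e x) \<le> b w a"
  shows "poly_bounded I (\<lambda>w a. dsize (enc_list e (us w a)))"
proof -
  have "poly_bounded I (\<lambda>w a. 1 + length (us w a) * (b w a + 1))"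
    using assms(1,2) by (intro poly_bounded_add poly_bounded_mult poly_bounded_const)
  then show ?thesis
    by (rule poly_bounded_le) (use assms(3) in \<open>auto intro!: dsize_enc_list[simplified]\<close>)
qed

lemma poly_bounded_enc_tuple:
  assumes "poly_bounded I (\<lambda>w a. length (us w a))"
    and "\<And>w a. valid w \<Longrightarrow> I w a \<Longrightarrow> set (us w a) \<subseteq> univ (wstr w)"
  shows "poly_bounded I (\<lambda>w a. dsize (enc_tuple (us w a)))"
  unfolding enc_tuple_def
proof (rule poly_bounded_enc_list[OF assms(1)])
  show "poly_bounded I (\<lambda>w a. wsize w ^ 3)" unfolding poly_bounded_def by blast
  fix w a x assume "valid w" "I w a" "x \<in> set (us w a)"
  then show "dsize (enc_nat x) \<le> wsize w ^ 3"
    using assms(2)[of w a] unfolding valid_def by blast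
qed

lemma gaifman_univ:
  assumes B: "is_struct \<sigma> B" and uv: "(u, v) \<in> gaifman B"
  shows "u \<in> univ B \<and> v \<in> univ B"
proof -
  obtain i us where us: "us \<in> interp B i" "u \<in> set us" "v \<in> set us"
    using uv unfolding gaifman_def by blast
  then have "i < length \<sigma>" using B unfolding is_struct_def by (metis empty_iff leI)
  then have "set us \<subseteq> univ B" using B us(1) unfolding is_struct_def by blast
  then show ?thesis using us by blast
qed

lemma valid_nbrs:
  assumes "valid w" "u \<in> univ (wstr w)"
  shows "set (ask_nbrs (wacc w) u) = gaifman_nbrs (wstr w) u" "length (ask_nbrs (wacc w) u) \<le> d"
    "set (ask_nbrs (wacc w) u) \<subseteq> univ (wstr w)"
proof -
  have 1: "distinct (ask_nbrs (wacc w) u)" "set (ask_nbrs (wacc w) u) = gaifman_nbrs (wstr w) u"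
    using assms by (auto simp: valid_def local_access_def)
  then show "set (ask_nbrs (wacc w) u) = gaifman_nbrs (wstr w) u" by simp
  show "length (ask_nbrs (wacc w) u) \<le> d"
    using assms unfolding distinct_card[OF 1(1), symmetric] 1(2) valid_def by blast
  show "set (ask_nbrs (wacc w) u) \<subseteq> univ (wstr w)"
    using assms(1) gaifman_univ[of "wstr w"] unfolding 1(2) gaifman_nbrs_def valid_def by blast
qed

text \<open>That \<open>u\<close> is an element bounds the size of the answer: at most
  \<open>d\<close> entries, each of them an element with a short encoding. For a number outside the
  universe the oracle could answer anything.\<close>

lemma computable_ask_nbrs:
  assumes "computable I inp (\<lambda>w a. enc_nat (u w a))"
    and u: "\<And>w a. valid w \<Longrightarrow> I w a \<Longrightarrow> u w a \<in> univ (wstr w)"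
  shows "computable I inp (\<lambda>w a. enc_tuple (ask_nbrs (wacc w) (u w a)))"
proof -
  let ?h = "\<lambda>w a. enc_nat (u w a)"
  let ?o = "\<lambda>w a. enc_tuple (ask_nbrs (wacc w) (u w a))"
  note h = computable_sizes(2)[OF assms(1)]
  have o: "poly_bounded I (\<lambda>w a. dsize (?o w a))"
  proof (rule poly_bounded_enc_tuple[OF poly_bounded_le[OF poly_bounded_const[of _ d]]])
    fix w a assume *: "valid w" "I w a"
    show "length (ask_nbrs (wacc w) (u w a)) \<le> d" "set (ask_nbrs (wacc w) (u w a)) \<subseteq> univ (wstr w)"
      using valid_nbrs[OF *(1) u[OF *]] by simp_all
  qed
  have "computable I ?h ?o"
  proof (rule computableI[where T = "\<lambda>w a. 1 + dsize (?h w a) + dsize (?o w a)" and c = "CAskNbrs 0 (EVar 0)"])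
    fix w a and s :: state assume *: "valid w" "I w a" "s 0 = ?h w a"
    show "\<exists>m s'. exec (wacc w) (CAskNbrs 0 (EVar 0)) s m s' \<and> s' 0 = ?o w a \<and>
        m \<le> 1 + dsize (?h w a) + dsize (?o w a)"
      apply (intro exI conjI)
        apply (rule exec_ask_nbrs)
         apply (simp add: *)
        apply (rule refl)
      using * by auto
  qed (use h o in auto)
  with assms(1) show ?thesis by (rule computable_trans)
qed

text \<open>The body is a program on pairs of the input and one list entry, correct under its own
  invariant \<open>J\<close>. The number of rounds is at most the size of the encoded list, which is
  polynomially bounded, so it remains to bound one round uniformly.\<close>

lemma computable_first_hit:
  assumes list: "computable I inp (\<lambda>w a. enc_list e (xs w a))"
    and body: "computable J (\<lambda>w (a, x). Pr (inp w a) (e x)) (\<lambda>w (a, x). f w a x)"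
    and J: "\<And>w a x. valid w \<Longrightarrow> I w a \<Longrightarrow> x \<in> set (xs w a) \<Longrightarrow> J w (a, x)"
  shows "computable I inp (\<lambda>w a. first_hit (f w a) (xs w a))"
proof -
  obtain c0 T0 where 0: "poly_bounded I (\<lambda>w a. dsize (inp w a))" "poly_bounded I (\<lambda>w a. dsize (enc_list e (xs w a)))"
    "poly_bounded I T0" and e0:
    "\<And>w a s. valid w \<Longrightarrow> I w a \<Longrightarrow> s 0 = inp w a \<Longrightarrow>
        \<exists>m s'. exec (wacc w) c0 s m s' \<and> s' 0 = enc_list e (xs w a) \<and> m \<le> T0 w a"
    by (rule computableE[OF list]) (rule that, assumption+)
  obtain c1 T1 where 1: "poly_bounded J (\<lambda>w a. dsize (case a of (a, x) \<Rightarrow> Pr (inp w a) (e x)))"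
    "poly_bounded J (\<lambda>w a. dsize (case a of (a, x) \<Rightarrow> f w a x))" "poly_bounded J T1" and e1':
    "\<And>w a s. valid w \<Longrightarrow> J w a \<Longrightarrow> s 0 = (case a of (a, x) \<Rightarrow> Pr (inp w a) (e x)) \<Longrightarrow>
        \<exists>m s'. exec (wacc w) c1 s m s' \<and> s' 0 = (case a of (a, x) \<Rightarrow> f w a x) \<and> m \<le> T1 w a"
    by (rule computableE[OF body]) (rule that, assumption+)
  have e1: "\<exists>m s'. exec (wacc w) c1 s m s' \<and> s' 0 = f w a x \<and> m \<le> T1 w (a, x)"
    if "valid w" "J w (a, x)" "s 0 = Pr (inp w a) (e x)" for w a x s
    using e1'[of w "(a, x)" s] that by simp
  \<comment> \<open>The body's bound depends on the entry. Passing to a power of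
    \<open>wsize w\<close> makes it independent of the entry, so that it can be multiplied by the
    number of rounds.\<close>
  obtain p where p: "\<And>w a. valid w \<Longrightarrow> J w a \<Longrightarrow> T1 w a \<le> wsize w ^ p"
    using 1(3) unfolding poly_bounded_def by blast
  obtain q where q: "\<And>w a. valid w \<Longrightarrow> J w a \<Longrightarrow> dsize (case a of (a, x) \<Rightarrow> f w a x) \<le> wsize w ^ q"
    using 1(2) unfolding poly_bounded_def by blast
  obtain y where y: "y \<noteq> 0" "y \<notin> assigned c0 \<union> assigned c1"
    by (rule fresh_variable[of "assigned c0 \<union> assigned c1"]) auto
  obtain z where z: "z \<noteq> 0" "z \<notin> insert y (assigned c1)"
    by (rule fresh_variable[of "insert y (assigned c1)"]) auto
  let ?e = "ECons (EVar y) (EHd (EVar z))"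
  \<comment> \<open>A hit empties the remaining list \<open>z\<close>, which ends the loop with the
    hit still in variable 0.\<close>
  let ?if = "CIf (EVar 0) (CAssign z (EQuote Nl)) (CAssign z (ETl (EVar z)))"
  let ?b = "CSeq (CAssign 0 ?e) (CSeq c1 ?if)"
  let ?wh = "CWhile (EVar z) ?b"
  let ?L = "\<lambda>w a. dsize (enc_list e (xs w a))"
  let ?K = "\<lambda>w a. 20 + 4 * dsize (inp w a) + 10 * ?L w a + wsize w ^ p + wsize w ^ q"
  \<comment> \<open>\<open>s 0 = Nl\<close> is the value left as the result when the list is
    exhausted; every miss restores it.\<close>
  have loop: "\<exists>m s'. exec (wacc w) ?wh s m s' \<and> s' 0 = first_hit (f w a) l \<and> m \<le> (length l + 1) * ?K w a"
    if "valid w" "I w a" "s y = inp w a" "s z = enc_list e l" "set l \<subseteq> set (xs w a)"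
      "dsize (enc_list e l) \<le> ?L w a" "s 0 = Nl" for w a s l
    using that
  proof (induction l arbitrary: s)
    case Nil
    show ?case
      by (intro exI conjI, rule exec_while_false) (use Nil in auto)
  next
    case (Cons x l)
    let ?s1 = "s(0 := Pr (inp w a) (e x))"
    have j: "J w (a, x)" using Cons.prems J by auto
    obtain m2 s2 where x2: "exec (wacc w) c1 ?s1 m2 s2" "s2 0 = f w a x" "m2 \<le> T1 w (a, x)"
      using e1[OF Cons.prems(1) j, of ?s1] by auto
    have s2: "s2 y = inp w a" "s2 z = Pr (e x) (enc_list e l)"
      using exec_frame[OF x2(1), of y] exec_frame[OF x2(1), of z] y z Cons.prems by auto
    have m2: "m2 \<le> wsize w ^ p" using x2(3) p[OF Cons.prems(1) j] by linarith
    have f2: "dsize (f w a x) \<le> wsize w ^ q" using q[OF Cons.prems(1) j] by simp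
    let ?s3 = "s2(z := if f w a x \<noteq> Nl then Nl else enc_list e l)"
    have "\<exists>m3. exec (wacc w) ?if s2 m3 ?s3 \<and> m3 \<le> 4 + wsize w ^ q + 2 * ?L w a"
    proof (cases "f w a x = Nl")
      case False
      have a: "exec (wacc w) (CAssign z (EQuote Nl)) s2 (1 + ecost (EQuote Nl) s2) ?s3"
        using exec_assign[of "wacc w" z "EQuote Nl" s2] False by simp
      show ?thesis
        by (intro exI conjI, rule exec_if_true[OF _ a]) (use False x2(2) f2 in auto)
    next
      case True
      have a: "exec (wacc w) (CAssign z (ETl (EVar z))) s2 (1 + ecost (ETl (EVar z)) s2) ?s3"
        using exec_assign[of "wacc w" z "ETl (EVar z)" s2] True s2 by simp
      show ?thesis
        by (intro exI conjI, rule exec_if_false[OF _ a]) (use True x2(2) f2 s2 Cons.prems in auto)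
    qed
    then obtain m3 where m3: "exec (wacc w) ?if s2 m3 ?s3" "m3 \<le> 4 + wsize w ^ q + 2 * ?L w a"
      by blast
    have sz: "dsize (s z) \<le> ?L w a" "dsize (e x) \<le> ?L w a" using Cons.prems by auto
    have b: "exec (wacc w) ?b s (1 + (1 + ecost ?e s) + (1 + m2 + m3)) ?s3"
      apply (rule exec_seq[OF exec_assign])
      apply (rule exec_seq[OF _ m3(1)])
      using x2(1) Cons.prems by simp
    have "\<exists>m4 s'. exec (wacc w) ?wh ?s3 m4 s' \<and> s' 0 = first_hit (f w a) (x # l) \<and> m4 \<le> (length l + 1) * ?K w a"
    proof (cases "f w a x = Nl")
      case True
      have "\<exists>m s'. exec (wacc w) ?wh ?s3 m s' \<and> s' 0 = first_hit (f w a) l \<and> m \<le> (length l + 1) * ?K w a"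
        by (rule Cons.IH) (use Cons.prems True s2 x2(2) y z in auto)
      then show ?thesis using True by simp
    next
      case False
      show ?thesis
        by (intro exI conjI, rule exec_while_false) (use False x2(2) z in auto)
    qed
    then obtain m4 s' where m4: "exec (wacc w) ?wh ?s3 m4 s'" "s' 0 = first_hit (f w a) (x # l)"
      "m4 \<le> (length l + 1) * ?K w a" by blast
    have cost: "1 + ecost (EVar z) s + (1 + (1 + ecost ?e s) + (1 + m2 + m3)) \<le> ?K w a"
      using m2 m3(2) sz Cons.prems(3,4) by simp
    have "exec (wacc w) ?wh s (1 + ecost (EVar z) s + (1 + (1 + ecost ?e s) + (1 + m2 + m3)) + m4) s'"
      by (rule exec_while_true[OF _ b m4(1)]) (use Cons.prems in simp)
    then show ?case
      apply (intro exI conjI)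
        apply assumption
       apply (rule m4(2))
      using cost m4(3) by simp
  qed
  let ?c = "CSeq (CAssign y (EVar 0)) (CSeq c0 (CSeq (CAssign z (EVar 0))
     (CSeq (CAssign 0 (EQuote Nl)) ?wh)))"
  let ?T = "\<lambda>w a. 9 + T0 w a + dsize (inp w a) + ?L w a + (?L w a + 1) * ?K w a"
  show ?thesis
  proof (rule computableI[where T = ?T and c = ?c])
    fix w a and s :: state assume *: "valid w" "I w a" "s 0 = inp w a"
    let ?s0 = "s(y := inp w a)"
    obtain m1 s1 where x1: "exec (wacc w) c0 ?s0 m1 s1" "s1 0 = enc_list e (xs w a)" "m1 \<le> T0 w a"
      using e0[OF *(1,2), of ?s0] *(3) y(1) by auto
    have s1: "s1 y = inp w a" using exec_frame[OF x1(1), of y] y by simp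
    let ?s2 = "s1(z := enc_list e (xs w a), 0 := Nl)"
    obtain m2 s3 where x2: "exec (wacc w) ?wh ?s2 m2 s3"
      "s3 0 = first_hit (f w a) (xs w a)" "m2 \<le> (length (xs w a) + 1) * ?K w a"
      using loop[OF *(1,2), of ?s2 "xs w a"] s1 y z by auto
    have "(length (xs w a) + 1) * ?K w a \<le> (?L w a + 1) * ?K w a"
      using length_le_dsize by (intro mult_le_mono1) simp
    with x2(3) have m2: "m2 \<le> (?L w a + 1) * ?K w a" by linarith
    have p: "exec (wacc w) ?c s (1 + (1 + ecost (EVar 0) s) + (1 + m1 + (1 + (1 + ecost (EVar 0) s1) +
       (1 + (1 + ecost (EQuote Nl) (s1(z := evale (EVar 0) s1))) + m2)))) s3"
      apply (rule exec_seq[OF exec_assign])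
      apply (rule exec_seq[where s' = s1])
       apply (simp add: *(3) x1(1))
      apply (rule exec_seq[OF exec_assign])
      apply (rule exec_seq[OF exec_assign])
      using x2(1) z y s1 x1(2) by simp
    show "\<exists>m s'. exec (wacc w) ?c s m s' \<and> s' 0 = first_hit (f w a) (xs w a) \<and> m \<le> ?T w a"
      by (rule exI, rule exI, rule conjI, rule p) (use *(3) x1(2,3) x2(2) m2 s1 z y in auto)
  next
    show "poly_bounded I (\<lambda>w a. dsize (first_hit (f w a) (xs w a)))"
    proof (rule poly_bounded_le[OF poly_bounded_add[OF poly_bounded_const[of _ 1] poly_bounded_power[of _ q]]])
      fix w a assume *: "valid w" "I w a"
      show "dsize (first_hit (f w a) (xs w a)) \<le> 1 + wsize w ^ q"
      proof (cases "first_hit (f w a) (xs w a) = Nl")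
        case False
        then obtain x where x: "x \<in> set (xs w a)" "first_hit (f w a) (xs w a) = f w a x"
          using first_hit_hits by metis
        then show ?thesis using q[OF *(1) J[OF * x(1)]] by simp
      qed simp
    qed
  next
    show "poly_bounded I ?T"
      using 0 by (intro poly_bounded_add poly_bounded_mult poly_bounded_const poly_bounded_power)
  qed (use 0 in auto)
qed

end

section \<open>Local queries\<close>

lemma nbhd_0: "u \<in> univ B \<Longrightarrow> nbhd B 0 [u] = {u}"
  by (auto simp: nbhd_def)

text \<open>Peels off the first step of a walk, because that is the step made by a neighbour query
  at \<open>u\<close>.\<close>

lemma nbhd_Suc:
  assumes "u \<in> univ B"
  shows "v \<in> nbhd B (Suc s) [u] \<longleftrightarrow> v = u \<or> (\<exists>y\<in>gaifman_nbrs B u. v \<in> nbhd B s [y])"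
proof
  assume "v \<in> nbhd B (Suc s) [u]"
  then obtain m where m: "v \<in> univ B" "m \<le> Suc s" "(u, v) \<in> gaifman B ^^ m"
    by (auto simp: nbhd_def)
  show "v = u \<or> (\<exists>y\<in>gaifman_nbrs B u. v \<in> nbhd B s [y])"
  proof (cases m)
    case 0
    then show ?thesis using m by auto
  next
    case (Suc m')
    with m obtain y where "(u, y) \<in> gaifman B" "(y, v) \<in> gaifman B ^^ m'"
      by (meson relpow_Suc_D2)
    with m Suc show ?thesis by (auto simp: nbhd_def gaifman_nbrs_def)
  qed
next
  assume "v = u \<or> (\<exists>y\<in>gaifman_nbrs B u. v \<in> nbhd B s [y])"
  then show "v \<in> nbhd B (Suc s) [u]"
  proof
    assume "v = u"
    then show ?thesis using assms by (auto simp: nbhd_def intro!: exI[of _ 0])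
  next
    assume "\<exists>y\<in>gaifman_nbrs B u. v \<in> nbhd B s [y]"
    then obtain y m where "(u, y) \<in> gaifman B" "v \<in> univ B" "m \<le> s" "(y, v) \<in> gaifman B ^^ m"
      by (auto simp: nbhd_def gaifman_nbrs_def)
    then show ?thesis
      by (auto simp: nbhd_def intro!: exI[of _ "Suc m"] relpow_Suc_I2)
  qed
qed

lemma nbhd_Union: "v \<in> nbhd B s us \<longleftrightarrow> (\<exists>u\<in>set us. v \<in> nbhd B s [u])"
  by (auto simp: nbhd_def)

lemma tuples_iff: "us \<in> tuples B m \<longleftrightarrow> length us = m \<and> set us \<subseteq> univ B"
  by (auto simp: tuples_def)

lemma tuples_Cons: "z # us \<in> tuples B (Suc m) \<longleftrightarrow> z \<in> univ B \<and> us \<in> tuples B m"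
  by (auto simp: tuples_def)

lemma tuples_nth: "us \<in> tuples B m \<Longrightarrow> i < m \<Longrightarrow> us ! i \<in> univ B"
  by (auto simp: tuples_def)

lemma tuples_map_nth: "us \<in> tuples B m \<Longrightarrow> set js \<subseteq> {..<m} \<Longrightarrow> map ((!) us) js \<in> tuples B (length js)"
  by (auto simp: tuples_def intro!: subsetD[OF _ nth_mem])

locale hypothesis_class = small_degree \<sigma> d for \<sigma> d +
  fixes P :: "'p num_preds"
begin

section \<open>Programs on encoded lists and tuples\<close>

lemma computable_drop:
  assumes "computable I inp (\<lambda>w a. enc_list e (xs w a))"
  shows "computable I inp (\<lambda>w a. enc_list e (drop i (xs w a)))"
proof (induction i)
  case (Suc i)
  show ?case
    by (rule computable_cong[OF computable_tl[OF Suc]])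
      (metis Suc dhd.simps dtl.simps drop_Suc tl_drop enc_list.elims list.sel(2,3))
qed (use assms in simp)

lemma computable_nth:
  assumes "computable I inp (\<lambda>w a. enc_list e (xs w a))"
    and "\<And>w a. valid w \<Longrightarrow> I w a \<Longrightarrow> i < length (xs w a)"
  shows "computable I inp (\<lambda>w a. e (xs w a ! i))"
proof (rule computable_cong[OF computable_hd[OF computable_drop[OF assms(1), of i]]])
  fix w a assume "valid w" "I w a"
  then have "drop i (xs w a) = xs w a ! i # drop (Suc i) (xs w a)"
    using assms(2) by (simp add: Cons_nth_drop_Suc)
  then show "I w a \<and> inp w a = inp w a \<and> e (xs w a ! i) = dhd (enc_list e (drop i (xs w a)))"
    using \<open>I w a\<close> by simp
qed

text \<open>The index list \<open>js\<close> is fixed and not part of the input, so the program is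
  unrolled into one pairing per index.\<close>

lemma computable_enc_list:
  assumes "poly_bounded I (\<lambda>w a. dsize (inp w a))"
    and "\<And>j. j \<in> set js \<Longrightarrow> computable I inp (\<lambda>w a. e (f w a j))"
  shows "computable I inp (\<lambda>w a. enc_list e (map (f w a) js))"
  using assms(2)
proof (induction js)
  case Nil
  show ?case using computable_const[OF assms(1)] by simp
next
  case (Cons j js)
  then show ?case by (auto intro!: computable_pair)
qed

lemma computable_not:
  assumes "computable I inp (\<lambda>w a. enc_bool (b w a))"
  shows "computable I inp (\<lambda>w a. enc_bool (\<not> b w a))"
proof -
  have s: "poly_bounded J (\<lambda>w a. dsize (inp w a))" if "\<And>w a. J w a \<Longrightarrow> I w a" for J
    by (rule poly_bounded_mono[OF computable_sizes(1)[OF assms], where h = "\<lambda>w a. a"]) (use that in auto)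
  show ?thesis
    by (rule computable_cong[OF computable_if[OF assms computable_const[of _ _ Nl] computable_const[of _ _ "Pr Nl Nl"]]])
      (auto intro: s simp: enc_bool_def)
qed

lemma computable_or:
  assumes "computable I inp (\<lambda>w a. enc_bool (b w a))"
    and "computable (\<lambda>w a. I w a \<and> \<not> b w a) inp (\<lambda>w a. enc_bool (b' w a))"
  shows "computable I inp (\<lambda>w a. enc_bool (b w a \<or> b' w a))"
proof -
  have s: "poly_bounded J (\<lambda>w a. dsize (inp w a))" if "\<And>w a. J w a \<Longrightarrow> I w a" for J
    by (rule poly_bounded_mono[OF computable_sizes(1)[OF assms(1)], where h = "\<lambda>w a. a"]) (use that in auto)
  have "computable (\<lambda>w a. I w a \<and> \<not> enc_bool (b w a) \<noteq> Nl) inp (\<lambda>w a. enc_bool (b' w a))"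
    by (rule computable_cong[OF assms(2)]) simp
  from computable_if[OF assms(1) computable_const[of _ _ "Pr Nl Nl"] this, OF s]
  have "computable I inp (\<lambda>w a. if enc_bool (b w a) \<noteq> Nl then Pr Nl Nl else enc_bool (b' w a))" by simp
  then show ?thesis by (rule computable_cong) (auto simp: enc_bool_def)
qed

lemma poly_bounded_tuple:
  "poly_bounded (\<lambda>w us. us \<in> tuples (wstr w) m) (\<lambda>w us. dsize (enc_tuple us))"
  by (rule poly_bounded_enc_tuple[OF poly_bounded_le[OF poly_bounded_const[of _ m]]]) (auto simp: tuples_iff)

lemma computable_tuple_id: "computable (\<lambda>w us. us \<in> tuples (wstr w) m) (\<lambda>w us. enc_tuple us) (\<lambda>w us. enc_tuple us)"
  by (rule computable_id[OF poly_bounded_tuple])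

lemma computable_tuple_nth:
  assumes "i < m"
  shows "computable (\<lambda>w us. us \<in> tuples (wstr w) m) (\<lambda>w us. enc_tuple us) (\<lambda>w us. enc_nat (us ! i))"
  by (rule computable_nth[OF computable_tuple_id[unfolded enc_tuple_def], folded enc_tuple_def])
    (use assms in \<open>auto simp: tuples_iff\<close>)

lemma computable_tuple_select:
  assumes "set js \<subseteq> {..<m}"
  shows "computable (\<lambda>w us. us \<in> tuples (wstr w) m) (\<lambda>w us. enc_tuple us) (\<lambda>w us. enc_tuple (map ((!) us) js))"
proof -
  have "computable (\<lambda>w us. us \<in> tuples (wstr w) m) (\<lambda>w us. enc_tuple us) (\<lambda>w us. enc_nat (us ! j))"
    if "j \<in> set js" for j
    using computable_tuple_nth assms that by blast
  from computable_enc_list[where f = "\<lambda>w us j. us ! j", OF poly_bounded_tuple this]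
  show ?thesis by (simp add: enc_tuple_def[of "map _ _"])
qed

text \<open>Admitting lists of variables with repetitions makes substitution trivial and avoids capture.\<close>

definition definable :: "nat \<Rightarrow> (nat struct \<Rightarrow> nat list \<Rightarrow> bool) \<Rightarrow> bool" where
  "definable m Q \<longleftrightarrow> (\<forall>zs. length zs = m \<longrightarrow>
     (\<exists>\<psi> :: 'p fm. first_order \<psi> \<and> wf_fm \<sigma> P \<psi> \<and> svars \<psi> \<subseteq> set zs \<and>
        (\<forall>B \<beta> \<nu>. is_struct \<sigma> B \<longrightarrow> \<beta> ` set zs \<subseteq> univ B \<longrightarrow> (sat P B \<beta> \<nu> \<psi> \<longleftrightarrow> Q B (map \<beta> zs)))))"

text \<open>The formula has to be correct in every finite structure, as
  \<open>sphere_formula\<close> demands, whereas the program has to work only in valid worlds, where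
  degrees are bounded.\<close>

definition local_query :: "nat \<Rightarrow> (nat struct \<Rightarrow> nat list \<Rightarrow> bool) \<Rightarrow> bool" where
  "local_query m Q \<longleftrightarrow> definable m Q \<and>
     computable (\<lambda>w us. us \<in> tuples (wstr w) m) (\<lambda>w us. enc_tuple us) (\<lambda>w us. enc_bool (Q (wstr w) us))"

section \<open>First-order definable properties of tuples\<close>

lemma definable_cong:
  assumes "definable m Q" "\<And>B us. is_struct \<sigma> B \<Longrightarrow> us \<in> tuples B m \<Longrightarrow> Q' B us = Q B us"
  shows "definable m Q'"
  unfolding definable_def
proof (intro allI impI)
  fix zs :: "nat list" assume zs: "length zs = m"
  then obtain \<psi> :: "'p fm" where \<psi>: "first_order \<psi>" "wf_fm \<sigma> P \<psi>" "svars \<psi> \<subseteq> set zs"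
    and s: "\<And>B \<beta> \<nu>. is_struct \<sigma> B \<Longrightarrow> \<beta> ` set zs \<subseteq> univ B \<Longrightarrow> sat P B \<beta> \<nu> \<psi> \<longleftrightarrow> Q B (map \<beta> zs)"
    using assms(1) unfolding definable_def by metis
  have "sat P B \<beta> \<nu> \<psi> \<longleftrightarrow> Q' B (map \<beta> zs)" if "is_struct \<sigma> B" "\<beta> ` set zs \<subseteq> univ B" for B \<beta> \<nu>
    using s[OF that] assms(2)[OF that(1), of "map \<beta> zs"] that(2) zs by (simp add: tuples_iff)
  then show "\<exists>\<psi> :: 'p fm. first_order \<psi> \<and> wf_fm \<sigma> P \<psi> \<and> svars \<psi> \<subseteq> set zs \<and>
        (\<forall>B \<beta> \<nu>. is_struct \<sigma> B \<longrightarrow> \<beta> ` set zs \<subseteq> univ B \<longrightarrow> (sat P B \<beta> \<nu> \<psi> \<longleftrightarrow> Q' B (map \<beta> zs)))"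
    using \<psi> by blast
qed

lemma local_query_cong:
  assumes "local_query m Q" "\<And>B us. is_struct \<sigma> B \<Longrightarrow> us \<in> tuples B m \<Longrightarrow> Q' B us = Q B us"
  shows "local_query m Q'"
proof -
  have "definable m Q'" using assms definable_cong unfolding local_query_def by blast
  moreover have "computable (\<lambda>w us. us \<in> tuples (wstr w) m) (\<lambda>w us. enc_tuple us) (\<lambda>w us. enc_bool (Q' (wstr w) us))"
    by (rule computable_cong[of "\<lambda>w us. us \<in> tuples (wstr w) m" "\<lambda>w us. enc_tuple us" "\<lambda>w us. enc_bool (Q (wstr w) us)"])
     (use assms in \<open>auto simp: local_query_def valid_def\<close>)
  ultimately show ?thesis by (simp add: local_query_def)
qed

lemma definableI:
  assumes "\<And>zs. length zs = m \<Longrightarrow> \<exists>\<psi> :: 'p fm. first_order \<psi> \<and> wf_fm \<sigma> P \<psi> \<and> svars \<psi> \<subseteq> set zs \<and>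
        (\<forall>B \<beta> \<nu>. is_struct \<sigma> B \<longrightarrow> \<beta> ` set zs \<subseteq> univ B \<longrightarrow> (sat P B \<beta> \<nu> \<psi> \<longleftrightarrow> Q B (map \<beta> zs)))"
  shows "definable m Q"
  unfolding definable_def by (intro allI impI assms)

lemma definableE:
  assumes "definable m Q" "length zs = m"
  obtains \<psi> :: "'p fm" where "first_order \<psi>" "wf_fm \<sigma> P \<psi>" "svars \<psi> \<subseteq> set zs"
    "\<And>B \<beta> \<nu>. is_struct \<sigma> B \<Longrightarrow> \<beta> ` set zs \<subseteq> univ B \<Longrightarrow> sat P B \<beta> \<nu> \<psi> \<longleftrightarrow> Q B (map \<beta> zs)"
  using assms unfolding definable_def by metis

lemma definable_True: "definable m (\<lambda>B us. True)"
  by (rule definableI, rule exI[of _ FTrue]) simp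

lemma definable_eq: "i < m \<Longrightarrow> j < m \<Longrightarrow> definable m (\<lambda>B us. us ! i = us ! j)"
  by (rule definableI, rule_tac x = "FEq (zs ! i) (zs ! j)" in exI) auto

lemma definable_rel:
  assumes "i < length \<sigma>" "length js = \<sigma> ! i" "set js \<subseteq> {..<m}"
  shows "definable m (\<lambda>B us. map ((!) us) js \<in> interp B i)"
proof (rule definableI)
  fix zs :: "nat list" assume "length zs = m"
  then have "map \<beta> (map ((!) zs) js) = map ((!) (map \<beta> zs)) js" for \<beta> :: "nat \<Rightarrow> nat"
    using assms by auto
  moreover have "set (map ((!) zs) js) \<subseteq> set zs" using assms \<open>length zs = m\<close> by auto
  ultimately show "\<exists>\<psi> :: 'p fm. first_order \<psi> \<and> wf_fm \<sigma> P \<psi> \<and> svars \<psi> \<subseteq> set zs \<and>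
        (\<forall>(B :: nat struct) \<beta> \<nu>. is_struct \<sigma> B \<longrightarrow> \<beta> ` set zs \<subseteq> univ B \<longrightarrow> (sat P B \<beta> \<nu> \<psi> \<longleftrightarrow> map ((!) (map \<beta> zs)) js \<in> interp B i))"
    using assms by (intro exI[of _ "FRel i (map ((!) zs) js)"]) (simp del: map_map)
qed

lemma definable_not:
  assumes Q: "definable m Q"
  shows "definable m (\<lambda>B us. \<not> Q B us)"
proof (rule definableI)
  fix zs :: "nat list" assume zs: "length zs = m"
  obtain \<psi> :: "'p fm" where 1: "first_order \<psi>" "wf_fm \<sigma> P \<psi>" "svars \<psi> \<subseteq> set zs"
    "\<And>B \<beta> \<nu>. is_struct \<sigma> B \<Longrightarrow> \<beta> ` set zs \<subseteq> univ B \<Longrightarrow> sat P B \<beta> \<nu> \<psi> \<longleftrightarrow> Q B (map \<beta> zs)"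
    by (rule definableE[OF Q zs]) (rule that, assumption+)
  show "\<exists>\<psi> :: 'p fm. first_order \<psi> \<and> wf_fm \<sigma> P \<psi> \<and> svars \<psi> \<subseteq> set zs \<and>
        (\<forall>B \<beta> \<nu>. is_struct \<sigma> B \<longrightarrow> \<beta> ` set zs \<subseteq> univ B \<longrightarrow> (sat P B \<beta> \<nu> \<psi> \<longleftrightarrow> \<not> Q B (map \<beta> zs)))"
    using 1 by (intro exI[of _ "FNeg \<psi>"]) simp
qed

lemma definable_or:
  assumes "definable m Q" "definable m Q'"
  shows "definable m (\<lambda>B us. Q B us \<or> Q' B us)"
proof (rule definableI)
  fix zs :: "nat list" assume zs: "length zs = m"
  obtain \<psi> :: "'p fm" where 1: "first_order \<psi>" "wf_fm \<sigma> P \<psi>" "svars \<psi> \<subseteq> set zs"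
    "\<And>B \<beta> \<nu>. is_struct \<sigma> B \<Longrightarrow> \<beta> ` set zs \<subseteq> univ B \<Longrightarrow> sat P B \<beta> \<nu> \<psi> \<longleftrightarrow> Q B (map \<beta> zs)"
    by (rule definableE[OF assms(1) zs]) (rule that, assumption+)
  obtain \<psi>' :: "'p fm" where 2: "first_order \<psi>'" "wf_fm \<sigma> P \<psi>'" "svars \<psi>' \<subseteq> set zs"
    "\<And>B \<beta> \<nu>. is_struct \<sigma> B \<Longrightarrow> \<beta> ` set zs \<subseteq> univ B \<Longrightarrow> sat P B \<beta> \<nu> \<psi>' \<longleftrightarrow> Q' B (map \<beta> zs)"
    by (rule definableE[OF assms(2) zs]) (rule that, assumption+)
  show "\<exists>\<psi> :: 'p fm. first_order \<psi> \<and> wf_fm \<sigma> P \<psi> \<and> svars \<psi> \<subseteq> set zs \<and>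
        (\<forall>B \<beta> \<nu>. is_struct \<sigma> B \<longrightarrow> \<beta> ` set zs \<subseteq> univ B \<longrightarrow> (sat P B \<beta> \<nu> \<psi> \<longleftrightarrow> Q B (map \<beta> zs) \<or> Q' B (map \<beta> zs)))"
    using 1 2 by (intro exI[of _ "FOr \<psi> \<psi>'"]) simp
qed

text \<open>The quantified variable is fresh, and its value is put in front of the tuple. All later
  quantifiers follow this convention, so old indices shift up by the number of new entries.\<close>

lemma definable_ex:
  assumes "definable (Suc m) Q"
  shows "definable m (\<lambda>B us. \<exists>z\<in>univ B. Q B (z # us))"
proof (rule definableI)
  fix zs :: "nat list" assume zs: "length zs = m"
  obtain y where y: "y \<notin> set zs" using ex_new_if_finite[of "set zs"] by auto
  obtain \<psi> :: "'p fm" where 1: "first_order \<psi>" "wf_fm \<sigma> P \<psi>" "svars \<psi> \<subseteq> set (y # zs)"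
    "\<And>B \<beta> \<nu>. is_struct \<sigma> B \<Longrightarrow> \<beta> ` set (y # zs) \<subseteq> univ B \<Longrightarrow> sat P B \<beta> \<nu> \<psi> \<longleftrightarrow> Q B (map \<beta> (y # zs))"
    by (rule definableE[OF assms(1), of "y # zs"]) (use zs in auto)
  have "sat P B \<beta> \<nu> (FEx y \<psi>) \<longleftrightarrow> (\<exists>z\<in>univ B. Q B (z # map \<beta> zs))"
    if B: "is_struct \<sigma> B" "\<beta> ` set zs \<subseteq> univ B" for B \<beta> \<nu>
  proof -
    have "sat P B (\<beta>(y := z)) \<nu> \<psi> \<longleftrightarrow> Q B (z # map \<beta> zs)" if z: "z \<in> univ B" for z
    proof -
      have m: "map (\<beta>(y := z)) zs = map \<beta> zs" using y by simp
      show ?thesis using 1(4)[OF B(1), of "\<beta>(y := z)" \<nu>] B(2) y z m by auto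
    qed
    then show ?thesis by simp
  qed
  then show "\<exists>\<psi> :: 'p fm. first_order \<psi> \<and> wf_fm \<sigma> P \<psi> \<and> svars \<psi> \<subseteq> set zs \<and>
        (\<forall>B \<beta> \<nu>. is_struct \<sigma> B \<longrightarrow> \<beta> ` set zs \<subseteq> univ B \<longrightarrow> (sat P B \<beta> \<nu> \<psi> \<longleftrightarrow> (\<exists>z\<in>univ B. Q B (z # map \<beta> zs))))"
    using 1 by (intro exI[of _ "FEx y \<psi>"]) auto
qed

lemma definable_select:
  assumes "definable (length js) Q" "set js \<subseteq> {..<m}"
  shows "definable m (\<lambda>B us. Q B (map ((!) us) js))"
proof (rule definableI)
  fix zs :: "nat list" assume zs: "length zs = m"
  let ?zs = "map ((!) zs) js"
  obtain \<psi> :: "'p fm" where 1: "first_order \<psi>" "wf_fm \<sigma> P \<psi>" "svars \<psi> \<subseteq> set ?zs"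
    "\<And>B \<beta> \<nu>. is_struct \<sigma> B \<Longrightarrow> \<beta> ` set ?zs \<subseteq> univ B \<Longrightarrow> sat P B \<beta> \<nu> \<psi> \<longleftrightarrow> Q B (map \<beta> ?zs)"
    by (rule definableE[OF assms(1), of ?zs]) auto
  have sub: "set ?zs \<subseteq> set zs" using assms(2) zs by auto
  have m: "map \<beta> ?zs = map ((!) (map \<beta> zs)) js" for \<beta> :: "nat \<Rightarrow> nat" using assms(2) zs by auto
  show "\<exists>\<psi> :: 'p fm. first_order \<psi> \<and> wf_fm \<sigma> P \<psi> \<and> svars \<psi> \<subseteq> set zs \<and>
        (\<forall>B \<beta> \<nu>. is_struct \<sigma> B \<longrightarrow> \<beta> ` set zs \<subseteq> univ B \<longrightarrow> (sat P B \<beta> \<nu> \<psi> \<longleftrightarrow> Q B (map ((!) (map \<beta> zs)) js)))"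
    using 1(1-3) 1(4)[unfolded m] sub by (intro exI[of _ \<psi>]) (meson image_mono order_trans)
qed

lemma definable_ex_list:
  assumes "definable (q + m) Q"
  shows "definable m (\<lambda>B us. \<exists>ts\<in>tuples B q. Q B (ts @ us))"
  using assms
proof (induction q arbitrary: m Q)
  case 0
  then have "definable m Q" by simp
  then show ?case by (rule definable_cong) (auto simp: tuples_iff)
next
  case (Suc q)
  \<comment> \<open>The entry next to \<open>us\<close>, which is the last one of the block, is
    quantified outermost.\<close>
  have "definable m (\<lambda>B us. \<exists>z\<in>univ B. \<exists>ts\<in>tuples B q. Q B (ts @ (z # us)))"
    by (rule definable_ex[OF Suc.IH[of "Suc m"]]) (use Suc.prems in simp)
  then show ?case
  proof (rule definable_cong)
    fix B :: "nat struct" and us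
    show "(\<exists>ts\<in>tuples B (Suc q). Q B (ts @ us)) = (\<exists>z\<in>univ B. \<exists>ts\<in>tuples B q. Q B (ts @ (z # us)))"
    proof
      assume "\<exists>ts\<in>tuples B (Suc q). Q B (ts @ us)"
      then obtain ts where ts: "ts \<in> tuples B (Suc q)" "Q B (ts @ us)" by blast
      then have "ts = butlast ts @ [last ts]" by (auto simp: tuples_iff intro!: append_butlast_last_id[symmetric])
      then obtain us' z where "ts = us' @ [z]" by blast
      then show "\<exists>z\<in>univ B. \<exists>ts\<in>tuples B q. Q B (ts @ (z # us))"
        using ts by (intro bexI[of _ z] bexI[of _ us']) (auto simp: tuples_iff)
    next
      assume "\<exists>z\<in>univ B. \<exists>ts\<in>tuples B q. Q B (ts @ (z # us))"
      then obtain z ts where "z \<in> univ B" "ts \<in> tuples B q" "Q B (ts @ (z # us))" by blast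
      then show "\<exists>ts\<in>tuples B (Suc q). Q B (ts @ us)"
        by (intro bexI[of _ "ts @ [z]"]) (auto simp: tuples_iff)
    qed
  qed
qed

lemma definable_and:
  assumes "definable m Q" "definable m Q'"
  shows "definable m (\<lambda>B us. Q B us \<and> Q' B us)"
  using definable_not[OF definable_or[OF definable_not[OF assms(1)] definable_not[OF assms(2)]]]
  by (rule definable_cong) simp

lemma definable_False: "definable m (\<lambda>B us. False)"
  using definable_not[OF definable_True] by simp

lemma definable_bex:
  "(\<And>x. x \<in> set xs \<Longrightarrow> definable m (Q x)) \<Longrightarrow> definable m (\<lambda>B us. \<exists>x\<in>set xs. Q x B us)"
proof (induction xs)
  case (Cons x xs)
  then show ?case using definable_or[of m "Q x" "\<lambda>B us. \<exists>x\<in>set xs. Q x B us"] by simp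
qed (simp add: definable_False)

text \<open>An edge is witnessed by a tuple of one of finitely many relations. The entries of the
  witness are quantified in front of \<open>us\<close>, so that index \<open>i\<close> of
  \<open>us\<close> becomes \<open>q + i\<close>. The quantifiers range over the whole universe, so
  this serves formulas only; programs obtain neighbours from the oracle.\<close>

lemma definable_gaifman:
  assumes "i < m" "j < m"
  shows "definable m (\<lambda>B us. (us ! i, us ! j) \<in> gaifman B)"
proof -
  let ?R = "\<lambda>a q (B :: nat struct) us. map ((!) us) [0..<q] \<in> interp B a \<and>
     (\<exists>p\<in>set [0..<q]. us ! p = us ! (q + i)) \<and> (\<exists>p\<in>set [0..<q]. us ! p = us ! (q + j))"
  have "definable (\<sigma> ! a + m) (?R a (\<sigma> ! a))" if "a < length \<sigma>" for a
    using that assms by (intro definable_and definable_rel definable_bex definable_eq) auto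
  then have "definable m (\<lambda>B us. \<exists>ts\<in>tuples B (\<sigma> ! a). ?R a (\<sigma> ! a) B (ts @ us))" if "a \<in> set [0..<length \<sigma>]" for a
    using that by (intro definable_ex_list) auto
  from definable_and[OF definable_not[OF definable_eq[OF assms]] definable_bex[OF this]]
  have "definable m (\<lambda>B us. \<not> us ! i = us ! j \<and>
     (\<exists>a\<in>set [0..<length \<sigma>]. \<exists>ts\<in>tuples B (\<sigma> ! a). ?R a (\<sigma> ! a) B (ts @ us)))" .
  then show ?thesis
  proof (rule definable_cong)
    fix B :: "nat struct" and us assume B: "is_struct \<sigma> B" and us: "us \<in> tuples B m"
    have m: "map ((!) (ts @ us)) [0..<length ts] = ts" for ts
      by (auto intro!: nth_equalityI simp: nth_append)
    have R: "?R a (\<sigma> ! a) B (ts @ us) \<longleftrightarrow> ts \<in> interp B a \<and> us ! i \<in> set ts \<and> us ! j \<in> set ts"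
      if "ts \<in> tuples B (\<sigma> ! a)" for ts a
    proof -
      have l: "\<sigma> ! a = length ts" using that by (simp add: tuples_iff)
      have "us ! i \<in> set ts \<longleftrightarrow> (\<exists>p\<in>set [0..<length ts]. (ts @ us) ! p = (ts @ us) ! (length ts + i))" for i
        by (auto simp: in_set_conv_nth nth_append)
      with m show ?thesis unfolding l by metis
    qed
    have t: "ts \<in> tuples B (\<sigma> ! a)" "a < length \<sigma>" if "ts \<in> interp B a" for ts a
    proof -
      show "a < length \<sigma>" using that B unfolding is_struct_def by (metis empty_iff leI)
      then show "ts \<in> tuples B (\<sigma> ! a)" using that B unfolding is_struct_def tuples_iff by blast
    qed
    show "(us ! i, us ! j) \<in> gaifman B \<longleftrightarrow> \<not> us ! i = us ! j \<and>
     (\<exists>a\<in>set [0..<length \<sigma>]. \<exists>ts\<in>tuples B (\<sigma> ! a). ?R a (\<sigma> ! a) B (ts @ us))"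
    proof -
      have "(\<exists>ts\<in>tuples B (\<sigma> ! a). ?R a (\<sigma> ! a) B (ts @ us)) \<longleftrightarrow>
          (\<exists>ts\<in>tuples B (\<sigma> ! a). ts \<in> interp B a \<and> us ! i \<in> set ts \<and> us ! j \<in> set ts)" for a
        using R by (intro bex_cong refl)
      moreover have "(us ! i, us ! j) \<in> gaifman B \<longleftrightarrow> \<not> us ! i = us ! j \<and> (\<exists>a\<in>set [0..<length \<sigma>].
          \<exists>ts\<in>tuples B (\<sigma> ! a). ts \<in> interp B a \<and> us ! i \<in> set ts \<and> us ! j \<in> set ts)"
        using t unfolding gaifman_def by (simp add: Bex_def) blast
      ultimately show ?thesis by presburger
    qed
  qed
qed

section \<open>Properties that are definable and decidable with local access\<close>

lemma local_query_True: "local_query m (\<lambda>B us. True)"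
  using definable_True computable_const[OF poly_bounded_tuple] by (simp add: local_query_def)

lemma local_query_eq:
  assumes "i < m" "j < m"
  shows "local_query m (\<lambda>B us. us ! i = us ! j)"
proof -
  have "computable (\<lambda>w us. us \<in> tuples (wstr w) m) (\<lambda>w us. enc_tuple us) (\<lambda>w us. enc_bool (us ! i = us ! j))"
    using computable_eq[OF computable_tuple_nth[OF assms(1)] computable_tuple_nth[OF assms(2)]] by simp
  then show ?thesis using definable_eq[OF assms] by (simp add: local_query_def)
qed

lemma local_query_rel:
  assumes "i < length \<sigma>" "length js = \<sigma> ! i" "set js \<subseteq> {..<m}"
  shows "local_query m (\<lambda>B us. map ((!) us) js \<in> interp B i)"
  using definable_rel[OF assms] computable_ask_rel[OF computable_tuple_select[OF assms(3)]]
  by (simp add: local_query_def)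

lemma local_query_not:
  assumes "local_query m Q"
  shows "local_query m (\<lambda>B us. \<not> Q B us)"
  using assms unfolding local_query_def by (intro conjI definable_not computable_not) auto

lemma local_query_or:
  assumes "local_query m Q" "local_query m Q'"
  shows "local_query m (\<lambda>B us. Q B us \<or> Q' B us)"
proof -
  have "computable (\<lambda>w us. us \<in> tuples (wstr w) m \<and> \<not> Q (wstr w) us) (\<lambda>w us. enc_tuple us) (\<lambda>w us. enc_bool (Q' (wstr w) us))"
    by (rule computable_cong[of "\<lambda>w us. us \<in> tuples (wstr w) m" "\<lambda>w us. enc_tuple us" "\<lambda>w us. enc_bool (Q' (wstr w) us)"])
      (use assms(2) in \<open>simp_all add: local_query_def\<close>)
  with assms show ?thesis unfolding local_query_def by (intro conjI definable_or computable_or) auto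
qed

lemma local_query_and:
  assumes "local_query m Q" "local_query m Q'"
  shows "local_query m (\<lambda>B us. Q B us \<and> Q' B us)"
  using local_query_not[OF local_query_or[OF local_query_not[OF assms(1)] local_query_not[OF assms(2)]]]
  by (rule local_query_cong) simp

lemma local_query_bex:
  "(\<And>x. x \<in> set xs \<Longrightarrow> local_query m (Q x)) \<Longrightarrow> local_query m (\<lambda>B us. \<exists>x\<in>set xs. Q x B us)"
proof (induction xs)
  case Nil
  then show ?case using local_query_not[OF local_query_True] by simp
next
  case (Cons x xs)
  then show ?case using local_query_or[of m "Q x" "\<lambda>B us. \<exists>x\<in>set xs. Q x B us"] by simp
qed

lemma local_query_ball:
  assumes "\<And>x. x \<in> set xs \<Longrightarrow> local_query m (Q x)"
  shows "local_query m (\<lambda>B us. \<forall>x\<in>set xs. Q x B us)"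
  using local_query_not[OF local_query_bex[of xs m "\<lambda>x B us. \<not> Q x B us"]] local_query_not[OF assms] by simp

lemma local_query_select:
  assumes "local_query (length js) Q" "set js \<subseteq> {..<m}"
  shows "local_query m (\<lambda>B us. Q B (map ((!) us) js))"
proof -
  have "computable (\<lambda>w us. us \<in> tuples (wstr w) m) (\<lambda>w us. enc_tuple (map ((!) us) js))
      (\<lambda>w us. enc_bool (Q (wstr w) (map ((!) us) js)))"
    by (rule computable_reindex[where h = "\<lambda>w us. map ((!) us) js" and
        J = "\<lambda>w us. us \<in> tuples (wstr w) (length js)" and inp = "\<lambda>w us. enc_tuple us" and out = "\<lambda>w us. enc_bool (Q (wstr w) us)"])
      (use assms tuples_map_nth in \<open>simp_all add: local_query_def\<close>)
  then show ?thesis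
    using definable_select[OF _ assms(2)] computable_trans[OF computable_tuple_select[OF assms(2)]] assms(1)
    by (simp add: local_query_def)
qed

text \<open>Here formula and program differ: the formula guards a quantifier over the universe by
  adjacency, the program loops over the answer to one neighbour query. This is the basic local
  quantifier, from which those over neighbourhoods are obtained by iteration.\<close>

lemma local_query_ex_nbr:
  assumes "local_query (Suc m) Q" "i < m"
  shows "local_query m (\<lambda>B us. \<exists>z\<in>gaifman_nbrs B (us ! i). Q B (z # us))"
proof -
  have "definable (Suc m) (\<lambda>B us. (us ! Suc i, us ! 0) \<in> gaifman B \<and> Q B us)"
    using assms by (intro definable_and definable_gaifman) (auto simp: local_query_def)
  from definable_ex[OF this]
  have d: "definable m (\<lambda>B us. \<exists>z\<in>gaifman_nbrs B (us ! i). Q B (z # us))"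
    by (rule definable_cong) (auto simp: gaifman_nbrs_def dest: gaifman_univ)
  let ?I = "\<lambda>w us. us \<in> tuples (wstr w) m"
  let ?J = "\<lambda>w (us, z). us \<in> tuples (wstr w) m \<and> z \<in> univ (wstr w)"
  let ?inp = "\<lambda>w (us, z). Pr (enc_tuple us) (enc_nat z)"
  have sz: "poly_bounded ?J (\<lambda>w a. dsize (?inp w a))"
  proof -
    have "poly_bounded ?J (\<lambda>w a. dsize (enc_tuple (fst a)))"
      by (rule poly_bounded_mono[OF poly_bounded_tuple[of m], of _ "\<lambda>w a. fst a"]) auto
    moreover have "poly_bounded ?J (\<lambda>w a. dsize (enc_nat (snd a)))"
      by (rule poly_bounded_enc_nat) auto
    ultimately have "poly_bounded ?J (\<lambda>w a. Suc (dsize (enc_tuple (fst a)) + dsize (enc_nat (snd a))))"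
      by (intro poly_bounded_Suc poly_bounded_add)
    then show ?thesis by (rule poly_bounded_le) auto
  qed
  have i: "computable ?J ?inp ?inp" by (rule computable_id[OF sz])
  have swap: "computable ?J ?inp (\<lambda>w (us, z). enc_tuple (z # us))"
    by (rule computable_cong[OF computable_pair[OF computable_tl[OF i] computable_hd[OF i]]])
      (auto simp: enc_tuple_def)
  have "computable ?J (\<lambda>w (us, z). enc_tuple (z # us)) (\<lambda>w (us, z). enc_bool (Q (wstr w) (z # us)))"
    by (rule computable_reindex[where h = "\<lambda>w (us, z). z # us" and
        J = "\<lambda>w us. us \<in> tuples (wstr w) (Suc m)" and inp = "\<lambda>w us. enc_tuple us" and out = "\<lambda>w us. enc_bool (Q (wstr w) us)"])
      (use assms in \<open>auto simp add: local_query_def tuples_Cons\<close>)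
  with swap have body: "computable ?J ?inp (\<lambda>w (us, z). enc_bool (Q (wstr w) (z # us)))"
    by (rule computable_trans)
  have nbrs: "computable ?I (\<lambda>w us. enc_tuple us) (\<lambda>w us. enc_tuple (ask_nbrs (wacc w) (us ! i)))"
    by (rule computable_ask_nbrs[OF computable_tuple_nth[OF assms(2)]]) (use assms(2) tuples_nth in auto)
  have "computable ?I (\<lambda>w us. enc_tuple us)
      (\<lambda>w us. first_hit (\<lambda>z. enc_bool (Q (wstr w) (z # us))) (ask_nbrs (wacc w) (us ! i)))"
    by (rule computable_first_hit[OF nbrs[unfolded enc_tuple_def[of "ask_nbrs _ _"]] body])
      (use valid_nbrs(3) tuples_nth[OF _ assms(2)] in blast)
  then have "computable ?I (\<lambda>w us. enc_tuple us)
      (\<lambda>w us. enc_bool (\<exists>z\<in>gaifman_nbrs (wstr w) (us ! i). Q (wstr w) (z # us)))"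
  proof (rule computable_cong)
    fix w us assume "valid w" and us: "us \<in> tuples (wstr w) m"
    then have "set (ask_nbrs (wacc w) (us ! i)) = gaifman_nbrs (wstr w) (us ! i)"
      using valid_nbrs(1) tuples_nth[OF us assms(2)] by blast
    then show "us \<in> tuples (wstr w) m \<and> enc_tuple us = enc_tuple us \<and>
       enc_bool (\<exists>z\<in>gaifman_nbrs (wstr w) (us ! i). Q (wstr w) (z # us)) =
       first_hit (\<lambda>z. enc_bool (Q (wstr w) (z # us))) (ask_nbrs (wacc w) (us ! i))"
      using us by (simp add: first_hit_bool)
  qed
  with d show ?thesis by (simp add: local_query_def)
qed

lemma local_query_ex_nbhd_single:
  assumes "local_query (Suc m) Q" "i < m"
  shows "local_query m (\<lambda>B us. \<exists>z\<in>nbhd B s [us ! i]. Q B (z # us))"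
  using assms
proof (induction s arbitrary: m Q i)
  case 0
  have "local_query m (\<lambda>B us. Q B (map ((!) us) (i # [0..<m])))"
    by (rule local_query_select) (use 0 in auto)
  then show ?case
  proof (rule local_query_cong)
    fix B :: "nat struct" and us assume us: "us \<in> tuples B m"
    then have "map ((!) us) [0..<m] = us" by (auto simp: tuples_iff map_nth)
    then show "(\<exists>z\<in>nbhd B 0 [us ! i]. Q B (z # us)) = Q B (map ((!) us) (i # [0..<m]))"
      using nbhd_0[OF tuples_nth[OF us 0(2)]] by simp
  qed
next
  case (Suc s)
  \<comment> \<open>In \<open>z # y # us\<close> the intermediate vertex \<open>y\<close> is to be
    forgotten: position 0 and the positions from 2 on are kept.\<close>
  let ?Q' = "\<lambda>B us. Q B (map ((!) us) (0 # map (\<lambda>j. j + 2) [0..<m]))"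
  have "local_query (Suc (Suc m)) ?Q'"
    by (rule local_query_select) (use Suc.prems in auto)
  from Suc.IH[OF this, of 0]
  have "local_query (Suc m) (\<lambda>B us. \<exists>z\<in>nbhd B s [us ! 0]. ?Q' B (z # us))" by simp
  from local_query_ex_nbr[OF this Suc.prems(2)]
  have 1: "local_query m (\<lambda>B us. \<exists>y\<in>gaifman_nbrs B (us ! i). \<exists>z\<in>nbhd B s [(y # us) ! 0]. ?Q' B (z # y # us))" .
  have 2: "local_query m (\<lambda>B us. Q B (map ((!) us) (i # [0..<m])))"
    by (rule local_query_select) (use Suc.prems in auto)
  show ?case
  proof (rule local_query_cong[OF local_query_or[OF 2 1]])
    fix B :: "nat struct" and us assume us: "us \<in> tuples B m"
    then have l: "length us = m" by (simp add: tuples_iff)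
    have a: "map ((!) us) (i # [0..<m]) = us ! i # us" using l by (auto simp: map_nth)
    have b: "map ((!) (z # y # us)) (0 # map (\<lambda>j. j + 2) [0..<m]) = z # us" for z y
      using l by (auto intro!: nth_equalityI simp del: upt_Suc)
    show "(\<exists>z\<in>nbhd B (Suc s) [us ! i]. Q B (z # us)) \<longleftrightarrow> Q B (map ((!) us) (i # [0..<m])) \<or>
       (\<exists>y\<in>gaifman_nbrs B (us ! i). \<exists>z\<in>nbhd B s [(y # us) ! 0]. ?Q' B (z # y # us))"
      unfolding a b using nbhd_Suc[OF tuples_nth[OF us Suc.prems(2)], of _ s] by auto
  qed
qed

lemma local_query_ex_nbhd:
  assumes "local_query (Suc m) Q" "set js \<subseteq> {..<m}"
  shows "local_query m (\<lambda>B us. \<exists>z\<in>nbhd B s (map ((!) us) js). Q B (z # us))"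
proof -
  have "local_query m (\<lambda>B us. \<exists>j\<in>set js. \<exists>z\<in>nbhd B s [us ! j]. Q B (z # us))"
    using assms by (intro local_query_bex local_query_ex_nbhd_single) auto
  then show ?thesis
    by (rule local_query_cong) (subst Bex_def, subst nbhd_Union, auto)
qed

lemma local_query_ex_nbhd_list:
  assumes "local_query (q + m) Q" "set js \<subseteq> {..<m}"
  shows "local_query m (\<lambda>B us. \<exists>bs. length bs = q \<and> set bs \<subseteq> nbhd B s (map ((!) us) js) \<and> Q B (bs @ us))"
  using assms
proof (induction q arbitrary: m Q js)
  case 0
  then show ?case by simp
next
  case (Suc q)
  have "local_query m (\<lambda>B us. \<exists>z\<in>nbhd B s (map ((!) us) js).
     \<exists>bs. length bs = q \<and> set bs \<subseteq> nbhd B s (map ((!) (z # us)) (map Suc js)) \<and> Q B (bs @ (z # us)))"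
    by (rule local_query_ex_nbhd[OF Suc.IH[of "Suc m"]]) (use Suc.prems in auto)
  then show ?case
  proof (rule local_query_cong)
    fix B :: "nat struct" and us :: "nat list"
    have m: "map ((!) (z # us)) (map Suc js) = map ((!) us) js" for z by simp
    show "(\<exists>bs. length bs = Suc q \<and> set bs \<subseteq> nbhd B s (map ((!) us) js) \<and> Q B (bs @ us)) \<longleftrightarrow>
      (\<exists>z\<in>nbhd B s (map ((!) us) js).
     \<exists>bs. length bs = q \<and> set bs \<subseteq> nbhd B s (map ((!) (z # us)) (map Suc js)) \<and> Q B (bs @ (z # us)))"
      unfolding m
    proof
      assume "\<exists>bs. length bs = Suc q \<and> set bs \<subseteq> nbhd B s (map ((!) us) js) \<and> Q B (bs @ us)"
      then obtain bs where bs: "length bs = Suc q" "set bs \<subseteq> nbhd B s (map ((!) us) js)" "Q B (bs @ us)" by blast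
      then have "bs = butlast bs @ [last bs]" by (intro append_butlast_last_id[symmetric]) auto
      then obtain bs' z where "bs = bs' @ [z]" by blast
      then show "\<exists>z\<in>nbhd B s (map ((!) us) js).
          \<exists>bs. length bs = q \<and> set bs \<subseteq> nbhd B s (map ((!) us) js) \<and> Q B (bs @ (z # us))"
        using bs by (intro bexI[of _ z] exI[of _ bs']) auto
    next
      assume "\<exists>z\<in>nbhd B s (map ((!) us) js).
          \<exists>bs. length bs = q \<and> set bs \<subseteq> nbhd B s (map ((!) us) js) \<and> Q B (bs @ (z # us))"
      then obtain z bs where "z \<in> nbhd B s (map ((!) us) js)" "length bs = q"
        "set bs \<subseteq> nbhd B s (map ((!) us) js)" "Q B (bs @ (z # us))" by blast
      then show "\<exists>bs. length bs = Suc q \<and> set bs \<subseteq> nbhd B s (map ((!) us) js) \<and> Q B (bs @ us)"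
        by (intro exI[of _ "bs @ [z]"]) auto
    qed
  qed
qed

section \<open>Recognising a fixed type by a local query\<close>

lemma isomorphic_sym:
  assumes "isomorphic \<A> \<B>" "set (snd \<A>) \<subseteq> univ (fst \<A>)"
  shows "isomorphic \<B> \<A>"
proof -
  obtain f where f: "bij_betw f (univ (fst \<A>)) (univ (fst \<B>))"
    and rel: "\<And>i us. set us \<subseteq> univ (fst \<A>) \<Longrightarrow> us \<in> interp (fst \<A>) i \<longleftrightarrow> map f us \<in> interp (fst \<B>) i"
    and c: "map f (snd \<A>) = snd \<B>"
    using assms(1) unfolding isomorphic_def by blast
  let ?g = "inv_into (univ (fst \<A>)) f"
  have g: "bij_betw ?g (univ (fst \<B>)) (univ (fst \<A>))" using f by (rule bij_betw_inv_into)
  have fg: "map f (map ?g us) = us" if "set us \<subseteq> univ (fst \<B>)" for us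
    using that f by (auto intro!: map_idI simp: bij_betw_inv_into_right)
  have gf: "map ?g (map f us) = us" if "set us \<subseteq> univ (fst \<A>)" for us
    using that f by (auto intro!: map_idI simp: bij_betw_inv_into_left)
  have "us \<in> interp (fst \<B>) i \<longleftrightarrow> map ?g us \<in> interp (fst \<A>) i" if "set us \<subseteq> univ (fst \<B>)" for i us
    using rel[of "map ?g us" i] fg[OF that] that g by (auto simp: bij_betw_def)
  \<comment> \<open>Here the centres must lie in the universe, where \<open>?g\<close> inverts
    \<open>f\<close>.\<close>
  moreover have "map ?g (snd \<B>) = snd \<A>" unfolding c[symmetric] by (rule gf[OF assms(2)])
  ultimately show ?thesis unfolding isomorphic_def using g by blast
qed

text \<open>An isomorphism from a structure on \<open>{..<q}\<close> is an enumeration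
  \<open>bs\<close> of the neighbourhood without repetitions that has the same diagram and the same
  centres. This turns the existence of a function into a block of \<open>q\<close> quantifiers over
  the neighbourhood followed by finitely many atomic conditions.\<close>

lemma isomorphic_sphere_iff:
  assumes B: "is_struct \<sigma> B" and us: "us \<in> tuples B m"
    and A: "is_struct \<sigma> A" "univ A = {..<q}" "length cs = m" "set cs \<subseteq> {..<q}"
  shows "isomorphic (sphere B s us) (A, cs) \<longleftrightarrow>
     (\<exists>bs. length bs = q \<and> set bs \<subseteq> nbhd B s us \<and> distinct bs \<and> nbhd B s us \<subseteq> set bs \<and>
        (\<forall>i<length \<sigma>. \<forall>js\<in>set (List.n_lists (\<sigma> ! i) [0..<q]). js \<in> interp A i \<longleftrightarrow> map ((!) bs) js \<in> interp B i) \<and>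
        us = map ((!) bs) cs)" (is "?L \<longleftrightarrow> ?R")
proof
  have un: "set us \<subseteq> nbhd B s us" using us by (auto simp: nbhd_def tuples_iff intro!: exI[of _ 0])
  assume ?L
  then have "isomorphic (A, cs) (sphere B s us)"
    by (rule isomorphic_sym) (use un in \<open>simp add: sphere_def induced_def\<close>)
  then obtain f where f: "bij_betw f {..<q} (nbhd B s us)"
    and rel: "\<And>i js. set js \<subseteq> {..<q} \<Longrightarrow> js \<in> interp A i \<longleftrightarrow> map f js \<in> interp B i \<and> f ` set js \<subseteq> nbhd B s us"
    and c: "map f cs = us"
    unfolding isomorphic_def by (auto simp: sphere_def induced_def A)
  let ?bs = "map f [0..<q]"
  have n: "map ((!) ?bs) js = map f js" if "set js \<subseteq> {..<q}" for js using that by auto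
  have "distinct ?bs" using f by (auto simp: distinct_map bij_betw_def atLeast0LessThan)
  moreover have "set ?bs = nbhd B s us" using f by (auto simp: bij_betw_def atLeast0LessThan)
  moreover have "js \<in> interp A i \<longleftrightarrow> map ((!) ?bs) js \<in> interp B i"
    if "js\<in>set (List.n_lists (\<sigma> ! i) [0..<q])" for js i
  proof -
    have j: "set js \<subseteq> {..<q}" using that by (auto simp: set_n_lists)
    then have "f ` set js \<subseteq> nbhd B s us" using f by (auto simp: bij_betw_def)
    then show ?thesis using rel[OF j, of i] unfolding n[OF j] by simp
  qed
  ultimately show ?R
    using c n[OF A(4), symmetric] by (intro exI[of _ ?bs]) (auto simp del: map_map)
next
  assume ?R
  then obtain bs where bs: "length bs = q" "set bs = nbhd B s us" "distinct bs" "us = map ((!) bs) cs"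
    and rel: "\<And>i js. i < length \<sigma> \<Longrightarrow> js\<in>set (List.n_lists (\<sigma> ! i) [0..<q]) \<Longrightarrow>
       js \<in> interp A i \<longleftrightarrow> map ((!) bs) js \<in> interp B i"
    by blast
  have f: "bij_betw ((!) bs) {..<q} (nbhd B s us)"
    using bs(1-3) bij_betw_nth by blast
  have "js \<in> interp A i \<longleftrightarrow> map ((!) bs) js \<in> interp (induced B (nbhd B s us)) i" if js: "set js \<subseteq> {..<q}" for i js
  proof (cases "i < length \<sigma> \<and> length js = \<sigma> ! i")
    case True
    then have "js\<in>set (List.n_lists (\<sigma> ! i) [0..<q])" using js by (auto simp: set_n_lists)
    moreover have "(!) bs ` set js \<subseteq> nbhd B s us" using f js by (auto simp: bij_betw_def)
    ultimately show ?thesis using rel[of i js] True by (simp add: induced_def)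
  next
    \<comment> \<open>A symbol outside the signature, or a tuple of wrong length, contributes to
      neither relation, so checking the finitely many tuples above was enough.\<close>
    case False
    then have "js \<notin> interp A i" "map ((!) bs) js \<notin> interp B i"
      using A(1) B unfolding is_struct_def by (metis empty_iff leI length_map)+
    then show ?thesis by (simp add: induced_def)
  qed
  then have "isomorphic (A, cs) (sphere B s us)"
    unfolding isomorphic_def using f bs(4) by (intro exI[of _ "(!) bs"]) (simp add: sphere_def induced_def A(2))
  then show ?L by (rule isomorphic_sym) (use A in simp)
qed

text \<open>The conditions say that \<open>bs\<close> has no repetitions, exhausts the
  neighbourhood, has the diagram of \<open>A\<close> and puts the centres in the right places. They
  are evaluated on \<open>bs @ us\<close>, where the centres start at position \<open>q\<close>.
  Only exhaustion needs a further quantifier, again bounded to the neighbourhood.\<close>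

lemma local_query_isomorphic_sphere:
  fixes q :: nat
  assumes A: "is_struct \<sigma> A" "univ A = {..<q}" "length cs = m" "set cs \<subseteq> {..<q}"
  shows "local_query m (\<lambda>B us. isomorphic (sphere B s us) (A, cs))"
proof -
  let ?dist = "\<lambda>(B :: nat struct) (us :: nat list). \<forall>i\<in>set [0..<q]. \<forall>j\<in>set [0..<q]. i = j \<or> \<not> us ! i = us ! j"
  \<comment> \<open>No element of the neighbourhood is missing from the first \<open>q\<close>
    entries; with \<open>z\<close> in front these sit at the positions \<open>Suc j\<close>.\<close>
  let ?cov = "\<lambda>B us. \<not> (\<exists>z\<in>nbhd B s (map ((!) us) [q..<q + m]). \<not> (\<exists>j\<in>set [0..<q]. (z # us) ! 0 = (z # us) ! Suc j))"
  let ?diag = "\<lambda>(B :: nat struct) us. \<forall>i\<in>set [0..<length \<sigma>]. \<forall>js\<in>set (List.n_lists (\<sigma> ! i) [0..<q]).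
     js \<in> interp A i \<longleftrightarrow> map ((!) us) js \<in> interp B i"
  let ?cen = "\<lambda>(B :: nat struct) (us :: nat list). \<forall>p\<in>set [0..<m]. us ! (q + p) = us ! (cs ! p)"
  have "local_query (q + m) ?dist"
  proof (intro local_query_ball)
    fix i j assume "i \<in> set [0..<q]" "j \<in> set [0..<q]"
    then show "local_query (q + m) (\<lambda>B us. i = j \<or> \<not> us ! i = us ! j)"
      by (cases "i = j") (auto intro!: local_query_not local_query_eq simp: local_query_True)
  qed
  moreover have "local_query (q + m) ?cov"
    by (intro local_query_not local_query_ex_nbhd[where Q = "\<lambda>B us. \<not> (\<exists>j\<in>set [0..<q]. us ! 0 = us ! Suc j)"]
        local_query_bex local_query_eq) auto
  moreover have "local_query (q + m) ?diag"
  proof (intro local_query_ball)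
    fix i js assume "i \<in> set [0..<length \<sigma>]" "js \<in> set (List.n_lists (\<sigma> ! i) [0..<q])"
    then have "local_query (q + m) (\<lambda>B us. map ((!) us) js \<in> interp B i)"
      by (intro local_query_rel) (auto simp: set_n_lists)
    then show "local_query (q + m) (\<lambda>B us. js \<in> interp A i \<longleftrightarrow> map ((!) us) js \<in> interp B i)"
      using local_query_not by (cases "js \<in> interp A i") auto
  qed
  moreover have "local_query (q + m) ?cen"
  proof (intro local_query_ball)
    fix p assume "p \<in> set [0..<m]"
    then have "cs ! p < q" using A(3,4) nth_mem[of p cs] by fastforce
    then show "local_query (q + m) (\<lambda>B us. us ! (q + p) = us ! (cs ! p))"
      using \<open>p \<in> set [0..<m]\<close> by (intro local_query_eq) auto
  qed
  ultimately have "local_query (q + m) (\<lambda>B us. ?dist B us \<and> ?cov B us \<and> ?diag B us \<and> ?cen B us)"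
    by (intro local_query_and)
  from local_query_ex_nbhd_list[OF this atLeast_upt[of m, THEN equalityD2], of s]
  have "local_query m (\<lambda>B us. \<exists>bs. length bs = q \<and> set bs \<subseteq> nbhd B s (map ((!) us) [0..<m]) \<and>
     ?dist B (bs @ us) \<and> ?cov B (bs @ us) \<and> ?diag B (bs @ us) \<and> ?cen B (bs @ us))" .
  then show ?thesis
  proof (rule local_query_cong)
    fix B :: "nat struct" and us assume B: "is_struct \<sigma> B" and us: "us \<in> tuples B m"
    then have l: "length us = m" by (simp add: tuples_iff)
    then have u: "map ((!) us) [0..<m] = us" by (auto simp: map_nth)
    have body: "?dist B (bs @ us) \<and> ?cov B (bs @ us) \<and> ?diag B (bs @ us) \<and> ?cen B (bs @ us) \<longleftrightarrow>
       distinct bs \<and> nbhd B s us \<subseteq> set bs \<and>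
        (\<forall>i<length \<sigma>. \<forall>js\<in>set (List.n_lists (\<sigma> ! i) [0..<q]). js \<in> interp A i \<longleftrightarrow> map ((!) bs) js \<in> interp B i) \<and>
        us = map ((!) bs) cs" if bs: "length bs = q" for bs
    proof -
      have 1: "?dist B (bs @ us) \<longleftrightarrow> distinct bs"
      proof -
        have "distinct bs \<longleftrightarrow> (\<forall>i\<in>set [0..<q]. \<forall>j\<in>set [0..<q]. i = j \<or> \<not> bs ! i = bs ! j)"
          unfolding distinct_conv_nth bs Ball_def set_upt atLeastLessThan_iff by blast
        also have "\<dots> \<longleftrightarrow> ?dist B (bs @ us)"
          using bs by (intro ball_cong refl) (simp add: nth_append)
        finally show ?thesis by blast
      qed
      have "map ((!) (bs @ us)) [q..<q + m] = us"
        using l bs by (auto intro!: nth_equalityI simp: nth_append)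
      moreover have "(\<exists>j\<in>set [0..<q]. (z # bs @ us) ! 0 = (z # bs @ us) ! Suc j) \<longleftrightarrow> z \<in> set bs" for z
        using bs unfolding in_set_conv_nth by (auto simp: nth_append)
      ultimately have 2: "?cov B (bs @ us) \<longleftrightarrow> nbhd B s us \<subseteq> set bs"
        by (simp add: subset_iff Ball_def)
      have "map ((!) (bs @ us)) js = map ((!) bs) js" if "js\<in>set (List.n_lists k [0..<q])" for js k
        using that bs by (auto simp: set_n_lists nth_append)
      note sel = this
      have 3: "?diag B (bs @ us) \<longleftrightarrow> (\<forall>i<length \<sigma>. \<forall>js\<in>set (List.n_lists (\<sigma> ! i) [0..<q]). js \<in> interp A i \<longleftrightarrow> map ((!) bs) js \<in> interp B i)"
        by (simp add: sel Ball_def del: map_eq_conv)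
      have 4: "?cen B (bs @ us) \<longleftrightarrow> us = map ((!) bs) cs"
      proof -
        have "cs ! p < q" if "p < m" for p using that A(3,4) nth_mem[of p cs] by fastforce
        then have "?cen B (bs @ us) \<longleftrightarrow> (\<forall>p<m. us ! p = bs ! (cs ! p))"
          using bs by (auto simp: nth_append)
        also have "\<dots> \<longleftrightarrow> us = map ((!) bs) cs" using l A(3) by (auto simp: list_eq_iff_nth_eq)
        finally show ?thesis .
      qed
      show ?thesis unfolding 1 2 3 4 ..
    qed
    show "isomorphic (sphere B s us) (A, cs) \<longleftrightarrow> (\<exists>bs. length bs = q \<and> set bs \<subseteq> nbhd B s (map ((!) us) [0..<m]) \<and>
     ?dist B (bs @ us) \<and> ?cov B (bs @ us) \<and> ?diag B (bs @ us) \<and> ?cen B (bs @ us))"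
      unfolding isomorphic_sphere_iff[OF B us A] u
      by (rule ex_cong1, rule conj_cong[OF refl], rule conj_cong[OF refl], erule body[symmetric])
  qed
qed

end

section \<open>Types and separation\<close>

text \<open>The counterpart of \<open>nbhd\<close> for a set of centres and without intersection
  with the universe, which makes the laws below unconditional. The two agree by
  \<open>nbhd_eq_ball\<close>.\<close>

definition ball :: "'a struct \<Rightarrow> nat \<Rightarrow> 'a set \<Rightarrow> 'a set" where
  "ball B s X = {v. \<exists>u\<in>X. \<exists>m\<le>s. (u, v) \<in> gaifman B ^^ m}"

lemma ballI: "u \<in> X \<Longrightarrow> m \<le> s \<Longrightarrow> (u, v) \<in> gaifman B ^^ m \<Longrightarrow> v \<in> ball B s X"
  unfolding ball_def by blast

lemma subset_ball: "X \<subseteq> ball B s X"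
  unfolding ball_def by (auto intro!: exI[of _ 0])

lemma in_ball: "x \<in> X \<Longrightarrow> x \<in> ball B s X"
  using subset_ball by (rule subsetD)

lemma ball_mono: "X \<subseteq> Y \<Longrightarrow> s \<le> t \<Longrightarrow> ball B s X \<subseteq> ball B t Y"
  unfolding ball_def by (rule Collect_mono) (meson in_mono order_trans)

lemma ball_Un: "ball B s (X \<union> Y) = ball B s X \<union> ball B s Y"
  unfolding ball_def by blast

lemma ball_empty [simp]: "ball B s {} = {}"
  unfolding ball_def by blast

lemma ball_ball: "ball B s (ball B t X) = ball B (t + s) X"
proof
  show "ball B s (ball B t X) \<subseteq> ball B (t + s) X"
  proof
    fix v assume "v \<in> ball B s (ball B t X)"
    then obtain u m y m' where "u \<in> X" "m \<le> t" "(u, y) \<in> gaifman B ^^ m" "m' \<le> s" "(y, v) \<in> gaifman B ^^ m'"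
      unfolding ball_def by blast
    then show "v \<in> ball B (t + s) X"
      by (intro ballI[of u _ "m + m'"]) (auto simp: relpow_add)
  qed
  show "ball B (t + s) X \<subseteq> ball B s (ball B t X)"
  proof
    fix v assume "v \<in> ball B (t + s) X"
    then obtain u m where u: "u \<in> X" "m \<le> t + s" "(u, v) \<in> gaifman B ^^ m" by (auto simp: ball_def)
    show "v \<in> ball B s (ball B t X)"
    proof (cases "m \<le> t")
      case True
      then have "v \<in> ball B t X" using u unfolding ball_def by blast
      then show ?thesis using subset_ball[of "ball B t X" B s] by blast
    next
      case False
      then have "(u, v) \<in> gaifman B ^^ (t + (m - t))" using u(3) by simp
      then have "(u, v) \<in> gaifman B ^^ t O gaifman B ^^ (m - t)" by (simp only: relpow_add)
      then obtain y where "(u, y) \<in> gaifman B ^^ t" "(y, v) \<in> gaifman B ^^ (m - t)" by blast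
      then have "y \<in> ball B t X" using u(1) by (intro ballI[of u X t]) auto
      then show ?thesis using \<open>(y, v) \<in> gaifman B ^^ (m - t)\<close> u(2) by (intro ballI[of y "ball B t X" "m - t"]) auto
    qed
  qed
qed

lemma ball_member_trans: "u \<in> ball B t X \<Longrightarrow> v \<in> ball B s {u} \<Longrightarrow> t + s \<le> r \<Longrightarrow> v \<in> ball B r X"
  using ball_ball[of B s t X] ball_mono[of "{u}" "ball B t X" s s B] ball_mono[of X X "t + s" r B] by blast

lemma gaifman_sym: "(u, v) \<in> gaifman B \<Longrightarrow> (v, u) \<in> gaifman B"
  unfolding gaifman_def by auto

lemma gaifman_relpow_sym: "(u, v) \<in> gaifman B ^^ m \<Longrightarrow> (v, u) \<in> gaifman B ^^ m"
proof (induction m arbitrary: v)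
  case (Suc m)
  then show ?case by (meson gaifman_sym relpow_Suc_E relpow_Suc_I2)
qed simp

lemma ball_sym: "v \<in> ball B s {u} \<Longrightarrow> u \<in> ball B s {v}"
  unfolding ball_def using gaifman_relpow_sym by fastforce

lemma gaifman_ball: "(u, v) \<in> gaifman B \<Longrightarrow> v \<in> ball B 1 {u}"
  unfolding ball_def by (auto intro!: exI[of _ "Suc 0"])

text \<open>Distinct entries of a tuple are adjacent, so one additional unit of radius captures the
  whole tuple.\<close>

lemma tuple_in_ball:
  assumes "us \<in> interp B i" "u \<in> set us" "u \<in> ball B t X" "Suc t \<le> s"
  shows "set us \<subseteq> ball B s X"
proof
  fix v assume "v \<in> set us"
  then have "v = u \<or> (u, v) \<in> gaifman B" using assms(1,2) by (auto simp: gaifman_def)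
  then show "v \<in> ball B s X"
  proof
    assume "v = u"
    then show ?thesis using assms(3,4) ball_mono[of X X t s B] by auto
  next
    assume "(u, v) \<in> gaifman B"
    then show ?thesis using assms(4) by (intro ball_member_trans[OF assms(3) gaifman_ball]) auto
  qed
qed

section \<open>Isomorphisms between parts of one structure\<close>

lemma image_subset_imp_subset: "inj_on f C \<Longrightarrow> X \<subseteq> C \<Longrightarrow> Y \<subseteq> C \<Longrightarrow> f ` X \<subseteq> f ` Y \<Longrightarrow> X \<subseteq> Y"
  by (auto simp: inj_on_def image_subset_iff) blast

text \<open>An isomorphism between two induced substructures of the same structure. Gaifman edges of
  \<open>B\<close> are not mentioned: a tuple witnessing an edge may leave \<open>X\<close>, so
  adjacency has to be recovered where the witness stays inside.\<close>

definition partial_iso :: "'a struct \<Rightarrow> ('a \<Rightarrow> 'a) \<Rightarrow> 'a set \<Rightarrow> 'a set \<Rightarrow> bool" where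
  "partial_iso B f X Y \<longleftrightarrow> bij_betw f X Y \<and>
     (\<forall>i us. set us \<subseteq> X \<longrightarrow> (us \<in> interp B i \<longleftrightarrow> map f us \<in> interp B i))"

lemma partial_iso_id: "partial_iso B id X X"
  by (simp add: partial_iso_def)

lemma partial_iso_inv:
  assumes "partial_iso B f X Y"
  shows "partial_iso B (inv_into X f) Y X"
proof -
  have f: "bij_betw f X Y" using assms by (simp add: partial_iso_def)
  have "us \<in> interp B i \<longleftrightarrow> map (inv_into X f) us \<in> interp B i" if "set us \<subseteq> Y" for i us
  proof -
    have "map f (map (inv_into X f) us) = us"
      using that f by (auto intro!: map_idI simp: bij_betw_inv_into_right)
    moreover have "set (map (inv_into X f) us) \<subseteq> X"
      using that bij_betw_inv_into[OF f] by (auto simp: bij_betw_def)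
    ultimately show ?thesis using assms unfolding partial_iso_def by metis
  qed
  then show ?thesis using bij_betw_inv_into[OF f] by (simp add: partial_iso_def)
qed

lemma partial_iso_comp:
  assumes "partial_iso B f X Y" "partial_iso B g Y Z"
  shows "partial_iso B (g \<circ> f) X Z"
proof -
  have f: "bij_betw f X Y" and g: "bij_betw g Y Z" using assms by (simp_all add: partial_iso_def)
  have "us \<in> interp B i \<longleftrightarrow> map (g \<circ> f) us \<in> interp B i" if "set us \<subseteq> X" for i us
  proof -
    have "set (map f us) \<subseteq> Y" using that f by (auto simp: bij_betw_def)
    then have "map f us \<in> interp B i \<longleftrightarrow> map g (map f us) \<in> interp B i"
      using assms(2) unfolding partial_iso_def by blast
    then show ?thesis using assms(1) that unfolding partial_iso_def by simp
  qed
  then show ?thesis using bij_betw_trans[OF f g] by (simp add: partial_iso_def)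
qed

lemma partial_iso_restrict:
  assumes "partial_iso B f X Y" "X' \<subseteq> X"
  shows "partial_iso B f X' (f ` X')"
  using assms unfolding partial_iso_def by (auto intro: bij_betw_subset)

text \<open>An edge at an element of radius less than \<open>s\<close> is witnessed by a tuple
  inside the ball of radius \<open>s\<close>, and \<open>f\<close> preserves that tuple. Edges
  between two elements on the boundary are not covered.\<close>

lemma partial_iso_edge:
  assumes f: "partial_iso B f (ball B s X) Y'" and u: "u \<in> ball B t X" "Suc t \<le> s" and uv: "(u, v) \<in> gaifman B"
  shows "(f u, f v) \<in> gaifman B"
proof -
  obtain i us where us: "us \<in> interp B i" "u \<in> set us" "v \<in> set us" "u \<noteq> v"
    using uv by (auto simp: gaifman_def)
  have sub: "set us \<subseteq> ball B s X" using tuple_in_ball[OF us(1,2) u] .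
  then have "map f us \<in> interp B i" using f us(1) by (auto simp: partial_iso_def)
  moreover have "f u \<noteq> f v" using f us sub by (auto simp: partial_iso_def bij_betw_def dest: inj_onD)
  ultimately show ?thesis using us by (force simp: gaifman_def)
qed

lemma partial_iso_walk:
  assumes f: "partial_iso B f (ball B s X) Y'"
    and "u \<in> ball B t X" "t + m \<le> s" "(u, v) \<in> gaifman B ^^ m"
  shows "(f u, f v) \<in> gaifman B ^^ m"
  using assms(2-)
proof (induction m arbitrary: v)
  case (Suc m)
  then obtain y where y: "(u, y) \<in> gaifman B ^^ m" "(y, v) \<in> gaifman B" by auto
  then have "y \<in> ball B (t + m) X"
    using Suc.prems(1) by (intro ball_member_trans[of u B t X y m]) (auto simp: ball_def)
  then have "(f y, f v) \<in> gaifman B"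
    using partial_iso_edge[OF f _ _ y(2)] Suc.prems(2) by auto
  with Suc y(1) show ?case by auto
qed simp

text \<open>Walks of length at most \<open>r\<close> from \<open>Z\<close> stay within radius
  \<open>t + r\<close> and are therefore mapped to walks. Applying this to the inverse map gives the
  other inclusion.\<close>

lemma partial_iso_ball:
  assumes f: "partial_iso B f (ball B s X) (ball B s (f ` X))"
    and Z: "Z \<subseteq> ball B t X" "t + r \<le> s"
  shows "f ` ball B r Z = ball B r (f ` Z)"
proof -
  have sub: "f ` ball B r Z \<subseteq> ball B r (f ` Z)"
    if f: "partial_iso B f (ball B s X) Y" and Z: "Z \<subseteq> ball B t X" "t + r \<le> s" for f X Y Z t r
  proof
    fix v' assume "v' \<in> f ` ball B r Z"
    then obtain u m v where v: "u \<in> Z" "m \<le> r" "(u, v) \<in> gaifman B ^^ m" "v' = f v" by (auto simp: ball_def)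
    have "(f u, f v) \<in> gaifman B ^^ m"
      by (rule partial_iso_walk[OF f _ _ v(3), of t]) (use v Z in auto)
    then show "v' \<in> ball B r (f ` Z)" using v by (auto simp: ball_def)
  qed
  let ?g = "inv_into (ball B s X) f"
  have inj: "inj_on f (ball B s X)" and im: "f ` ball B s X = ball B s (f ` X)"
    using f by (auto simp: partial_iso_def bij_betw_def)
  have gf: "?g ` (f ` W) = W" if "W \<subseteq> ball B s X" for W
    using that inj by (force simp: image_image inv_into_f_f)
  have Zs: "Z \<subseteq> ball B s X" using Z ball_mono[of X X t s B] by auto
  have fZ: "f ` Z \<subseteq> ball B t (f ` X)"
    using sub[OF f subset_ball[of X B 0], of t] Z by auto
  have "?g ` ball B r (f ` Z) \<subseteq> ball B r (?g ` (f ` Z))"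
    by (rule sub[OF partial_iso_inv[OF f] fZ Z(2)])
  then have "?g ` ball B r (f ` Z) \<subseteq> ball B r Z" using gf[OF Zs] by simp
  then have "f ` ?g ` ball B r (f ` Z) \<subseteq> f ` ball B r Z" by blast
  moreover have "ball B r (f ` Z) \<subseteq> ball B s (f ` X)"
    using ball_mono[OF fZ order_refl, of B r] ball_ball[of B r t "f ` X"] ball_mono[OF order_refl Z(2), of B "f ` X"] by auto
  then have "f ` ?g ` ball B r (f ` Z) = ball B r (f ` Z)"
    by (intro image_inv_into_cancel[OF im])
  ultimately show ?thesis using sub[OF f Z] by auto
qed

text \<open>The tuples are presented as variable assignments, so that extending a tuple does not require reindexing.\<close>

definition same_type :: "'a struct \<Rightarrow> nat \<Rightarrow> nat set \<Rightarrow> (nat \<Rightarrow> 'a) \<Rightarrow> (nat \<Rightarrow> 'a) \<Rightarrow> bool" where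
  "same_type B s V \<beta> \<gamma> \<longleftrightarrow>
     (\<exists>f. partial_iso B f (ball B s (\<beta> ` V)) (ball B s (\<gamma> ` V)) \<and> (\<forall>x\<in>V. f (\<beta> x) = \<gamma> x))"

section \<open>Types of assignments\<close>

lemma same_type_cong:
  assumes "\<And>x. x \<in> V \<Longrightarrow> \<beta> x = \<beta>' x" "\<And>x. x \<in> V \<Longrightarrow> \<gamma> x = \<gamma>' x"
  shows "same_type B s V \<beta> \<gamma> \<longleftrightarrow> same_type B s V \<beta>' \<gamma>'"
proof -
  have "\<beta> ` V = \<beta>' ` V" "\<gamma> ` V = \<gamma>' ` V" using assms by force+
  then show ?thesis unfolding same_type_def using assms by simp
qed

lemma same_type_refl: "same_type B s V \<beta> \<beta>"
  unfolding same_type_def using partial_iso_id by fastforce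

lemma same_type_sym:
  assumes "same_type B s V \<beta> \<gamma>"
  shows "same_type B s V \<gamma> \<beta>"
proof -
  obtain f where f: "partial_iso B f (ball B s (\<beta> ` V)) (ball B s (\<gamma> ` V))" "\<And>x. x \<in> V \<Longrightarrow> f (\<beta> x) = \<gamma> x"
    using assms by (auto simp: same_type_def)
  have "inv_into (ball B s (\<beta> ` V)) f (\<gamma> x) = \<beta> x" if "x \<in> V" for x
  proof -
    have "\<beta> x \<in> ball B s (\<beta> ` V)" using that by (intro in_ball imageI)
    then show ?thesis using f(1) f(2)[OF that, symmetric] by (simp add: partial_iso_def bij_betw_def inv_into_f_f)
  qed
  then show ?thesis using partial_iso_inv[OF f(1)] unfolding same_type_def by blast
qed

lemma same_type_trans:
  assumes "same_type B s V \<beta> \<gamma>" "same_type B s V \<gamma> \<delta>"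
  shows "same_type B s V \<beta> \<delta>"
proof -
  obtain f where f: "partial_iso B f (ball B s (\<beta> ` V)) (ball B s (\<gamma> ` V))" "\<And>x. x \<in> V \<Longrightarrow> f (\<beta> x) = \<gamma> x"
    using assms by (auto simp: same_type_def)
  obtain g where g: "partial_iso B g (ball B s (\<gamma> ` V)) (ball B s (\<delta> ` V))" "\<And>x. x \<in> V \<Longrightarrow> g (\<gamma> x) = \<delta> x"
    using assms by (auto simp: same_type_def)
  show ?thesis
    unfolding same_type_def using partial_iso_comp[OF f(1) g(1)] f(2) g(2)
    by (intro exI[of _ "g \<circ> f"]) simp
qed

lemma same_typeE:
  assumes "same_type B s V \<beta> \<gamma>"
  obtains f where "partial_iso B f (ball B s (\<beta> ` V)) (ball B s (f ` \<beta> ` V))"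
    "\<And>x. x \<in> V \<Longrightarrow> \<gamma> x = f (\<beta> x)" "f ` \<beta> ` V = \<gamma> ` V"
proof -
  obtain f where f: "partial_iso B f (ball B s (\<beta> ` V)) (ball B s (\<gamma> ` V))" "\<And>x. x \<in> V \<Longrightarrow> f (\<beta> x) = \<gamma> x"
    using assms by (auto simp: same_type_def)
  moreover have "f ` \<beta> ` V = \<gamma> ` V" using f(2) by force
  ultimately show ?thesis using that by metis
qed

text \<open>One isomorphism around \<open>V\<close> serves for every assignment of further variables
  with values within \<open>t\<close> of \<open>V\<close>; the distance \<open>t\<close> is deducted
  from the radius. This is how values near the given tuple are transported from one side to the
  other.\<close>

lemma same_type_extend:
  assumes f: "partial_iso B f (ball B s (\<beta> ` V)) (ball B s (f ` \<beta> ` V))"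
    and near: "\<beta> ` V' \<subseteq> ball B t (\<beta> ` V)" "t + r \<le> s"
    and \<gamma>: "\<And>x. x \<in> V' \<Longrightarrow> \<gamma> x = f (\<beta> x)"
  shows "same_type B r V' \<beta> \<gamma>"
proof -
  have sub: "ball B r (\<beta> ` V') \<subseteq> ball B s (\<beta> ` V)"
    using ball_mono[OF near(1) order_refl, of B r] ball_ball[of B r t "\<beta> ` V"]
      ball_mono[OF order_refl near(2), of B "\<beta> ` V"] by auto
  have "f ` \<beta> ` V' = \<gamma> ` V'" using \<gamma> by force
  then have "f ` ball B r (\<beta> ` V') = ball B r (\<gamma> ` V')"
    using partial_iso_ball[OF f near] by simp
  then show ?thesis
    using partial_iso_restrict[OF f sub] \<gamma> unfolding same_type_def by auto
qed

lemma same_type_mono: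
  assumes "same_type B s V \<beta> \<gamma>" "V' \<subseteq> V" "r \<le> s"
  shows "same_type B r V' \<beta> \<gamma>"
proof -
  obtain f where f: "partial_iso B f (ball B s (\<beta> ` V)) (ball B s (f ` \<beta> ` V))" "\<And>x. x \<in> V \<Longrightarrow> \<gamma> x = f (\<beta> x)"
    "f ` \<beta> ` V = \<gamma> ` V"
    by (rule same_typeE[OF assms(1)]) (rule that, assumption+)
  show ?thesis
    by (rule same_type_extend[OF f(1), of _ 0]) (use assms f subset_ball in fastforce)+
qed

text \<open>
  Unlike being at Gaifman distance greater than \<open>2 s + 1\<close>, this is visible in the type: the tuple
  witnessing an edge between two balls may have entries outside of both.
\<close>

definition separated :: "'a struct \<Rightarrow> nat \<Rightarrow> (nat \<Rightarrow> 'a) \<Rightarrow> nat set \<Rightarrow> nat set \<Rightarrow> bool" where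
  "separated B s \<beta> V X \<longleftrightarrow> ball B s (\<beta> ` V) \<inter> ball B s (\<beta> ` X) = {} \<and>
     (\<forall>i. \<forall>us\<in>interp B i. set us \<subseteq> ball B s (\<beta> ` V) \<union> ball B s (\<beta> ` X) \<longrightarrow>
        set us \<subseteq> ball B s (\<beta> ` V) \<or> set us \<subseteq> ball B s (\<beta> ` X))"

section \<open>Separated and linked sets of variables\<close>

lemma separated_empty: "separated B s \<beta> V {}"
  by (simp add: separated_def)

text \<open>An isomorphism of the joint neighbourhoods maps the two balls onto the corresponding
  balls, and it preserves exactly the tuples of which the definition speaks, those inside the union
  of the balls.\<close>

lemma separated_invariant:
  assumes "same_type B s (V \<union> X) \<beta> \<gamma>" "separated B s \<gamma> V X"
  shows "separated B s \<beta> V X"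
proof -
  obtain f where f: "partial_iso B f (ball B s (\<beta> ` (V \<union> X))) (ball B s (f ` \<beta> ` (V \<union> X)))"
    "\<And>x. x \<in> V \<union> X \<Longrightarrow> \<gamma> x = f (\<beta> x)"
    "f ` \<beta> ` (V \<union> X) = \<gamma> ` (V \<union> X)"
    by (rule same_typeE[OF assms(1)]) (rule that, assumption+)
  have b: "f ` ball B s (\<beta> ` W) = ball B s (\<gamma> ` W)" if "W \<subseteq> V \<union> X" for W
  proof -
    have "f ` ball B s (\<beta> ` W) = ball B s (f ` \<beta> ` W)"
      by (rule partial_iso_ball[OF f(1), of _ 0]) (use that subset_ball in fastforce)+
    also have "f ` \<beta> ` W = \<gamma> ` W" using f(2) that by force
    finally show ?thesis .
  qed
  let ?V = "ball B s (\<beta> ` V)" and ?X = "ball B s (\<beta> ` X)"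
  have un: "ball B s (\<beta> ` (V \<union> X)) = ?V \<union> ?X" by (simp add: image_Un ball_Un)
  have inj: "inj_on f (?V \<union> ?X)" using f(1) unfolding un by (auto simp: partial_iso_def bij_betw_def)
  have V: "f ` ?V = ball B s (\<gamma> ` V)" and X: "f ` ?X = ball B s (\<gamma> ` X)" using b by auto
  have "?V \<inter> ?X = {}"
  proof -
    have "f ` ?V \<inter> f ` ?X = {}" using assms(2) unfolding V X separated_def by blast
    then show ?thesis by blast
  qed
  moreover have "set us \<subseteq> ?V \<or> set us \<subseteq> ?X" if us: "us \<in> interp B i" "set us \<subseteq> ?V \<union> ?X" for i us
  proof -
    have "map f us \<in> interp B i" using f(1) us unfolding un by (auto simp: partial_iso_def)
    moreover have "set (map f us) \<subseteq> f ` ?V \<union> f ` ?X" using us(2) by auto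
    ultimately have "f ` set us \<subseteq> f ` ?V \<or> f ` set us \<subseteq> f ` ?X"
      using assms(2) unfolding V X separated_def by (metis set_map)
    then show ?thesis
      using image_subset_imp_subset[OF inj us(2), of ?V] image_subset_imp_subset[OF inj us(2), of ?X] by auto
  qed
  ultimately show ?thesis by (auto simp: separated_def)
qed

text \<open>The distance is s + 1 + s: the balls meet, or an edge leads from one to the
  other.\<close>

lemma not_separated_near:
  assumes "\<not> separated B s \<beta> V X"
  shows "\<exists>x\<in>X. \<beta> x \<in> ball B (2 * s + 1) (\<beta> ` V)"
proof -
  have "\<exists>p\<in>ball B s (\<beta> ` V). \<exists>q\<in>ball B s (\<beta> ` X). q \<in> ball B 1 {p}"
  proof (cases "ball B s (\<beta> ` V) \<inter> ball B s (\<beta> ` X) = {}")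
    case False
    then obtain p where "p \<in> ball B s (\<beta> ` V)" "p \<in> ball B s (\<beta> ` X)" by blast
    then show ?thesis using in_ball[of p "{p}" B 1] by blast
  next
    case True
    then obtain i us where us: "us \<in> interp B i" "set us \<subseteq> ball B s (\<beta> ` V) \<union> ball B s (\<beta> ` X)"
      "\<not> set us \<subseteq> ball B s (\<beta> ` V)" "\<not> set us \<subseteq> ball B s (\<beta> ` X)"
      using assms by (auto simp: separated_def)
    then obtain p q where "p \<in> set us" "p \<in> ball B s (\<beta> ` V)" "q \<in> set us" "q \<in> ball B s (\<beta> ` X)" by blast
    moreover have "p \<noteq> q" using True calculation by blast
    moreover have "(p, q) \<in> gaifman B" using us(1) calculation unfolding gaifman_def by blast
    ultimately show ?thesis using gaifman_ball[of p q B] by blast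
  qed
  then obtain p q where p: "p \<in> ball B s (\<beta> ` V)" and q: "q \<in> ball B s (\<beta> ` X)" and pq: "q \<in> ball B 1 {p}" by blast
  obtain x where x: "x \<in> X" "q \<in> ball B s {\<beta> x}" using q unfolding ball_def by blast
  have "q \<in> ball B (s + 1) (\<beta> ` V)" using ball_member_trans[OF p pq] by simp
  then have "\<beta> x \<in> ball B (2 * s + 1) (\<beta> ` V)"
    by (rule ball_member_trans[OF _ ball_sym[OF x(2)]]) simp
  then show ?thesis using x by blast
qed

text \<open>The two isomorphisms are glued. Separation under \<open>\<beta>\<close> puts every tuple
  of the domain into one of the two parts; separation under \<open>\<gamma>\<close> does the same
  for tuples of the image, so that relations are also reflected.\<close>

lemma same_type_Un:
  assumes "same_type B s V \<beta> \<gamma>" "same_type B s X \<beta> \<gamma>" "separated B s \<beta> V X" "separated B s \<gamma> V X"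
  shows "same_type B s (V \<union> X) \<beta> \<gamma>"
proof -
  let ?V = "ball B s (\<beta> ` V)" and ?X = "ball B s (\<beta> ` X)"
  let ?V' = "ball B s (\<gamma> ` V)" and ?X' = "ball B s (\<gamma> ` X)"
  obtain f where f: "partial_iso B f ?V ?V'" "\<And>x. x \<in> V \<Longrightarrow> f (\<beta> x) = \<gamma> x"
    using assms(1) by (auto simp: same_type_def)
  obtain g where g: "partial_iso B g ?X ?X'" "\<And>x. x \<in> X \<Longrightarrow> g (\<beta> x) = \<gamma> x"
    using assms(2) by (auto simp: same_type_def)
  define h where "h = (\<lambda>v. if v \<in> ?V then f v else g v)"
  have disj: "?V \<inter> ?X = {}" "?V' \<inter> ?X' = {}" using assms(3,4) by (auto simp: separated_def)
  have hf: "h v = f v" if "v \<in> ?V" for v using that by (simp add: h_def)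
  have hg: "h v = g v" if "v \<in> ?X" for v using that disj by (auto simp: h_def)
  have bf: "bij_betw h ?V ?V'" using bij_betw_cong[of ?V h f ?V'] hf f(1) by (simp add: partial_iso_def)
  have bg: "bij_betw h ?X ?X'" using bij_betw_cong[of ?X h g ?X'] hg g(1) by (simp add: partial_iso_def)
  have bij: "bij_betw h (?V \<union> ?X) (?V' \<union> ?X')" using bij_betw_combine[OF bf bg disj(2)] .
  have mf: "map h us = map f us" if "set us \<subseteq> ?V" for us using that hf by auto
  have mg: "map h us = map g us" if "set us \<subseteq> ?X" for us using that hg by auto
  have rV: "us \<in> interp B i \<longleftrightarrow> map h us \<in> interp B i" if "set us \<subseteq> ?V" for us i
    using f(1) that unfolding mf[OF that] partial_iso_def by blast
  have rX: "us \<in> interp B i \<longleftrightarrow> map h us \<in> interp B i" if "set us \<subseteq> ?X" for us i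
    using g(1) that unfolding mg[OF that] partial_iso_def by blast
  have "us \<in> interp B i \<longleftrightarrow> map h us \<in> interp B i" if us: "set us \<subseteq> ?V \<union> ?X" for us i
  proof
    assume "us \<in> interp B i"
    moreover have "set us \<subseteq> ?V \<or> set us \<subseteq> ?X"
      using assms(3) calculation us unfolding separated_def by blast
    ultimately show "map h us \<in> interp B i" using rV rX by blast
  next
    assume a: "map h us \<in> interp B i"
    have hs: "h ` set us \<subseteq> ?V' \<union> ?X'" using us bij by (auto simp: bij_betw_def)
    have "set (map h us) \<subseteq> ?V' \<or> set (map h us) \<subseteq> ?X'"
      using assms(4) a hs unfolding separated_def by (metis set_map)
    then have "h ` set us \<subseteq> h ` ?V \<or> h ` set us \<subseteq> h ` ?X" using bf bg by (auto simp: bij_betw_def)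
    then have "set us \<subseteq> ?V \<or> set us \<subseteq> ?X"
      using image_subset_imp_subset[OF bij_betw_imp_inj_on[OF bij] us, of ?V]
        image_subset_imp_subset[OF bij_betw_imp_inj_on[OF bij] us, of ?X] by auto
    then show "us \<in> interp B i" using a rV rX by blast
  qed
  then have "partial_iso B h (ball B s (\<beta> ` (V \<union> X))) (ball B s (\<gamma> ` (V \<union> X)))"
    using bij by (simp add: partial_iso_def image_Un ball_Un)
  moreover have "h (\<beta> x) = \<gamma> x" if "x \<in> V \<union> X" for x
  proof (cases "x \<in> V")
    case True
    then have "\<beta> x \<in> ?V" by (intro in_ball imageI)
    then show ?thesis using hf f(2) True by simp
  next
    case False
    then have "x \<in> X" using that by simp
    then have "\<beta> x \<in> ?X" by (intro in_ball imageI)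
    then show ?thesis using hg g(2) \<open>x \<in> X\<close> by simp
  qed
  ultimately show ?thesis unfolding same_type_def by blast
qed

text \<open>Being linked is determined by the type and, by \<open>linked_near\<close> below, forces \<open>D\<close> to be near \<open>V\<close>.\<close>

definition linked :: "'a struct \<Rightarrow> nat \<Rightarrow> (nat \<Rightarrow> 'a) \<Rightarrow> nat set \<Rightarrow> nat set \<Rightarrow> bool" where
  "linked B s \<beta> V D \<longleftrightarrow> (\<forall>D'. D' \<subset> D \<longrightarrow> \<not> separated B s \<beta> (V \<union> D') (D - D'))"

lemma linked_invariant:
  assumes "same_type B s (V \<union> D) \<beta> \<gamma>" "linked B s \<gamma> V D"
  shows "linked B s \<beta> V D"
  unfolding linked_def
proof (intro allI impI)
  fix D' assume "D' \<subset> D"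
  then have "(V \<union> D') \<union> (D - D') = V \<union> D" by blast
  then have "same_type B s ((V \<union> D') \<union> (D - D')) \<gamma> \<beta>" using same_type_sym[OF assms(1)] by simp
  then show "\<not> separated B s \<beta> (V \<union> D') (D - D')"
    using assms(2) \<open>D' \<subset> D\<close> separated_invariant[of B s "V \<union> D'" "D - D'" \<gamma> \<beta>] unfolding linked_def by metis
qed

text \<open>Choose a maximal \<open>D\<close> whose values lie within \<open>card D * t\<close> of
  \<open>E\<close>: another point within \<open>t\<close> of \<open>E\<close> or of \<open>D\<close>
  could be added, since the enlarged set is allowed one more \<open>t\<close>. This bounds chains
  both for counted variables and for the parameters of a hypothesis.\<close>

lemma near_closure:
  fixes \<beta> :: "nat \<Rightarrow> 'a"
  assumes "finite X"
  obtains D where "D \<subseteq> X" "\<beta> ` D \<subseteq> ball B (card D * t) E" "\<And>x. x \<in> X - D \<Longrightarrow> \<beta> x \<notin> ball B t (E \<union> \<beta> ` D)"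
proof -
  define S where "S = {D. D \<subseteq> X \<and> \<beta> ` D \<subseteq> ball B (card D * t) E}"
  have "finite S" "{} \<in> S" using assms by (auto simp: S_def)
  then obtain D where D: "D \<in> S" "\<And>D'. D' \<in> S \<Longrightarrow> D \<subseteq> D' \<Longrightarrow> D = D'"
    using finite_has_maximal[of S] by auto
  have fin: "finite D" using D(1) assms finite_subset by (auto simp: S_def)
  show ?thesis
  proof (rule that[of D])
    fix x assume x: "x \<in> X - D"
    show "\<beta> x \<notin> ball B t (E \<union> \<beta> ` D)"
    proof
      assume "\<beta> x \<in> ball B t (E \<union> \<beta> ` D)"
      moreover have "E \<union> \<beta> ` D \<subseteq> ball B (card D * t) E"
        using D(1) in_ball[of _ E B "card D * t"] by (auto simp: S_def)
      ultimately have "\<beta> x \<in> ball B t (ball B (card D * t) E)"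
        using ball_mono[of "E \<union> \<beta> ` D" "ball B (card D * t) E" t t B] by auto
      then have "\<beta> x \<in> ball B (card (insert x D) * t) E" using x fin by (simp add: ball_ball add.commute)
      moreover have "ball B (card D * t) E \<subseteq> ball B (card (insert x D) * t) E"
        using x fin by (intro ball_mono) auto
      ultimately have "insert x D \<in> S" using D(1) x by (auto simp: S_def)
      then have "D = insert x D" by (rule D(2)) auto
      then show False using x by blast
    qed
  qed (use D(1) in \<open>auto simp: S_def\<close>)
qed

text \<open>If the near closure of \<open>V\<close> inside \<open>D\<close> were a proper subset,
  linkedness would provide a further element of \<open>D\<close> within \<open>2 * s + 1\<close> of
  it.\<close>

lemma linked_near:
  assumes "linked B s \<beta> V D" "finite D"
  shows "\<beta> ` D \<subseteq> ball B (card D * (2 * s + 1)) (\<beta> ` V)"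
proof -
  obtain D' where D': "D' \<subseteq> D" "\<beta> ` D' \<subseteq> ball B (card D' * (2 * s + 1)) (\<beta> ` V)"
    "\<And>x. x \<in> D - D' \<Longrightarrow> \<beta> x \<notin> ball B (2 * s + 1) (\<beta> ` V \<union> \<beta> ` D')"
    by (rule near_closure[OF assms(2)]) (rule that, assumption+)
  have "D' = D"
  proof (rule ccontr)
    assume "D' \<noteq> D"
    then have "\<not> separated B s \<beta> (V \<union> D') (D - D')" using assms(1) D'(1) by (auto simp: linked_def)
    from not_separated_near[OF this] show False using D'(3) by (auto simp: image_Un)
  qed
  then show ?thesis using D'(2) by simp
qed

text \<open>Take a minimal \<open>D\<close> such that the rest of \<open>X\<close> is separated from
  \<open>V\<close> together with \<open>D\<close>; \<open>X\<close> itself is such a set. It is not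
  empty, because \<open>V\<close> and \<open>X\<close> are not separated.\<close>

lemma exists_linked:
  assumes "finite X" "\<not> separated B s \<beta> V X"
  obtains D where "D \<subseteq> X" "D \<noteq> {}" "linked B s \<beta> V D"
proof -
  define S where "S = {D. D \<subseteq> X \<and> separated B s \<beta> (V \<union> D) (X - D)}"
  have "finite S" "X \<in> S" using assms by (auto simp: S_def separated_empty)
  then obtain D where D: "D \<in> S" "\<And>D'. D' \<in> S \<Longrightarrow> D' \<subseteq> D \<Longrightarrow> D = D'"
    using finite_has_minimal[of S] by auto
  have DX: "D \<subseteq> X" and sD: "separated B s \<beta> (V \<union> D) (X - D)" using D(1) by (auto simp: S_def)
  have "D \<noteq> {}" using sD assms(2) by auto
  moreover have "linked B s \<beta> V D"
    unfolding linked_def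
  proof (intro allI impI notI)
    fix D' assume D': "D' \<subset> D" and sD': "separated B s \<beta> (V \<union> D') (D - D')"
    let ?A = "ball B s (\<beta> ` (V \<union> D'))" and ?M = "ball B s (\<beta> ` (D - D'))" and ?Y = "ball B s (\<beta> ` (X - D))"
    have "V \<union> D = (V \<union> D') \<union> (D - D')" "X - D' = (D - D') \<union> (X - D)" using D' DX by blast+
    then have 1: "ball B s (\<beta> ` (V \<union> D)) = ?A \<union> ?M" and 2: "ball B s (\<beta> ` (X - D')) = ?M \<union> ?Y"
      by (metis image_Un ball_Un)+
    \<comment> \<open>A tuple inside the three parts \<open>?A\<close>, \<open>?M\<close>,
      \<open>?Y\<close> lies in \<open>?Y\<close> or in \<open>?A\<close> and \<open>?M\<close>
      together, and in the latter case in one of these two. So \<open>D'\<close> would contradict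
      minimality.\<close>
    have "separated B s \<beta> (V \<union> D') (X - D')"
      using sD sD' unfolding separated_def 1 2 by blast
    then have "D' \<in> S" using D' DX by (auto simp: S_def)
    then show False using D(2)[of D'] D' by blast
  qed
  ultimately show ?thesis using that DX by blast
qed

section \<open>Locality of counting logic\<close>

text \<open>On the two ranges \<open>Q\<close> is a union of classes of the equivalence
  \<open>R\<close>, so both sides can be counted class by class. Only finitely many classes occur,
  since \<open>C\<close> is finite.\<close>

lemma card_Collect_classes:
  assumes "finite C"
    and R: "\<And>x. R x x" "\<And>x y. R x y \<Longrightarrow> R y x" "\<And>x y z. R x y \<Longrightarrow> R y z \<Longrightarrow> R x z"
    and inv: "\<And>x y. x \<in> F ` C \<union> G ` C \<Longrightarrow> y \<in> F ` C \<union> G ` C \<Longrightarrow> R x y \<Longrightarrow> Q x \<Longrightarrow> Q y"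
    and eq: "\<And>e. e \<in> F ` C \<union> G ` C \<Longrightarrow> Q e \<Longrightarrow> card {c \<in> C. R (F c) e} = card {c \<in> C. R (G c) e}"
  shows "card {c \<in> C. Q (F c)} = card {c \<in> C. Q (G c)}"
proof -
  define key where "key = (\<lambda>x. {y. R x y})"
  have key: "key x = key y \<longleftrightarrow> R x y" for x y
  proof
    assume "key x = key y"
    then have "y \<in> key x" using R(1)[of y] by (simp add: key_def)
    then show "R x y" by (simp add: key_def)
  next
    assume "R x y"
    show "key x = key y"
      unfolding key_def using R(3)[OF R(2)[OF \<open>R x y\<close>]] R(3)[OF \<open>R x y\<close>] by auto
  qed
  let ?T = "key ` {x \<in> F ` C \<union> G ` C. Q x}"
  have fin: "finite ?T" using assms(1) by simp
  have *: "card {c \<in> C. Q (H c)} = (\<Sum>K\<in>?T. card {c \<in> C. key (H c) = K})" if H: "H ` C \<subseteq> F ` C \<union> G ` C" for H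
  proof -
    have "{c \<in> C. Q (H c)} = (\<Union>K\<in>?T. {c \<in> C. key (H c) = K})"
    proof
      show "{c \<in> C. Q (H c)} \<subseteq> (\<Union>K\<in>?T. {c \<in> C. key (H c) = K})"
      proof
        fix c assume "c \<in> {c \<in> C. Q (H c)}"
        then have "c \<in> C" "H c \<in> {x \<in> F ` C \<union> G ` C. Q x}" using H by auto
        then show "c \<in> (\<Union>K\<in>?T. {c \<in> C. key (H c) = K})" by (intro UN_I[of "key (H c)"] imageI) auto
      qed
      show "(\<Union>K\<in>?T. {c \<in> C. key (H c) = K}) \<subseteq> {c \<in> C. Q (H c)}"
      proof
        fix c assume "c \<in> (\<Union>K\<in>?T. {c \<in> C. key (H c) = K})"
        then obtain x where x: "x \<in> F ` C \<union> G ` C" "Q x" "c \<in> C" "key x = key (H c)" by auto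
        then have "R x (H c)" using key by simp
        then show "c \<in> {c \<in> C. Q (H c)}" using inv[OF x(1) _ _ x(2), of "H c"] H x(3) by blast
      qed
    qed
    then have "card {c \<in> C. Q (H c)} = card (\<Union>K\<in>?T. {c \<in> C. key (H c) = K})" by (rule arg_cong)
    also have "\<dots> = (\<Sum>K\<in>?T. card {c \<in> C. key (H c) = K})"
      by (rule card_UN_disjoint[OF fin]) (use assms(1) in auto)
    finally show ?thesis .
  qed
  have "card {c \<in> C. key (F c) = K} = card {c \<in> C. key (G c) = K}" if "K \<in> ?T" for K
    using that eq key by auto
  then show ?thesis using *[of F] *[of G] by simp
qed

text \<open>Values on \<open>D\<close> are chosen first and values on the rest afterwards.
  Overriding in two stages gives the same assignment as overriding at once.\<close>

lemma card_PiE_split: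
  assumes "finite X" "finite U" "D \<subseteq> X"
  shows "card {c \<in> X \<rightarrow>\<^sub>E U. Q (override_on \<beta> c X)} =
    (\<Sum>e \<in> D \<rightarrow>\<^sub>E U. card {c \<in> (X - D) \<rightarrow>\<^sub>E U. Q (override_on (override_on \<beta> e D) c (X - D))})"
proof -
  let ?g = "\<lambda>c. (restrict c D, restrict c (X - D))"
  let ?h = "\<lambda>(e, c') x. if x \<in> D then e x else c' x"
  let ?S = "SIGMA e:D \<rightarrow>\<^sub>E U. {c \<in> (X - D) \<rightarrow>\<^sub>E U. Q (override_on (override_on \<beta> e D) c (X - D))}"
  have o1: "override_on (override_on \<beta> (restrict c D) D) (restrict c (X - D)) (X - D) = override_on \<beta> c X" for c
    using assms(3) by (auto simp: override_on_def restrict_def fun_eq_iff)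
  have o2: "override_on \<beta> (\<lambda>x. if x \<in> D then e x else c x) X = override_on (override_on \<beta> e D) c (X - D)" for e c
    using assms(3) by (auto simp: override_on_def fun_eq_iff)
  have "bij_betw ?g {c \<in> X \<rightarrow>\<^sub>E U. Q (override_on \<beta> c X)} ?S"
  proof (rule bij_betw_byWitness[where f' = ?h])
    show "\<forall>a\<in>{c \<in> X \<rightarrow>\<^sub>E U. Q (override_on \<beta> c X)}. ?h (?g a) = a"
      using assms(3) by (auto simp: fun_eq_iff restrict_def PiE_def extensional_def)
    show "\<forall>a'\<in>?S. ?g (?h a') = a'"
      by (auto simp: fun_eq_iff restrict_def PiE_def extensional_def)
    show "?g ` {c \<in> X \<rightarrow>\<^sub>E U. Q (override_on \<beta> c X)} \<subseteq> ?S"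
      using assms(3) by (auto simp: o1)
    show "?h ` ?S \<subseteq> {c \<in> X \<rightarrow>\<^sub>E U. Q (override_on \<beta> c X)}"
      using assms(3) by (auto simp: o2 PiE_def extensional_def Pi_def)
  qed
  then have "card {c \<in> X \<rightarrow>\<^sub>E U. Q (override_on \<beta> c X)} = card ?S" by (rule bij_betw_same_card)
  also have "\<dots> = (\<Sum>e \<in> D \<rightarrow>\<^sub>E U. card {c \<in> (X - D) \<rightarrow>\<^sub>E U. Q (override_on (override_on \<beta> e D) c (X - D))})"
  proof (rule card_SigmaI)
    show "finite (D \<rightarrow>\<^sub>E U)" using assms finite_subset by (intro finite_PiE) auto
    show "\<forall>e\<in>D \<rightarrow>\<^sub>E U. finite {c \<in> X - D \<rightarrow>\<^sub>E U. Q (override_on (override_on \<beta> e D) c (X - D))}"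
      using assms finite_PiE[of "X - D" "\<lambda>_. U"] by auto
  qed
  finally show ?thesis .
qed

lemma bij_betw_PiE_compose:
  assumes "bij_betw f N M"
  shows "bij_betw (\<lambda>e. restrict (f \<circ> e) D) (D \<rightarrow>\<^sub>E N) (D \<rightarrow>\<^sub>E M)"
proof (rule bij_betw_byWitness[where f' = "\<lambda>e. restrict (inv_into N f \<circ> e) D"])
  have g: "bij_betw (inv_into N f) M N" using assms by (rule bij_betw_inv_into)
  show "\<forall>a\<in>D \<rightarrow>\<^sub>E N. restrict (inv_into N f \<circ> restrict (f \<circ> a) D) D = a"
  proof
    fix a assume a: "a \<in> D \<rightarrow>\<^sub>E N"
    show "restrict (inv_into N f \<circ> restrict (f \<circ> a) D) D = a"
    proof
      fix x show "restrict (inv_into N f \<circ> restrict (f \<circ> a) D) D x = a x"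
        using bij_betw_inv_into_left[OF assms, of "a x"] PiE_mem[OF a] PiE_arb[OF a] by (cases "x \<in> D") auto
    qed
  qed
  show "\<forall>a\<in>D \<rightarrow>\<^sub>E M. restrict (f \<circ> restrict (inv_into N f \<circ> a) D) D = a"
  proof
    fix a assume a: "a \<in> D \<rightarrow>\<^sub>E M"
    show "restrict (f \<circ> restrict (inv_into N f \<circ> a) D) D = a"
    proof
      fix x show "restrict (f \<circ> restrict (inv_into N f \<circ> a) D) D x = a x"
        using bij_betw_inv_into_right[OF assms, of "a x"] PiE_mem[OF a] PiE_arb[OF a] by (cases "x \<in> D") auto
    qed
  qed
  show "(\<lambda>e. restrict (f \<circ> e) D) ` (D \<rightarrow>\<^sub>E N) \<subseteq> D \<rightarrow>\<^sub>E M"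
    using assms by (fastforce simp: bij_betw_def dest: PiE_mem)
  show "(\<lambda>e. restrict (inv_into N f \<circ> e) D) ` (D \<rightarrow>\<^sub>E M) \<subseteq> D \<rightarrow>\<^sub>E N"
    using g by (fastforce simp: bij_betw_def dest: PiE_mem)
qed

lemma ball_univ:
  assumes "gaifman B \<subseteq> univ B \<times> univ B" "X \<subseteq> univ B"
  shows "ball B s X \<subseteq> univ B"
proof
  fix v assume "v \<in> ball B s X"
  then obtain u m where u: "u \<in> X" "(u, v) \<in> gaifman B ^^ m" by (auto simp: ball_def)
  show "v \<in> univ B"
  proof (cases m)
    case 0
    then show ?thesis using u assms by auto
  next
    case (Suc k)
    then obtain y where "(y, v) \<in> gaifman B" using u(2) by auto
    then show ?thesis using assms(1) by auto
  qed
qed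

lemma same_type_override_right: "same_type B s X (override_on \<beta> c X) \<delta> \<longleftrightarrow> same_type B s X c \<delta>"
  by (rule same_type_cong) simp_all

text \<open>The assignment \<open>\<delta>\<close> represents the type that is counted. The
  induction on \<open>X\<close> has to vary \<open>V\<close>, the two assignments and the radius:
  variables found near \<open>V\<close> are moved into \<open>V\<close>, each at the price of
  \<open>2 * s + 1\<close>, and a radius of at least \<open>s\<close> must remain at the end to
  compare the types themselves.\<close>

lemma count_types:
  assumes fin: "finite (univ B)" and gaif: "gaifman B \<subseteq> univ B \<times> univ B"
    and "finite X" "V \<inter> X = {}" "same_type B R V \<beta> \<gamma>" "card X * (2 * s + 1) + s \<le> R"
    "\<beta> ` V \<subseteq> univ B" "\<gamma> ` V \<subseteq> univ B"
  shows "card {c \<in> X \<rightarrow>\<^sub>E univ B. same_type B s (V \<union> X) (override_on \<beta> c X) \<delta>} =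
    card {c \<in> X \<rightarrow>\<^sub>E univ B. same_type B s (V \<union> X) (override_on \<gamma> c X) \<delta>}"
  using assms(3-)
proof (induction X arbitrary: V \<beta> \<gamma> \<delta> R rule: finite_psubset_induct)
  case (psubset X)
  let ?U = "univ B"
  note VX = psubset.prems(1)
  have sR: "s \<le> R" using psubset.prems(3) by simp
  \<comment> \<open>Stated for every \<open>\<delta>\<close>, because the case in which nothing is
    linked applies it to other types than the given one.\<close>
  have linked_case: "card {c \<in> X \<rightarrow>\<^sub>E ?U. same_type B s (V \<union> X) (override_on \<beta> c X) \<delta>} =
    card {c \<in> X \<rightarrow>\<^sub>E ?U. same_type B s (V \<union> X) (override_on \<gamma> c X) \<delta>}"
    if D: "D \<subseteq> X" "D \<noteq> {}" "linked B s \<delta> V D" for D \<delta>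
  proof -
    define t where "t = card D * (2 * s + 1)"
    let ?N = "\<lambda>\<beta>. ball B t (\<beta> ` V)"
    let ?C = "\<lambda>\<beta> e. card {c \<in> (X - D) \<rightarrow>\<^sub>E ?U. same_type B s (V \<union> X) (override_on (override_on \<beta> e D) c (X - D)) \<delta>}"
    have finD: "finite D" using D(1) psubset.hyps finite_subset by blast
    have cardX: "card X = card D + card (X - D)"
      using card_Diff_subset[OF finD D(1)] card_mono[OF psubset.hyps D(1)] by simp
    then have t: "card (X - D) * (2 * s + 1) + s \<le> R - t" "t \<le> R"
      using psubset.prems(3) by (simp_all add: t_def add_mult_distrib)
    obtain f where f: "partial_iso B f (ball B R (\<beta> ` V)) (ball B R (f ` \<beta> ` V))"
      and f\<gamma>: "\<And>x. x \<in> V \<Longrightarrow> \<gamma> x = f (\<beta> x)" and im: "f ` \<beta> ` V = \<gamma> ` V"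
      by (rule same_typeE[OF psubset.prems(2)]) (rule that, assumption+)
    have "f ` ?N \<beta> = ?N \<gamma>"
      using partial_iso_ball[OF f subset_ball[of _ B 0], of t] t(2) im by simp
    moreover have "inj_on f (ball B R (\<beta> ` V))" using f by (simp add: partial_iso_def bij_betw_def)
    then have "inj_on f (?N \<beta>)" by (rule inj_on_subset[OF _ ball_mono[OF order_refl t(2)]])
    ultimately have bij: "bij_betw f (?N \<beta>) (?N \<gamma>)" by (simp add: bij_betw_def)
    have V': "override_on \<beta> e D ` V = \<beta> ` V" for \<beta> e
      using VX D(1) by (intro image_cong) (auto simp: override_on_def)
    \<comment> \<open>Values of \<open>D\<close> outside radius \<open>t\<close> around
      \<open>V\<close> contribute nothing: an extension of the type of \<open>\<delta>\<close>
      inherits linkedness from it, which forces \<open>D\<close> to be near. So the sum may be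
      restricted to \<open>?N \<beta>\<close>.\<close>
    have split: "card {c \<in> X \<rightarrow>\<^sub>E ?U. same_type B s (V \<union> X) (override_on \<beta> c X) \<delta>} = (\<Sum>e \<in> D \<rightarrow>\<^sub>E ?N \<beta>. ?C \<beta> e)"
      if \<beta>: "\<beta> ` V \<subseteq> ?U" for \<beta>
    proof -
      have "?C \<beta> e = 0" if e: "e \<in> (D \<rightarrow>\<^sub>E ?U) - (D \<rightarrow>\<^sub>E ?N \<beta>)" for e
      proof -
        have "\<not> same_type B s (V \<union> X) (override_on (override_on \<beta> e D) c (X - D)) \<delta>" (is "\<not> same_type B s _ ?\<beta> \<delta>") for c
        proof
          assume "same_type B s (V \<union> X) ?\<beta> \<delta>"
          then have "same_type B s (V \<union> D) ?\<beta> \<delta>" by (rule same_type_mono) (use D(1) in auto)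
          then have "linked B s ?\<beta> V D" using D(3) by (rule linked_invariant)
          then have "?\<beta> ` D \<subseteq> ball B t (?\<beta> ` V)" unfolding t_def by (rule linked_near[OF _ finD])
          moreover have "?\<beta> ` V = \<beta> ` V" using VX D(1) by (intro image_cong) (auto simp: override_on_def)
          moreover have "?\<beta> ` D = e ` D" by (intro image_cong) (auto simp: override_on_def)
          ultimately have "e \<in> D \<rightarrow>\<^sub>E ?N \<beta>" using e by (auto simp: PiE_def)
          then show False using e by blast
        qed
        then show ?thesis by simp
      qed
      moreover have "D \<rightarrow>\<^sub>E ?N \<beta> \<subseteq> D \<rightarrow>\<^sub>E ?U" using ball_univ[OF gaif \<beta>] by (intro PiE_mono) auto
      moreover have "finite (D \<rightarrow>\<^sub>E ?U)" using finD fin by (intro finite_PiE) auto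
      ultimately have "(\<Sum>e \<in> D \<rightarrow>\<^sub>E ?U. ?C \<beta> e) = (\<Sum>e \<in> D \<rightarrow>\<^sub>E ?N \<beta>. ?C \<beta> e)"
        by (intro sum.mono_neutral_right) auto
      then show ?thesis using card_PiE_split[OF psubset.hyps fin D(1), of "\<lambda>\<epsilon>. same_type B s (V \<union> X) \<epsilon> \<delta>"] by simp
    qed
    \<comment> \<open>Transporting the near values by \<open>f\<close> keeps the two sides of equal
      type at radius \<open>R - t\<close>, and \<open>X - D\<close> is strictly smaller, so the
      induction hypothesis counts the remaining values.\<close>
    have "?C \<beta> e = ?C \<gamma> (restrict (f \<circ> e) D)" if e: "e \<in> D \<rightarrow>\<^sub>E ?N \<beta>" for e
    proof -
      let ?\<beta> = "override_on \<beta> e D" and ?\<gamma> = "override_on \<gamma> (restrict (f \<circ> e) D) D"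
      have eD: "e x \<in> ?N \<beta>" if "x \<in> D" for x using e that by auto
      have "?\<beta> ` (V \<union> D) \<subseteq> ball B t (?\<beta> ` V)"
        unfolding V' using eD in_ball[of _ "\<beta> ` V" B t] by (auto simp: override_on_def)
      moreover have "?\<gamma> x = f (?\<beta> x)" if "x \<in> V \<union> D" for x
        using that f\<gamma> by (auto simp: override_on_def)
      ultimately have st: "same_type B (R - t) (V \<union> D) ?\<beta> ?\<gamma>"
        using f by (intro same_type_extend[of B f R ?\<beta> V _ t]) (simp_all add: V' eq_imp_le[OF le_add_diff_inverse[OF t(2)]])
      have "f (e x) \<in> ?N \<gamma>" if "x \<in> D" for x using eD[OF that] bij by (auto simp: bij_betw_def)
      then have fe: "e x \<in> ?U" "f (e x) \<in> ?U" if "x \<in> D" for x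
        using that eD ball_univ[OF gaif psubset.prems(4)] ball_univ[OF gaif psubset.prems(5)] by blast+
      have u: "?\<beta> ` (V \<union> D) \<subseteq> ?U" "?\<gamma> ` (V \<union> D) \<subseteq> ?U"
        using fe psubset.prems(4,5)
        by (auto simp: override_on_def)
      have VD: "V \<union> D \<union> (X - D) = V \<union> X" using D(1) by blast
      show ?thesis
        using psubset.IH[OF _ _ st t(1) u, of \<delta>] D VX unfolding VD by blast
    qed
    then have "(\<Sum>e \<in> D \<rightarrow>\<^sub>E ?N \<beta>. ?C \<beta> e) = (\<Sum>e \<in> D \<rightarrow>\<^sub>E ?N \<beta>. ?C \<gamma> (restrict (f \<circ> e) D))" by simp
    also have "\<dots> = (\<Sum>e \<in> D \<rightarrow>\<^sub>E ?N \<gamma>. ?C \<gamma> e)"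
      by (rule sum.reindex_bij_betw[OF bij_betw_PiE_compose[OF bij]])
    finally show ?thesis using split psubset.prems(4,5) by simp
  qed
  show ?case
  proof (cases "\<exists>D. D \<subseteq> X \<and> D \<noteq> {} \<and> linked B s \<delta> V D")
    case True
    then show ?thesis using linked_case by blast
  next
    case False
    then have sep: "separated B s \<delta> V X" using exists_linked[OF psubset.hyps, of B s \<delta> V] by metis
    show ?thesis
    proof (cases "same_type B s V \<beta> \<delta>")
      \<comment> \<open>Neither \<open>\<beta>\<close> nor \<open>\<gamma>\<close> has the type of
        \<open>\<delta>\<close> on \<open>V\<close>, and both counts are 0.\<close>
      case False
      have cong: "same_type B s V (override_on \<beta> c X) \<delta> \<longleftrightarrow> same_type B s V \<beta> \<delta>" for \<beta> c
        using VX by (intro same_type_cong) (auto simp: override_on_def)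
      have mono: "same_type B s (V \<union> X) \<beta> \<delta> \<Longrightarrow> same_type B s V \<beta> \<delta>" for \<beta>
        by (erule same_type_mono) auto
      have "\<not> same_type B s V \<gamma> \<delta>"
        using False same_type_trans[OF same_type_mono[OF psubset.prems(2) order_refl sR]] by blast
      then have "\<not> same_type B s (V \<union> X) (override_on \<beta> c X) \<delta>" "\<not> same_type B s (V \<union> X) (override_on \<gamma> c X) \<delta>" for c
        using False cong mono by blast+
      then show ?thesis by simp
    next
      case True
      \<comment> \<open>\<open>?S\<close> mentions neither \<open>\<beta>\<close> nor
        \<open>\<gamma>\<close> and is the common minuend; what is subtracted are the values that
        match on \<open>X\<close> but are not separated from \<open>V\<close>.\<close>
      let ?S = "{c \<in> X \<rightarrow>\<^sub>E ?U. same_type B s X c \<delta>}"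
      let ?N = "\<lambda>\<beta>. {c \<in> X \<rightarrow>\<^sub>E ?U. same_type B s X (override_on \<beta> c X) \<delta> \<and> \<not> separated B s (override_on \<beta> c X) V X}"
      have finS: "finite (X \<rightarrow>\<^sub>E ?U)" using psubset.hyps fin by (intro finite_PiE) auto
      have diff: "card {c \<in> X \<rightarrow>\<^sub>E ?U. same_type B s (V \<union> X) (override_on \<beta> c X) \<delta>} = card ?S - card (?N \<beta>)"
        if \<beta>: "same_type B s V \<beta> \<delta>" for \<beta>
      proof -
        have "same_type B s (V \<union> X) (override_on \<beta> c X) \<delta> \<longleftrightarrow>
          same_type B s X (override_on \<beta> c X) \<delta> \<and> separated B s (override_on \<beta> c X) V X" for c
        proof
          assume *: "same_type B s (V \<union> X) (override_on \<beta> c X) \<delta>"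
          show "same_type B s X (override_on \<beta> c X) \<delta> \<and> separated B s (override_on \<beta> c X) V X"
            using same_type_mono[OF *] separated_invariant[OF * sep] by auto
        next
          assume *: "same_type B s X (override_on \<beta> c X) \<delta> \<and> separated B s (override_on \<beta> c X) V X"
          have "same_type B s V (override_on \<beta> c X) \<delta> \<longleftrightarrow> same_type B s V \<beta> \<delta>"
            using VX by (intro same_type_cong) (auto simp: override_on_def)
          with \<beta> have "same_type B s V (override_on \<beta> c X) \<delta>" by simp
          then show "same_type B s (V \<union> X) (override_on \<beta> c X) \<delta>"
            using * sep by (intro same_type_Un) auto
        qed
        then have "{c \<in> X \<rightarrow>\<^sub>E ?U. same_type B s (V \<union> X) (override_on \<beta> c X) \<delta>} = ?S - ?N \<beta>"
          using same_type_override_right by blast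
        moreover have "?N \<beta> \<subseteq> ?S" using same_type_override_right by blast
        ultimately show ?thesis using finS by (simp add: card_Diff_subset)
      qed
      \<comment> \<open>The subtracted values are sorted by their joint type on \<open>V\<close> and
        \<open>X\<close>. Each such type is not separated, hence links some nonempty set to
        \<open>V\<close>, and the linked case counts it equally on both sides.\<close>
      have "card (?N \<beta>) = card (?N \<gamma>)"
      proof (rule card_Collect_classes[where R = "same_type B s (V \<union> X)" and F = "\<lambda>c. override_on \<beta> c X" and
          G = "\<lambda>c. override_on \<gamma> c X" and Q = "\<lambda>\<epsilon>. same_type B s X \<epsilon> \<delta> \<and> \<not> separated B s \<epsilon> V X"])
        fix x y assume *: "same_type B s (V \<union> X) x y" "same_type B s X x \<delta> \<and> \<not> separated B s x V X"
        have "same_type B s X x y" using same_type_mono[OF *(1)] by blast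
        then show "same_type B s X y \<delta> \<and> \<not> separated B s y V X"
          using *(2) same_type_trans[OF same_type_sym] separated_invariant[OF *(1)] by blast
      next
        fix e assume "same_type B s X e \<delta> \<and> \<not> separated B s e V X"
        then obtain D where "D \<subseteq> X" "D \<noteq> {}" "linked B s e V D"
          using exists_linked[OF psubset.hyps, of B s e V] by metis
        then show "card {c \<in> X \<rightarrow>\<^sub>E ?U. same_type B s (V \<union> X) (override_on \<beta> c X) e} =
           card {c \<in> X \<rightarrow>\<^sub>E ?U. same_type B s (V \<union> X) (override_on \<gamma> c X) e}" by (rule linked_case)
      qed (use finS in \<open>auto intro: same_type_refl same_type_sym same_type_trans\<close>)
      moreover have "same_type B s V \<gamma> \<delta>"
        using same_type_trans[OF same_type_sym[OF same_type_mono[OF psubset.prems(2) order_refl sR]] True] .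
      ultimately show ?thesis using diff True by simp
    qed
  qed
qed

text \<open>One level of binding: a property that depends only on types of the smaller radius is
  satisfied by equally many extensions, because each of these types is.\<close>

lemma count_extensions:
  assumes fin: "finite (univ B)" and gaif: "gaifman B \<subseteq> univ B \<times> univ B"
    and X: "finite X" "card X \<le> w" and st: "same_type B ((2 * w + 1) ^ Suc r - 1) V \<beta> \<gamma>"
    and U: "\<beta> ` V \<subseteq> univ B" "\<gamma> ` V \<subseteq> univ B"
    and inv: "\<And>\<beta>' \<gamma>'. \<beta>' ` (V \<union> X) \<subseteq> univ B \<Longrightarrow> \<gamma>' ` (V \<union> X) \<subseteq> univ B \<Longrightarrow>
       same_type B ((2 * w + 1) ^ r - 1) (V \<union> X) \<beta>' \<gamma>' \<Longrightarrow> Q \<beta>' = Q \<gamma>'"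
  shows "card {c \<in> X \<rightarrow>\<^sub>E univ B. Q (override_on \<beta> c X)} = card {c \<in> X \<rightarrow>\<^sub>E univ B. Q (override_on \<gamma> c X)}"
proof -
  define s where "s = (2 * w + 1) ^ r - 1"
  have s: "(2 * w + 1) ^ r = Suc s" by (simp add: s_def)
  have "card X * (2 * s + 1) + s \<le> w * (2 * s + 1) + s" using X(2) by (intro add_mono mult_le_mono) auto
  \<comment> \<open>With K = (2 w + 1)^r and s = K - 1, the left-hand side is (2 w + 1) K - w -
    1.\<close>
  also have "\<dots> \<le> (2 * w + 1) ^ Suc r - 1" unfolding power_Suc s by (simp add: algebra_simps)
  finally have R: "card X * (2 * s + 1) + s \<le> (2 * w + 1) ^ Suc r - 1" .
  \<comment> \<open>Variables may be bound again: the values on the intersection of \<open>V\<close>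
    and \<open>X\<close> are overwritten, and the count is made over \<open>V - X\<close>.\<close>
  have st': "same_type B ((2 * w + 1) ^ Suc r - 1) (V - X) \<beta> \<gamma>" by (rule same_type_mono[OF st]) auto
  have U': "\<beta> ` (V - X) \<subseteq> univ B" "\<gamma> ` (V - X) \<subseteq> univ B" using U by auto
  have VX: "V - X \<union> X = V \<union> X" by blast
  have img: "override_on \<beta> c X ` (V \<union> X) \<subseteq> univ B" if "\<beta> ` V \<subseteq> univ B" "c \<in> X \<rightarrow>\<^sub>E univ B" for \<beta> c
    using that by (auto simp: override_on_def)
  show ?thesis
  proof (rule card_Collect_classes[where R = "same_type B s (V \<union> X)" and F = "\<lambda>c. override_on \<beta> c X" and
          G = "\<lambda>c. override_on \<gamma> c X" and Q = Q])
    show "finite (X \<rightarrow>\<^sub>E univ B)" using X fin by (intro finite_PiE) auto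
    fix x y assume xy: "x \<in> (\<lambda>c. override_on \<beta> c X) ` (X \<rightarrow>\<^sub>E univ B) \<union> (\<lambda>c. override_on \<gamma> c X) ` (X \<rightarrow>\<^sub>E univ B)"
     "y \<in> (\<lambda>c. override_on \<beta> c X) ` (X \<rightarrow>\<^sub>E univ B) \<union> (\<lambda>c. override_on \<gamma> c X) ` (X \<rightarrow>\<^sub>E univ B)"
      "same_type B s (V \<union> X) x y" "Q x"
    have "x ` (V \<union> X) \<subseteq> univ B" "y ` (V \<union> X) \<subseteq> univ B" using xy(1,2) img U by blast+
    from inv[OF this] show "Q y" using xy(3,4) by (simp add: s_def)
  next
    fix e
    show "card {c \<in> X \<rightarrow>\<^sub>E univ B. same_type B s (V \<union> X) (override_on \<beta> c X) e} =
       card {c \<in> X \<rightarrow>\<^sub>E univ B. same_type B s (V \<union> X) (override_on \<gamma> c X) e}"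
      using count_types[OF fin gaif X(1) _ st' R U', of e] unfolding VX by blast
  qed (auto intro: same_type_refl same_type_sym same_type_trans)
qed

section \<open>Tuples of values as assignments\<close>

lemma upds_nth:
  "distinct xs \<Longrightarrow> length as = length xs \<Longrightarrow> i < length xs \<Longrightarrow> upds \<beta> xs as (xs ! i) = as ! i"
  by (simp add: upds_def map_of_zip_nth)

lemma upds_other: "length as = length xs \<Longrightarrow> x \<notin> set xs \<Longrightarrow> upds \<beta> xs as x = \<beta> x"
  by (simp add: upds_def map_of_zip_is_None[THEN iffD2])

lemma map_upds: "distinct xs \<Longrightarrow> length as = length xs \<Longrightarrow> map (upds \<beta> xs as) xs = as"
  by (auto intro!: nth_equalityI simp: upds_nth)

lemma upds_map: "distinct xs \<Longrightarrow> upds \<beta> xs (map c xs) = override_on \<beta> c (set xs)"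
proof
  fix x assume "distinct xs"
  then show "upds \<beta> xs (map c xs) x = override_on \<beta> c (set xs) x"
    by (cases "x \<in> set xs") (auto simp: upds_other in_set_conv_nth upds_nth)
qed

text \<open>Replaces the lists in the semantics of \<open>TCount\<close> by functions on the set of
  counted variables, the form in which subsets of variables can be split off.\<close>

lemma card_tuples_PiE:
  assumes "distinct xs"
  shows "card {as. length as = length xs \<and> set as \<subseteq> U \<and> Q (upds \<beta> xs as)} =
    card {c \<in> set xs \<rightarrow>\<^sub>E U. Q (override_on \<beta> c (set xs))}"
proof -
  have "bij_betw (\<lambda>c. map c xs) {c \<in> set xs \<rightarrow>\<^sub>E U. Q (override_on \<beta> c (set xs))}
     {as. length as = length xs \<and> set as \<subseteq> U \<and> Q (upds \<beta> xs as)}"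
  proof (rule bij_betw_byWitness[where f' = "\<lambda>as. restrict (upds undefined xs as) (set xs)"])
    show "\<forall>c\<in>{c \<in> set xs \<rightarrow>\<^sub>E U. Q (override_on \<beta> c (set xs))}. restrict (upds undefined xs (map c xs)) (set xs) = c"
      using assms by (auto simp: upds_map override_on_def restrict_def PiE_def extensional_def fun_eq_iff)
    show "\<forall>as\<in>{as. length as = length xs \<and> set as \<subseteq> U \<and> Q (upds \<beta> xs as)}.
        map (restrict (upds undefined xs as) (set xs)) xs = as"
    proof
      fix as assume "as \<in> {as. length as = length xs \<and> set as \<subseteq> U \<and> Q (upds \<beta> xs as)}"
      then have "map (upds undefined xs as) xs = as" using assms by (intro map_upds) auto
      then show "map (restrict (upds undefined xs as) (set xs)) xs = as"
        by (metis (no_types, lifting) map_cong restrict_apply')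
    qed
    show "(\<lambda>c. map c xs) ` {c \<in> set xs \<rightarrow>\<^sub>E U. Q (override_on \<beta> c (set xs))}
       \<subseteq> {as. length as = length xs \<and> set as \<subseteq> U \<and> Q (upds \<beta> xs as)}"
      using assms by (auto simp: upds_map)
    show "(\<lambda>as. restrict (upds undefined xs as) (set xs)) ` {as. length as = length xs \<and> set as \<subseteq> U \<and> Q (upds \<beta> xs as)}
       \<subseteq> {c \<in> set xs \<rightarrow>\<^sub>E U. Q (override_on \<beta> c (set xs))}"
    proof
      fix c assume "c \<in> (\<lambda>as. restrict (upds undefined xs as) (set xs)) ` {as. length as = length xs \<and> set as \<subseteq> U \<and> Q (upds \<beta> xs as)}"
      then obtain as where as: "length as = length xs" "set as \<subseteq> U" "Q (upds \<beta> xs as)"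
        and c: "c = restrict (upds undefined xs as) (set xs)" by auto
      have m: "map c xs = as"
        using map_upds[OF assms as(1), of undefined] unfolding c by (metis (no_types, lifting) map_cong restrict_apply')
      then have "c x \<in> U" if "x \<in> set xs" for x using as(2) that by force
      moreover have "Q (override_on \<beta> c (set xs))" using upds_map[OF assms, of \<beta> c] as(3) m by simp
      ultimately show "c \<in> {c \<in> set xs \<rightarrow>\<^sub>E U. Q (override_on \<beta> c (set xs))}" by (auto simp: c)
    qed
  qed
  from bij_betw_same_card[OF this] show ?thesis by simp
qed

text \<open>The set \<open>V\<close> may contain more than the free variables, so that it can grow
  uniformly at every binder. The number variables have the same values on both sides, and the
  predicates see only the values of terms, so equality of all counts suffices. The width must be at
  least 1 once a quantifier occurs, since a quantifier is handled as a count over one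
  variable.\<close>

lemma locality:
  fixes \<phi> :: "'p fm" and t :: "'p tm"
  assumes fin: "finite (univ B)" and gaif: "gaifman B \<subseteq> univ B \<times> univ B"
  shows "wf_fm \<sigma> P \<phi> \<Longrightarrow> svars \<phi> \<subseteq> V \<Longrightarrow> br \<phi> \<le> r \<Longrightarrow> \<forall>n\<in>count_widths \<phi>. n \<le> w \<Longrightarrow> (has_quant \<phi> \<Longrightarrow> 1 \<le> w) \<Longrightarrow>
      \<beta> ` V \<subseteq> univ B \<Longrightarrow> \<gamma> ` V \<subseteq> univ B \<Longrightarrow> same_type B ((2 * w + 1) ^ r - 1) V \<beta> \<gamma> \<Longrightarrow>
      sat P B \<beta> \<nu> \<phi> = sat P B \<gamma> \<nu> \<phi>"
    and "wf_tm \<sigma> P t \<Longrightarrow> svars_tm t \<subseteq> V \<Longrightarrow> br_tm t \<le> r \<Longrightarrow> \<forall>n\<in>count_widths_tm t. n \<le> w \<Longrightarrow> (has_quant_tm t \<Longrightarrow> 1 \<le> w) \<Longrightarrow>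
      \<beta> ` V \<subseteq> univ B \<Longrightarrow> \<gamma> ` V \<subseteq> univ B \<Longrightarrow> same_type B ((2 * w + 1) ^ r - 1) V \<beta> \<gamma> \<Longrightarrow>
      tval P B \<beta> \<nu> t = tval P B \<gamma> \<nu> t"
proof (induction \<phi> and t arbitrary: V r \<beta> \<gamma> \<nu> and V r \<beta> \<gamma> \<nu>)
  case (FEq x y)
  let ?s = "(2 * w + 1) ^ r - 1"
  obtain f where f: "partial_iso B f (ball B ?s (\<beta> ` V)) (ball B ?s (f ` \<beta> ` V))"
    and f\<gamma>: "\<And>x. x \<in> V \<Longrightarrow> \<gamma> x = f (\<beta> x)" and "f ` \<beta> ` V = \<gamma> ` V"
    by (rule same_typeE[OF FEq.prems(8)]) (rule that, assumption+)
  have xy: "x \<in> V" "y \<in> V" using FEq.prems by auto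
  then have "\<beta> x \<in> ball B ?s (\<beta> ` V)" "\<beta> y \<in> ball B ?s (\<beta> ` V)" by (auto intro!: in_ball)
  moreover have "inj_on f (ball B ?s (\<beta> ` V))" using f by (simp add: partial_iso_def bij_betw_def)
  ultimately show ?case using f\<gamma>[OF xy(1)] f\<gamma>[OF xy(2)] by (auto dest: inj_onD)
next
  case (FRel i xs)
  let ?s = "(2 * w + 1) ^ r - 1"
  obtain f where f: "partial_iso B f (ball B ?s (\<beta> ` V)) (ball B ?s (f ` \<beta> ` V))"
    and f\<gamma>: "\<And>x. x \<in> V \<Longrightarrow> \<gamma> x = f (\<beta> x)" and "f ` \<beta> ` V = \<gamma> ` V"
    by (rule same_typeE[OF FRel.prems(8)]) (rule that, assumption+)
  have xs: "set xs \<subseteq> V" using FRel.prems by simp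
  then have "set (map \<beta> xs) \<subseteq> ball B ?s (\<beta> ` V)" using in_ball[of _ "\<beta> ` V" B ?s] by auto
  then have "map \<beta> xs \<in> interp B i \<longleftrightarrow> map f (map \<beta> xs) \<in> interp B i" using f unfolding partial_iso_def by blast
  moreover have "map f (map \<beta> xs) = map \<gamma> xs" using xs f\<gamma> by auto
  ultimately show ?case by (simp only: sat.simps)
next
  case (FNeg \<phi>)
  have "sat P B \<beta> \<nu> \<phi> = sat P B \<gamma> \<nu> \<phi>" by (rule FNeg.IH[of V r]) (use FNeg.prems in simp_all)
  then show ?case by simp
next
  case (FOr \<phi> \<psi>)
  have "sat P B \<beta> \<nu> \<phi> = sat P B \<gamma> \<nu> \<phi>" by (rule FOr.IH(1)[of V r]) (use FOr.prems in simp_all)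
  moreover have "sat P B \<beta> \<nu> \<psi> = sat P B \<gamma> \<nu> \<psi>" by (rule FOr.IH(2)[of V r]) (use FOr.prems in simp_all)
  ultimately show ?case by simp
next
  case (FEx x \<phi>)
  then obtain r' where r: "r = Suc r'" by (cases r) auto
  \<comment> \<open>Existence is rephrased as a nonzero count, so that the counting lemma applies
    with the single variable \<open>x\<close>.\<close>
  have ex: "sat P B \<beta> \<nu> (FEx x \<phi>) \<longleftrightarrow> card {c \<in> {x} \<rightarrow>\<^sub>E univ B. sat P B (override_on \<beta> c {x}) \<nu> \<phi>} \<noteq> 0" for \<beta>
  proof -
    have o: "override_on \<beta> c {x} = \<beta>(x := c x)" for c by (auto simp: override_on_def)
    have "(\<exists>a\<in>univ B. sat P B (\<beta>(x := a)) \<nu> \<phi>) \<longleftrightarrow> (\<exists>c\<in>{x} \<rightarrow>\<^sub>E univ B. sat P B (\<beta>(x := c x)) \<nu> \<phi>)"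
    proof
      assume "\<exists>a\<in>univ B. sat P B (\<beta>(x := a)) \<nu> \<phi>"
      then obtain a where "a \<in> univ B" "sat P B (\<beta>(x := a)) \<nu> \<phi>" by blast
      then show "\<exists>c\<in>{x} \<rightarrow>\<^sub>E univ B. sat P B (\<beta>(x := c x)) \<nu> \<phi>"
        by (intro bexI[of _ "restrict (\<lambda>_. a) {x}"]) auto
    next
      assume "\<exists>c\<in>{x} \<rightarrow>\<^sub>E univ B. sat P B (\<beta>(x := c x)) \<nu> \<phi>"
      then show "\<exists>a\<in>univ B. sat P B (\<beta>(x := a)) \<nu> \<phi>" by (meson PiE_mem singletonI)
    qed
    moreover have "finite ({x} \<rightarrow>\<^sub>E univ B)" using fin by (intro finite_PiE) auto
    ultimately show ?thesis by (auto simp: o)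
  qed
  have "card {c \<in> {x} \<rightarrow>\<^sub>E univ B. sat P B (override_on \<beta> c {x}) \<nu> \<phi>} =
     card {c \<in> {x} \<rightarrow>\<^sub>E univ B. sat P B (override_on \<gamma> c {x}) \<nu> \<phi>}"
  proof (rule count_extensions[OF fin gaif, where w = w and r = r' and V = V])
    fix \<beta>' \<gamma>' assume "\<beta>' ` (V \<union> {x}) \<subseteq> univ B" "\<gamma>' ` (V \<union> {x}) \<subseteq> univ B"
       "same_type B ((2 * w + 1) ^ r' - 1) (V \<union> {x}) \<beta>' \<gamma>'"
    then show "sat P B \<beta>' \<nu> \<phi> = sat P B \<gamma>' \<nu> \<phi>"
      by (intro FEx.IH[of "V \<union> {x}" r']) (use FEx.prems r in auto)
  qed (use FEx.prems r in auto)
  then show ?case unfolding ex by simp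
next
  case (FPred p ts)
  have "tval P B \<beta> \<nu> t = tval P B \<gamma> \<nu> t" if t: "t \<in> set ts" for t
  proof (rule FPred.IH[OF t, of V r])
    show "br_tm t \<le> r" using FPred.prems(3) t by simp
  qed (use FPred.prems t in auto)
  then have "map (tval P B \<beta> \<nu>) ts = map (tval P B \<gamma> \<nu>) ts" by simp
  then show ?case by (simp only: sat.simps)
next
  case (FNumEx \<kappa> \<phi>)
  have "sat P B \<beta> \<nu>' \<phi> = sat P B \<gamma> \<nu>' \<phi>" for \<nu>' by (rule FNumEx.IH[of V r]) (use FNumEx.prems in simp_all)
  then show ?case by simp
next
  case (TCount xs \<phi>)
  then obtain r' where r: "r = Suc r'" by (cases r) auto
  have d: "distinct xs" and len: "length xs \<le> w" and ne: "xs \<noteq> []" using TCount.prems by auto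
  then have w: "1 \<le> w" by (cases xs) auto
  have "card {c \<in> set xs \<rightarrow>\<^sub>E univ B. sat P B (override_on \<beta> c (set xs)) \<nu> \<phi>} =
     card {c \<in> set xs \<rightarrow>\<^sub>E univ B. sat P B (override_on \<gamma> c (set xs)) \<nu> \<phi>}"
  proof (rule count_extensions[OF fin gaif, where w = w and r = r' and V = V])
    fix \<beta>' \<gamma>' assume "\<beta>' ` (V \<union> set xs) \<subseteq> univ B" "\<gamma>' ` (V \<union> set xs) \<subseteq> univ B"
       "same_type B ((2 * w + 1) ^ r' - 1) (V \<union> set xs) \<beta>' \<gamma>'"
    then show "sat P B \<beta>' \<nu> \<phi> = sat P B \<gamma>' \<nu> \<phi>"
      by (intro TCount.IH[of "V \<union> set xs" r']) (use TCount.prems r w in auto)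
  qed (use TCount.prems r len in \<open>auto intro: order_trans[OF card_length]\<close>)
  then show ?case
    using card_tuples_PiE[OF d, where Q = "\<lambda>\<epsilon>. sat P B \<epsilon> \<nu> \<phi>"] by simp
next
  case (TPlus s t)
  have "tval P B \<beta> \<nu> s = tval P B \<gamma> \<nu> s" by (rule TPlus.IH(1)[of V r]) (use TPlus.prems in simp_all)
  moreover have "tval P B \<beta> \<nu> t = tval P B \<gamma> \<nu> t" by (rule TPlus.IH(2)[of V r]) (use TPlus.prems in simp_all)
  ultimately show ?case by simp
next
  case (TTimes s t)
  have "tval P B \<beta> \<nu> s = tval P B \<gamma> \<nu> s" by (rule TTimes.IH(1)[of V r]) (use TTimes.prems in simp_all)
  moreover have "tval P B \<beta> \<nu> t = tval P B \<gamma> \<nu> t" by (rule TTimes.IH(2)[of V r]) (use TTimes.prems in simp_all)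
  ultimately show ?case by simp
qed simp_all

section \<open>Isomorphic spheres, and the replacement of far parameters\<close>

lemma nbhd_eq_ball:
  assumes "gaifman B \<subseteq> univ B \<times> univ B" "set us \<subseteq> univ B"
  shows "nbhd B s us = ball B s (set us)"
  using ball_univ[OF assms, of s] unfolding nbhd_def ball_def by blast

lemma isomorphic_imp_same_type:
  assumes gaif: "gaifman B \<subseteq> univ B \<times> univ B"
    and us: "set us \<subseteq> univ B" "length us = length zs" and us': "set us' \<subseteq> univ B" "length us' = length zs"
    and zs: "distinct zs" and iso: "isomorphic (sphere B s us) (sphere B s us')"
  shows "same_type B s (set zs) (upds \<beta> zs us) (upds \<gamma> zs us')"
proof -
  obtain f where f: "bij_betw f (ball B s (set us)) (ball B s (set us'))"
    and rel: "\<And>i ts. set ts \<subseteq> ball B s (set us) \<Longrightarrow>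
      ts \<in> interp B i \<longleftrightarrow> map f ts \<in> interp B i \<and> f ` set ts \<subseteq> ball B s (set us')"
    and c: "map f us = us'"
    using iso nbhd_eq_ball[OF gaif us(1), of s] nbhd_eq_ball[OF gaif us'(1), of s]
    unfolding isomorphic_def by (auto simp: sphere_def induced_def)
  have "partial_iso B f (ball B s (set us)) (ball B s (set us'))"
    unfolding partial_iso_def
  proof (intro conjI allI impI)
    fix i ts assume ts: "set ts \<subseteq> ball B s (set us)"
    then have "f ` set ts \<subseteq> ball B s (set us')" using f by (auto simp: bij_betw_def)
    then show "ts \<in> interp B i \<longleftrightarrow> map f ts \<in> interp B i" using rel[OF ts] by blast
  qed (rule f)
  moreover have "upds \<beta> zs us ` set zs = set us" "upds \<gamma> zs us' ` set zs = set us'"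
    using map_upds[OF zs us(2), of \<beta>] map_upds[OF zs us'(2), of \<gamma>] by (metis set_map)+
  moreover have "f (upds \<beta> zs us x) = upds \<gamma> zs us' x" if "x \<in> set zs" for x
    using that zs us us' c by (auto simp: in_set_conv_nth upds_nth)
  ultimately show ?thesis unfolding same_type_def by auto
qed

lemma upds_append:
  "length us = length xs \<Longrightarrow> upds \<beta> (xs @ ys) (us @ vs) = upds (upds \<beta> ys vs) xs us"
  by (auto simp: upds_def fun_eq_iff map_add_def dest: map_of_SomeD set_zip_leftD split: option.splits)

lemma upds_in:
  "length us = length xs \<Longrightarrow> x \<in> set xs \<Longrightarrow> upds \<beta> xs us x = upds \<beta>' xs us x"
  using map_of_zip_is_None[of xs us x] by (auto simp: upds_def split: option.splits)

text \<open>Only one direction is required: examples confused by the new parameters were already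
  confused by the old ones, so the new ones distinguish at least as much. The parameters are shared
  by all examples, hence the far ones have the same type in each of them by the identity, and being
  separated they can be glued back to the rest.\<close>

lemma replace_far_parameters:
  fixes xs ys :: "nat list"
  assumes gaif: "gaifman B \<subseteq> univ B \<times> univ B"
    and dist: "distinct (xs @ ys)"
    and Us: "\<And>us. us \<in> Us \<Longrightarrow> length us = length xs"
    and vs: "length vs = length ys" "set vs \<subseteq> univ B" and a: "a \<in> univ B"
  obtains vs' where "length vs' = length ys" "set vs' \<subseteq> univ B"
    "set vs' \<subseteq> insert a (ball B (length ys * (2 * s + 1)) (\<Union>us\<in>Us. set us))"
    "\<And>us us'. us \<in> Us \<Longrightarrow> us' \<in> Us \<Longrightarrow>
       same_type B s (set (xs @ ys)) (upds \<beta> (xs @ ys) (us @ vs')) (upds \<beta> (xs @ ys) (us' @ vs')) \<Longrightarrow>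
       same_type B s (set (xs @ ys)) (upds \<beta> (xs @ ys) (us @ vs)) (upds \<beta> (xs @ ys) (us' @ vs))"
proof -
  define \<rho> where "\<rho> = upds \<beta> ys vs"
  let ?E = "\<Union>us\<in>Us. set us"
  \<comment> \<open>The entries of all examples together are the starting set, as a parameter far
    from one example may be near another and the same \<open>D\<close> must serve for all of
    them.\<close>
  obtain D where D: "D \<subseteq> set ys" "\<rho> ` D \<subseteq> ball B (card D * (2 * s + 1)) ?E"
    "\<And>x. x \<in> set ys - D \<Longrightarrow> \<rho> x \<notin> ball B (2 * s + 1) (?E \<union> \<rho> ` D)"
    by (rule near_closure[OF finite_set]) (rule that, assumption+)
  define vs' where "vs' = map (\<lambda>y. if y \<in> D then \<rho> y else a) ys"
  have disj: "distinct xs" "distinct ys" "set xs \<inter> set ys = {}" using dist by auto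
  have \<rho>: "set vs = \<rho> ` set ys" using map_upds[OF disj(2) vs(1), of \<beta>] unfolding \<rho>_def by (metis set_map)
  have cardD: "card D \<le> length ys" using D(1) card_length[of ys] card_mono[OF finite_set D(1)] by linarith
  show ?thesis
  proof (rule that)
    show "length vs' = length ys" by (simp add: vs'_def)
    show "set vs' \<subseteq> univ B" using \<rho> vs(2) a by (auto simp: vs'_def)
    have "ball B (card D * (2 * s + 1)) ?E \<subseteq> ball B (length ys * (2 * s + 1)) ?E"
      using cardD by (intro ball_mono mult_le_mono) auto
    then show "set vs' \<subseteq> insert a (ball B (length ys * (2 * s + 1)) ?E)"
      using D(2) by (auto simp: vs'_def)
  next
    fix us us' assume us: "us \<in> Us" "us' \<in> Us"
    let ?b = "\<lambda>us vs. upds \<beta> (xs @ ys) (us @ vs)"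
    assume st: "same_type B s (set (xs @ ys)) (?b us vs') (?b us' vs')"
    have bx: "?b us vs x = ?b us vs' x" if "us \<in> Us" "x \<in> set xs" for us x
      using that Us by (simp add: upds_append upds_in)
    have by1: "?b us vs y = \<rho> y" if "us \<in> Us" "y \<in> set ys" for us y
    proof -
      have "y \<notin> set xs" using that(2) disj(3) by blast
      then show ?thesis using that(1) by (simp add: upds_append upds_other Us \<rho>_def)
    qed
    have by2: "?b us vs' y = (if y \<in> D then \<rho> y else a)" if "us \<in> Us" "y \<in> set ys" for us y
    proof -
      have "y \<notin> set xs" using that(2) disj(3) by blast
      then have "?b us vs' y = upds \<beta> ys vs' y"
        using that(1) by (simp add: upds_append upds_other Us)
      then show ?thesis unfolding vs'_def using that(2) by (simp add: upds_map[OF disj(2)])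
    qed
    have "same_type B s (set xs \<union> D) (?b us vs') (?b us' vs')"
      by (rule same_type_mono[OF st]) (use D(1) in auto)
    moreover have "?b us vs' x = ?b us vs x" if "us \<in> Us" "x \<in> set xs \<union> D" for us x
      using that bx[of us x] by1[of us x] by2[of us x] D(1) by auto
    ultimately have near: "same_type B s (set xs \<union> D) (?b us vs) (?b us' vs)"
      using us same_type_cong[of "set xs \<union> D" "?b us vs'" "?b us vs" "?b us' vs'" "?b us' vs" B s] by blast
    \<comment> \<open>On the far parameters both assignments coincide with
      \<open>\<rho>\<close>.\<close>
    have far: "same_type B s (set ys - D) (?b us vs) (?b us' vs)"
      using same_type_cong[of "set ys - D" "?b us vs" \<rho> "?b us' vs" \<rho> B s] by1 us same_type_refl by blast
    have sep: "separated B s (?b us vs) (set xs \<union> D) (set ys - D)" if "us \<in> Us" for us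
    proof (rule ccontr)
      assume "\<not> separated B s (?b us vs) (set xs \<union> D) (set ys - D)"
      from not_separated_near[OF this] obtain y where y: "y \<in> set ys - D"
        "?b us vs y \<in> ball B (2 * s + 1) (?b us vs ` (set xs \<union> D))" by blast
      have "?b us vs x \<in> set us" if "x \<in> set xs" for x
      proof -
        have "?b us vs x = upds \<beta> xs us x" using \<open>us \<in> Us\<close> Us that by (simp add: upds_append upds_in)
        then show ?thesis using map_upds[OF disj(1) Us[OF \<open>us \<in> Us\<close>], of \<beta>] that by (metis imageI set_map)
      qed
      then have "?b us vs ` (set xs \<union> D) \<subseteq> ?E \<union> \<rho> ` D" using that D(1) by1[OF that] by auto
      then have "?b us vs y \<in> ball B (2 * s + 1) (?E \<union> \<rho> ` D)"
        using y(2) ball_mono[OF _ order_refl] by blast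
      then show False using D(3)[OF y(1)] by1[OF that, of y] y(1) by simp
    qed
    have "set (xs @ ys) = (set xs \<union> D) \<union> (set ys - D)" using D(1) by auto
    then show "same_type B s (set (xs @ ys)) (?b us vs) (?b us' vs)"
      using same_type_Un[OF near far sep[OF us(1)] sep[OF us(2)]] by simp
  qed
qed

section \<open>Finitely many hypotheses\<close>

lemma (in small_degree) gaifman_subset: "is_struct \<sigma> B \<Longrightarrow> gaifman B \<subseteq> univ B \<times> univ B"
  by (auto dest: gaifman_univ)

lemma isomorphic_refl: "isomorphic \<A> \<A>"
  unfolding isomorphic_def by (rule exI[of _ id]) simp

lemma isomorphic_trans:
  assumes "isomorphic \<A> \<B>" "isomorphic \<B> \<C>"
  shows "isomorphic \<A> \<C>"
proof -
  obtain f where f: "bij_betw f (univ (fst \<A>)) (univ (fst \<B>))" "map f (snd \<A>) = snd \<B>"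
    "\<And>i us. set us \<subseteq> univ (fst \<A>) \<Longrightarrow> us \<in> interp (fst \<A>) i \<longleftrightarrow> map f us \<in> interp (fst \<B>) i"
    using assms(1) unfolding isomorphic_def by blast
  obtain g where g: "bij_betw g (univ (fst \<B>)) (univ (fst \<C>))" "map g (snd \<B>) = snd \<C>"
    "\<And>i us. set us \<subseteq> univ (fst \<B>) \<Longrightarrow> us \<in> interp (fst \<B>) i \<longleftrightarrow> map g us \<in> interp (fst \<C>) i"
    using assms(2) unfolding isomorphic_def by blast
  have "us \<in> interp (fst \<A>) i \<longleftrightarrow> map (g \<circ> f) us \<in> interp (fst \<C>) i" if us: "set us \<subseteq> univ (fst \<A>)" for i us
  proof -
    have "set (map f us) \<subseteq> univ (fst \<B>)" using us f(1) by (auto simp: bij_betw_def)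
    from g(3)[OF this] show ?thesis using f(3)[OF us] by simp
  qed
  moreover have "map (g \<circ> f) (snd \<A>) = snd \<C>" using f(2) g(2) by (metis map_map)
  ultimately show ?thesis
    unfolding isomorphic_def using bij_betw_trans[OF f(1) g(1)] by blast
qed

section \<open>Finitely many types in bounded degree\<close>

context small_degree
begin

definition degree_at_most :: "nat struct \<Rightarrow> bool" where
  "degree_at_most B \<longleftrightarrow> (\<forall>u\<in>univ B. card (gaifman_nbrs B u) \<le> d)"

lemma finite_nbhd: "is_struct \<sigma> B \<Longrightarrow> finite (nbhd B s us)"
  unfolding nbhd_def is_struct_def by auto

text \<open>The recursion is b(s + 1) = 1 + d b(s). What matters is that the bound does not depend
  on the structure.\<close>

lemma card_nbhd_single:
  "\<exists>b. \<forall>B u. is_struct \<sigma> B \<longrightarrow> degree_at_most B \<longrightarrow> u \<in> univ B \<longrightarrow> card (nbhd B s [u]) \<le> b"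
proof (induction s)
  case 0
  show ?case by (rule exI[of _ 1]) (simp add: nbhd_0)
next
  case (Suc s)
  then obtain b where b: "\<And>B u. is_struct \<sigma> B \<Longrightarrow> degree_at_most B \<Longrightarrow> u \<in> univ B \<Longrightarrow> card (nbhd B s [u]) \<le> b" by blast
  have "card (nbhd B (Suc s) [u]) \<le> Suc (d * b)"
    if B: "is_struct \<sigma> B" "degree_at_most B" "u \<in> univ B" for B u
  proof -
    have sub: "gaifman_nbrs B u \<subseteq> univ B" using gaifman_univ[OF B(1)] by (auto simp: gaifman_nbrs_def)
    then have fin: "finite (gaifman_nbrs B u)" using B(1) finite_subset unfolding is_struct_def by blast
    have eq: "nbhd B (Suc s) [u] = insert u (\<Union>y\<in>gaifman_nbrs B u. nbhd B s [y])" (is "_ = insert u ?U")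
      using nbhd_Suc[OF B(3), of _ s] by blast
    have "card (insert u ?U) \<le> Suc (card ?U)" by (rule card_insert_le_m1) auto
    moreover have "card ?U \<le> (\<Sum>y\<in>gaifman_nbrs B u. card (nbhd B s [y]))" by (rule card_UN_le[OF fin])
    moreover have "\<dots> \<le> card (gaifman_nbrs B u) * b"
      using sum_bounded_above[of "gaifman_nbrs B u" "\<lambda>y. card (nbhd B s [y])" b] b[OF B(1,2)] sub by auto
    moreover have "\<dots> \<le> d * b" using B by (intro mult_le_mono1) (simp add: degree_at_most_def)
    ultimately show ?thesis unfolding eq by linarith
  qed
  then show ?case by blast
qed

lemma card_nbhd_bounded:
  "\<exists>M. \<forall>B us. is_struct \<sigma> B \<longrightarrow> degree_at_most B \<longrightarrow> us \<in> tuples B m \<longrightarrow> card (nbhd B s us) \<le> M"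
proof -
  obtain b where b: "\<And>B u. is_struct \<sigma> B \<Longrightarrow> degree_at_most B \<Longrightarrow> u \<in> univ B \<Longrightarrow> card (nbhd B s [u]) \<le> b"
    using card_nbhd_single[of s] by (elim exE) (simp, metis)
  have "card (nbhd B s us) \<le> m * b" if B: "is_struct \<sigma> B" "degree_at_most B" "us \<in> tuples B m" for B us
  proof -
    have eq: "nbhd B s us = (\<Union>u\<in>set us. nbhd B s [u])" by (auto simp: nbhd_def)
    have "card (nbhd B s us) \<le> (\<Sum>u\<in>set us. card (nbhd B s [u]))"
      unfolding eq by (rule card_UN_le[OF finite_set])
    also have "\<dots> \<le> card (set us) * b"
      using sum_bounded_above[of "set us" "\<lambda>u. card (nbhd B s [u])" b] b[OF B(1,2)] B(3) by (auto simp: tuples_iff)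
    also have "\<dots> \<le> m * b" using B(3) card_length[of us] by (intro mult_le_mono1) (simp add: tuples_iff)
    finally show ?thesis .
  qed
  then show ?thesis by blast
qed

text \<open>A structure is determined by its universe and the relations of the finitely many
  symbols; all other relations are empty. \<open>sum_list \<sigma>\<close> is a common bound on the
  arities.\<close>

lemma finite_pointed_structs:
  "finite {(A :: nat struct, cs). is_struct \<sigma> A \<and> univ A \<subseteq> {..<M} \<and> set cs \<subseteq> univ A \<and> length cs = m}"
  (is "finite ?S")
proof -
  let ?K = "sum_list \<sigma>"
  let ?T = "{ts. set ts \<subseteq> {..<M} \<and> length ts \<le> ?K}"
  let ?g = "\<lambda>(A :: nat struct, cs :: nat list). (univ A, map (interp A) [0..<length \<sigma>], cs)"
  have fT: "finite ?T" by (rule finite_lists_length_le) simp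
  have "inj_on ?g ?S"
  proof (rule inj_onI)
    fix x y assume x: "x \<in> ?S" and y: "y \<in> ?S" and e: "?g x = ?g y"
    obtain A cs where xx: "x = (A, cs)" by (cases x)
    obtain A' cs' where yy: "y = (A', cs')" by (cases y)
    have "interp A i = interp A' i" for i
    proof (cases "i < length \<sigma>")
      case True
      then show ?thesis using e unfolding xx yy by auto
    next
      case False
      have "is_struct \<sigma> A" "is_struct \<sigma> A'" using x y unfolding xx yy by simp_all
      then have "interp A i = {}" "interp A' i = {}" using False unfolding is_struct_def by (meson leI)+
      then show ?thesis by simp
    qed
    then have "interp A = interp A'" by (rule ext)
    then have "A = A'" using e unfolding xx yy by (intro struct.equality) auto
    then show "x = y" using e unfolding xx yy by simp
  qed
  moreover have "?g ` ?S \<subseteq> Pow {..<M} \<times> {xs. set xs \<subseteq> Pow ?T \<and> length xs = length \<sigma>} \<times>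
      {cs. set cs \<subseteq> {..<M} \<and> length cs = m}"
  proof
    fix z assume "z \<in> ?g ` ?S"
    then obtain A cs where z: "z = ?g (A, cs)" "(A, cs) \<in> ?S" by blast
    have "interp A i \<subseteq> ?T" if "i < length \<sigma>" for i
    proof
      fix ts assume "ts \<in> interp A i"
      moreover have "is_struct \<sigma> A" and M: "univ A \<subseteq> {..<M}" using z(2) by auto
      ultimately have "length ts = \<sigma> ! i" "set ts \<subseteq> univ A" using that unfolding is_struct_def by blast+
      then have "length ts = \<sigma> ! i" "set ts \<subseteq> {..<M}" using M by auto
      moreover have "\<sigma> ! i \<le> ?K" using that by (intro member_le_sum_list) auto
      ultimately show "ts \<in> ?T" by simp
    qed
    then have "set (map (interp A) [0..<length \<sigma>]) \<subseteq> Pow ?T" by (simp add: image_subset_iff)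
    moreover have "univ A \<subseteq> {..<M}" "set cs \<subseteq> {..<M}" "length cs = m" using z(2) by auto
    ultimately show "z \<in> Pow {..<M} \<times> {xs. set xs \<subseteq> Pow ?T \<and> length xs = length \<sigma>} \<times> {cs. set cs \<subseteq> {..<M} \<and> length cs = m}"
      unfolding z(1) by simp
  qed
  moreover have "finite (Pow {..<M} \<times> {xs. set xs \<subseteq> Pow ?T \<and> length xs = length \<sigma>} \<times>
      {cs. set cs \<subseteq> {..<M} \<and> length cs = m})"
    using fT by (intro finite_cartesian_product finite_lists_length_eq) auto
  ultimately show ?thesis by (rule inj_on_finite)
qed

text \<open>Spheres are renamed to initial segments of the natural numbers, so that bounded size
  leaves finitely many. A nonempty tuple is required because the sphere of the empty tuple has empty
  universe and is no structure.\<close>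

lemma relabel_sphere:
  assumes B: "is_struct \<sigma> B" and us: "us \<in> tuples B m" "0 < m"
  obtains A cs where "is_type \<sigma> s (A, cs)" "isomorphic (sphere B s us) (A, cs)"
    "univ A = {..<card (nbhd B s us)}" "length cs = m"
proof -
  let ?X = "nbhd B s us"
  have X: "?X = ball B s (set us)" using us(1) nbhd_eq_ball[OF gaifman_subset[OF B]] by (simp add: tuples_iff)
  obtain g where "bij_betw g ?X {0..<card ?X}" using ex_bij_betw_finite_nat[OF finite_nbhd[OF B]] by blast
  then have g: "bij_betw g ?X {..<card ?X}" by (simp add: atLeast0LessThan)
  have inj: "inj_on g ?X" and im: "g ` ?X = {..<card ?X}" using g by (auto simp: bij_betw_def)
  define A where "A = \<lparr>univ = {..<card ?X}, interp = (\<lambda>i. map g ` {ts \<in> interp B i. set ts \<subseteq> ?X})\<rparr>"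
  have usX: "set us \<subseteq> ?X" unfolding X by (rule subset_ball)
  have "set us \<noteq> {}" using us by (force simp: tuples_iff)
  then have "?X \<noteq> {}" using usX subset_empty by metis
  then have "card ?X \<noteq> 0" using finite_nbhd[OF B, of s us] by (simp add: card_eq_0_iff)
  have "length ts = \<sigma> ! i \<and> set ts \<subseteq> univ A" if i: "i < length \<sigma>" and ts: "ts \<in> interp A i" for i ts
  proof -
    obtain ts' where ts': "ts' \<in> interp B i" "set ts' \<subseteq> ?X" "ts = map g ts'" using ts by (auto simp: A_def)
    then have "length ts = \<sigma> ! i" using B i unfolding is_struct_def by simp
    moreover have "set ts \<subseteq> univ A" using ts'(2,3) im by (auto simp: A_def)
    ultimately show ?thesis by simp
  qed
  moreover have "interp A i = {}" if "length \<sigma> \<le> i" for i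
  proof -
    have "interp B i = {}" using B that unfolding is_struct_def by simp
    then show ?thesis by (simp add: A_def)
  qed
  moreover have "finite (univ A)" "univ A \<noteq> {}" using \<open>card ?X \<noteq> 0\<close> by (simp_all add: A_def lessThan_empty_iff)
  ultimately have A: "is_struct \<sigma> A" unfolding is_struct_def by blast
  have iso: "isomorphic (sphere B s us) (A, map g us)"
    unfolding isomorphic_def
  proof (intro exI[of _ g] conjI allI impI)
    fix i ts assume "set ts \<subseteq> univ (fst (sphere B s us))"
    then have ts: "set ts \<subseteq> ?X" by (simp add: sphere_def induced_def)
    have "map g ts \<in> map g ` {ts \<in> interp B i. set ts \<subseteq> ?X} \<longleftrightarrow> ts \<in> {ts \<in> interp B i. set ts \<subseteq> ?X}"
    proof
      assume "map g ts \<in> map g ` {ts \<in> interp B i. set ts \<subseteq> ?X}"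
      then obtain ts' where ts': "ts' \<in> interp B i" "set ts' \<subseteq> ?X" "map g ts = map g ts'" by auto
      have "ts = ts'"
        by (rule map_inj_on[OF ts'(3)]) (use inj ts ts'(2) in \<open>auto intro: inj_on_subset\<close>)
      then show "ts \<in> {ts \<in> interp B i. set ts \<subseteq> ?X}" using ts' by simp
    qed blast
    then show "ts \<in> interp (fst (sphere B s us)) i \<longleftrightarrow> map g ts \<in> interp (fst (A, map g us)) i"
      using ts by (simp add: sphere_def induced_def A_def)
  qed (use g in \<open>simp_all add: sphere_def induced_def A_def\<close>)
  \<comment> \<open>In a type, every element must be reached from a centre inside the type itself. A
    walk of length at most \<open>s\<close> crosses its edges from radius less than
    \<open>s\<close>, so the witnessing tuples lie in the sphere and survive the renaming.\<close>
  have walk: "(g u, g v) \<in> gaifman A ^^ j" if "u \<in> set us" "(u, v) \<in> gaifman B ^^ j" "j \<le> s" for u v j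
    using that(2,3)
  proof (induction j arbitrary: v)
    case (Suc j)
    then obtain y where y: "(u, y) \<in> gaifman B ^^ j" "(y, v) \<in> gaifman B" by auto
    obtain i ts where ts: "ts \<in> interp B i" "y \<in> set ts" "v \<in> set ts" "y \<noteq> v" using y(2) by (auto simp: gaifman_def)
    have "y \<in> ball B j (set us)" using that(1) y(1) by (intro ballI) auto
    then have tsX: "set ts \<subseteq> ?X" unfolding X using tuple_in_ball[OF ts(1,2)] Suc.prems(2) by blast
    then have "map g ts \<in> interp A i" using ts(1) by (simp add: A_def)
    moreover have "g y \<noteq> g v" using inj ts tsX by (auto dest: inj_onD)
    ultimately have "(g y, g v) \<in> gaifman A" using ts(2,3) by (force simp: gaifman_def)
    then show ?case using Suc.IH[OF y(1)] Suc.prems(2) by auto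
  qed simp
  have "{..<card ?X} \<subseteq> nbhd A s (map g us)"
  proof
    fix x assume "x \<in> {..<card ?X}"
    then obtain v where v: "v \<in> ?X" "x = g v" using im by blast
    then obtain u j where u: "u \<in> set us" "j \<le> s" "(u, v) \<in> gaifman B ^^ j" unfolding nbhd_def by blast
    have "g v \<in> univ A" using im v(1) by (auto simp: A_def)
    then show "x \<in> nbhd A s (map g us)"
      unfolding nbhd_def using u(1,2) walk[OF u(1,3,2)] v(2) by auto
  qed
  then have "univ A = nbhd A s (map g us)" by (auto simp: A_def nbhd_def)
  then have "is_type \<sigma> s (A, map g us)"
    using A usX im unfolding is_type_def by (auto simp: A_def)
  then show ?thesis
    using iso us(1) by (intro that[of A "map g us"]) (auto simp: A_def tuples_iff)
qed

lemma finite_types: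
  assumes "0 < m"
  obtains \<Theta> where "\<And>A cs. (A, cs) \<in> set \<Theta> \<Longrightarrow> is_type \<sigma> s (A, cs) \<and> length cs = m \<and> (\<exists>q. univ A = {..<q})"
    "\<And>B us. is_struct \<sigma> B \<Longrightarrow> degree_at_most B \<Longrightarrow> us \<in> tuples B m \<Longrightarrow>
       \<exists>\<tau>\<in>set \<Theta>. isomorphic (sphere B s us) \<tau>"
proof -
  obtain M where M: "\<And>B us. is_struct \<sigma> B \<Longrightarrow> degree_at_most B \<Longrightarrow> us \<in> tuples B m \<Longrightarrow> card (nbhd B s us) \<le> M"
    using card_nbhd_bounded by blast
  let ?S = "{(A :: nat struct, cs). is_struct \<sigma> A \<and> univ A \<subseteq> {..<M} \<and> set cs \<subseteq> univ A \<and> length cs = m}"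
  let ?T = "{(A, cs). is_type \<sigma> s (A, cs) \<and> length cs = m \<and> univ A \<subseteq> {..<M} \<and> (\<exists>q. univ A = {..<q})}"
  have "?T \<subseteq> ?S" by (auto simp: is_type_def)
  then have "finite ?T" by (rule finite_subset[OF _ finite_pointed_structs])
  from finite_list[OF this] obtain \<Theta> where \<Theta>: "set \<Theta> = ?T" by (elim exE)
  show ?thesis
  proof (rule that[of \<Theta>])
    fix B us assume B: "is_struct \<sigma> B" "degree_at_most B" "us \<in> tuples B m"
    obtain A cs where A: "is_type \<sigma> s (A, cs)" "isomorphic (sphere B s us) (A, cs)"
      "univ A = {..<card (nbhd B s us)}" "length cs = m"
      by (rule relabel_sphere[OF B(1,3) assms])
    then have "(A, cs) \<in> set \<Theta>" using M[OF B] unfolding \<Theta> by auto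
    then show "\<exists>\<tau>\<in>set \<Theta>. isomorphic (sphere B s us) \<tau>" using A(2) by blast
  qed (auto simp: \<Theta>)
qed

end

section \<open>Sphere formulas and the list of all hypotheses\<close>

context hypothesis_class
begin

lemma exists_sphere_formula:
  assumes \<tau>: "is_type \<sigma> s (A, cs)" "length cs = m" "univ A = {..<q}"
  obtains \<psi> :: "'p fm" where "sphere_formula \<sigma> P s (A, cs) [0..<m] \<psi>"
proof -
  have A: "is_struct \<sigma> A" "set cs \<subseteq> {..<q}" using \<tau> by (auto simp: is_type_def)
  have iso: "definable m (\<lambda>B us. isomorphic (sphere B s us) (A, cs))"
    using local_query_isomorphic_sphere[OF A(1) \<tau>(3,2) A(2)] by (simp add: local_query_def)
  obtain \<psi> :: "'p fm" where \<psi>: "first_order \<psi>" "wf_fm \<sigma> P \<psi>" "svars \<psi> \<subseteq> set [0..<m]"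
    and sat: "\<And>(B :: nat struct) \<beta> \<nu>. is_struct \<sigma> B \<Longrightarrow> \<beta> ` set [0..<m] \<subseteq> univ B \<Longrightarrow>
      sat P B \<beta> \<nu> \<psi> \<longleftrightarrow> isomorphic (sphere B s (map \<beta> [0..<m])) (A, cs)"
    by (rule definableE[OF iso, of "[0..<m]"]) (simp, rule that, assumption+)
  have "holds P B \<psi> [0..<m] bs [] [] \<longleftrightarrow> isomorphic (sphere B s bs) (A, cs)"
    if B: "is_struct \<sigma> B" "length bs = m" "set bs \<subseteq> univ B" for B :: "nat struct" and bs
  proof -
    have m: "map (upds (\<lambda>_. undefined) [0..<m] bs) [0..<m] = bs" using B by (intro map_upds) auto
    then have "upds (\<lambda>_. undefined) [0..<m] bs ` set [0..<m] = set bs" by (metis set_map)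
    then show ?thesis using sat[OF B(1), of "upds (\<lambda>_. undefined) [0..<m] bs"] B(3) unfolding m holds_def by simp
  qed
  then have "sphere_formula \<sigma> P s (A, cs) [0..<m] \<psi>"
    using \<psi> \<tau>(2) by (simp add: sphere_formula_def)
  then show ?thesis by (rule that)
qed

fun disjunction :: "('t \<Rightarrow> 'p fm) \<Rightarrow> 't list \<Rightarrow> 'p fm" where
  "disjunction \<psi> [] = FNeg FTrue"
| "disjunction \<psi> (\<tau> # \<tau>s) = FOr (\<psi> \<tau>) (disjunction \<psi> \<tau>s)"

lemma holds_disjunction: "holds P B (disjunction \<psi> \<tau>s) xs us [] [] \<longleftrightarrow> (\<exists>\<tau>\<in>set \<tau>s. holds P B (\<psi> \<tau>) xs us [] [])"
  by (induction \<tau>s) (auto simp: holds_def)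

lemma disjunction_syntax:
  assumes "\<And>\<tau>. \<tau> \<in> set \<tau>s \<Longrightarrow> first_order (\<psi> \<tau>) \<and> wf_fm \<sigma> P (\<psi> \<tau>) \<and> svars (\<psi> \<tau>) \<subseteq> X \<and> \<psi> \<tau> \<in> S"
  shows "first_order (disjunction \<psi> \<tau>s) \<and> wf_fm \<sigma> P (disjunction \<psi> \<tau>s) \<and> svars (disjunction \<psi> \<tau>s) \<subseteq> X \<and>
    bool_comb S (disjunction \<psi> \<tau>s)"
  using assms by (induction \<tau>s) (auto intro: bool_comb.intros)

text \<open>Every tuple realises one of finitely many types, and tuples with non-isomorphic spheres
  realise different ones, so disjunctions over all sets of types suffice as hypotheses. For
  \<open>m = 0\<close> there is just one tuple, and its empty sphere is no structure; there the two
  constant formulas do the job.\<close>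

lemma finite_hypotheses:
  assumes R: "s < R"
  obtains \<Phi> :: "'p fm list" where
    "\<And>\<phi>. \<phi> \<in> set \<Phi> \<Longrightarrow> first_order \<phi> \<and> wf_fm \<sigma> P \<phi> \<and> svars \<phi> \<subseteq> {..<m} \<and>
       bool_comb (sphere_formulas \<sigma> P R {..<m}) \<phi> \<and> local_query m (\<lambda>B us. holds P B \<phi> [0..<m] us [] [])"
    "\<And>B U U'. is_struct \<sigma> B \<Longrightarrow> degree_at_most B \<Longrightarrow> U \<subseteq> tuples B m \<Longrightarrow> U' \<subseteq> tuples B m \<Longrightarrow>
       \<forall>us\<in>U. \<forall>us'\<in>U'. \<not> isomorphic (sphere B s us) (sphere B s us') \<Longrightarrow>
       \<exists>\<phi>\<in>set \<Phi>. (\<forall>us\<in>U. holds P B \<phi> [0..<m] us [] []) \<and> (\<forall>us\<in>U'. \<not> holds P B \<phi> [0..<m] us [] [])"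
proof (cases "m = 0")
  case True
  show ?thesis
  proof (rule that[of "[FTrue, FNeg FTrue]"])
    fix \<phi> :: "'p fm" assume "\<phi> \<in> set [FTrue, FNeg FTrue]"
    then have "\<phi> = FTrue \<or> \<phi> = FNeg FTrue" by simp
    then show "first_order \<phi> \<and> wf_fm \<sigma> P \<phi> \<and> svars \<phi> \<subseteq> {..<m} \<and>
       bool_comb (sphere_formulas \<sigma> P R {..<m}) \<phi> \<and> local_query m (\<lambda>B us. holds P B \<phi> [0..<m] us [] [])"
      using local_query_True local_query_not[OF local_query_True] by (auto simp: holds_def intro: bool_comb.intros)
  next
    fix B U U' assume U: "U \<subseteq> tuples B m" "U' \<subseteq> tuples B m"
      and "\<forall>us\<in>U. \<forall>us'\<in>U'. \<not> isomorphic (sphere B s us) (sphere B s us')"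
    moreover have "us = us'" if "us \<in> U" "us' \<in> U'" for us us'
      using that U True by (auto simp: tuples_iff dest!: subsetD)
    ultimately have "U = {} \<or> U' = {}" using isomorphic_refl by blast
    then show "\<exists>\<phi>\<in>set [FTrue, FNeg FTrue]. (\<forall>us\<in>U. holds P B \<phi> [0..<m] us [] []) \<and> (\<forall>us\<in>U'. \<not> holds P B \<phi> [0..<m] us [] [])"
      by (auto simp: holds_def)
  qed
next
  case False
  then have m: "0 < m" by simp
  obtain \<Theta> where \<Theta>: "\<And>A cs. (A, cs) \<in> set \<Theta> \<Longrightarrow> is_type \<sigma> s (A, cs) \<and> length cs = m \<and> (\<exists>q. univ A = {..<q})"
    and cover: "\<And>B us. is_struct \<sigma> B \<Longrightarrow> degree_at_most B \<Longrightarrow> us \<in> tuples B m \<Longrightarrow>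
       \<exists>\<tau>\<in>set \<Theta>. isomorphic (sphere B s us) \<tau>"
    using finite_types[OF m, where s = s] by metis
  have "\<exists>\<psi> :: 'p fm. sphere_formula \<sigma> P s \<tau> [0..<m] \<psi>" if "\<tau> \<in> set \<Theta>" for \<tau>
    using \<Theta>[of "fst \<tau>" "snd \<tau>"] that exists_sphere_formula[of s "fst \<tau>" "snd \<tau>" m] by (metis prod.collapse)
  then obtain \<psi> :: "nat struct \<times> nat list \<Rightarrow> 'p fm" where
    \<psi>: "\<And>\<tau>. \<tau> \<in> set \<Theta> \<Longrightarrow> sphere_formula \<sigma> P s \<tau> [0..<m] (\<psi> \<tau>)" by metis
  have sem: "holds P B (\<psi> \<tau>) [0..<m] us [] [] \<longleftrightarrow> isomorphic (sphere B s us) \<tau>"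
    if "\<tau> \<in> set \<Theta>" "is_struct \<sigma> B" "us \<in> tuples B m" for \<tau> and B :: "nat struct" and us
  proof -
    have "length us = length [0..<m]" "set us \<subseteq> univ B" using that(3) by (auto simp: tuples_iff)
    then show ?thesis using \<psi>[OF that(1)] that(2) unfolding sphere_formula_def by blast
  qed
  have syn: "first_order (\<psi> \<tau>) \<and> wf_fm \<sigma> P (\<psi> \<tau>) \<and> svars (\<psi> \<tau>) \<subseteq> {..<m} \<and> \<psi> \<tau> \<in> sphere_formulas \<sigma> P R {..<m}"
    if "\<tau> \<in> set \<Theta>" for \<tau>
  proof -
    have "is_type \<sigma> s \<tau>" using \<Theta>[of "fst \<tau>" "snd \<tau>"] that by simp
    then have "\<psi> \<tau> \<in> sphere_formulas \<sigma> P R {..<m}"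
      unfolding sphere_formulas_def using \<psi>[OF that] R
      by (intro CollectI exI[of _ s] exI[of _ \<tau>] exI[of _ "[0..<m]"]) auto
    then show ?thesis using \<psi>[OF that] by (auto simp: sphere_formula_def)
  qed
  show ?thesis
  proof (rule that[of "map (disjunction \<psi>) (subseqs \<Theta>)"])
    fix \<phi> assume "\<phi> \<in> set (map (disjunction \<psi>) (subseqs \<Theta>))"
    then obtain \<tau>s where \<tau>s: "\<tau>s \<in> set (subseqs \<Theta>)" "\<phi> = disjunction \<psi> \<tau>s" by auto
    then have sub: "set \<tau>s \<subseteq> set \<Theta>" using subseqs_powset[of \<Theta>] by auto
    have "local_query m (\<lambda>B us. \<exists>\<tau>\<in>set \<tau>s. isomorphic (sphere B s us) \<tau>)"
    proof (rule local_query_bex)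
      fix \<tau> assume "\<tau> \<in> set \<tau>s"
      then obtain q where t: "is_type \<sigma> s \<tau>" "length (snd \<tau>) = m" "univ (fst \<tau>) = {..<q}"
        using \<Theta>[of "fst \<tau>" "snd \<tau>"] sub by auto
      then show "local_query m (\<lambda>B us. isomorphic (sphere B s us) \<tau>)"
        using local_query_isomorphic_sphere[of "fst \<tau>" q "snd \<tau>" m s] by (auto simp: is_type_def)
    qed
    then have "local_query m (\<lambda>B us. holds P B \<phi> [0..<m] us [] [])"
      unfolding \<tau>s(2) holds_disjunction
      by (rule local_query_cong) (rule bex_cong[OF refl], use sub sem in blast)
    then show "first_order \<phi> \<and> wf_fm \<sigma> P \<phi> \<and> svars \<phi> \<subseteq> {..<m} \<and>
       bool_comb (sphere_formulas \<sigma> P R {..<m}) \<phi> \<and> local_query m (\<lambda>B us. holds P B \<phi> [0..<m] us [] [])"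
      using disjunction_syntax[of \<tau>s \<psi> "{..<m}" "sphere_formulas \<sigma> P R {..<m}"] syn sub unfolding \<tau>s(2) by blast
  next
    fix B U U' assume B: "is_struct \<sigma> B" "degree_at_most B" and U: "U \<subseteq> tuples B m" "U' \<subseteq> tuples B m"
      and niso: "\<forall>us\<in>U. \<forall>us'\<in>U'. \<not> isomorphic (sphere B s us) (sphere B s us')"
    \<comment> \<open>The hypothesis to choose is the disjunction over the types realised in
      \<open>U\<close>.\<close>
    let ?J = "{\<tau> \<in> set \<Theta>. \<exists>us\<in>U. isomorphic (sphere B s us) \<tau>}"
    have "?J \<in> Pow (set \<Theta>)" by auto
    then have "?J \<in> set ` set (subseqs \<Theta>)" by (simp only: subseqs_powset)
    then obtain \<tau>s where \<tau>s: "\<tau>s \<in> set (subseqs \<Theta>)" "set \<tau>s = ?J" by auto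
    have h: "holds P B (disjunction \<psi> \<tau>s) [0..<m] us [] [] \<longleftrightarrow> (\<exists>\<tau>\<in>?J. isomorphic (sphere B s us) \<tau>)"
      if "us \<in> tuples B m" for us
      unfolding holds_disjunction \<tau>s(2) by (rule bex_cong[OF refl], rule sem[OF _ B(1) that]) blast
    have "holds P B (disjunction \<psi> \<tau>s) [0..<m] us [] []" if "us \<in> U" for us
      using that U(1) h cover[OF B] by blast
    moreover have "\<not> holds P B (disjunction \<psi> \<tau>s) [0..<m] us' [] []" if us': "us' \<in> U'" for us'
    proof
      assume "holds P B (disjunction \<psi> \<tau>s) [0..<m] us' [] []"
      then have "\<exists>\<tau>\<in>?J. isomorphic (sphere B s us') \<tau>" using h us' U(2) by (simp add: subset_iff)
      then obtain \<tau> :: "nat struct \<times> nat list" and us where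
        \<tau>: "isomorphic (sphere B s us') \<tau>" "us \<in> U" "isomorphic (sphere B s us) \<tau>" by blast
      have "us' \<in> tuples B m" using us' U(2) by blast
      then have "set us' \<subseteq> univ B" by (simp add: tuples_iff)
      from nbhd_eq_ball[OF gaifman_subset[OF B(1)] this]
      have "set us' \<subseteq> nbhd B s us'" using subset_ball by simp
      then have "isomorphic \<tau> (sphere B s us')"
        using isomorphic_sym[OF \<tau>(1)] by (simp add: sphere_def induced_def)
      then show False using niso \<tau>(2) us' isomorphic_trans[OF \<tau>(3)] by blast
    qed
    ultimately show "\<exists>\<phi>\<in>set (map (disjunction \<psi>) (subseqs \<Theta>)).
        (\<forall>us\<in>U. holds P B \<phi> [0..<m] us [] []) \<and> (\<forall>us\<in>U'. \<not> holds P B \<phi> [0..<m] us [] [])"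
      using \<tau>s(1) by auto
  qed
qed

end

section \<open>The learner\<close>

context small_degree
begin

text \<open>Follows all walks of length at most \<open>r\<close> without recording visited elements,
  so an element may be tried repeatedly. As \<open>r\<close> and the degree are bounded by
  constants, this costs only a constant factor.\<close>

primrec first_hit_walk :: "world \<Rightarrow> nat \<Rightarrow> (nat \<Rightarrow> dat) \<Rightarrow> nat \<Rightarrow> dat" where
  "first_hit_walk w 0 f u = f u"
| "first_hit_walk w (Suc r) f u =
     (if f u \<noteq> Nl then f u else first_hit (first_hit_walk w r f) (ask_nbrs (wacc w) u))"

lemma first_hit_walk_eq_Nl_iff:
  "valid w \<Longrightarrow> u \<in> univ (wstr w) \<Longrightarrow> first_hit_walk w r f u = Nl \<longleftrightarrow> (\<forall>v\<in>nbhd (wstr w) r [u]. f v = Nl)"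
proof (induction r arbitrary: u)
  case 0
  then show ?case by (simp add: nbhd_0)
next
  case (Suc r)
  have "first_hit_walk w r f y = Nl \<longleftrightarrow> (\<forall>v\<in>nbhd (wstr w) r [y]. f v = Nl)" if "y \<in> gaifman_nbrs (wstr w) u" for y
    using Suc.IH[OF Suc.prems(1)] valid_nbrs(1,3)[OF Suc.prems] that by blast
  then show ?case
    unfolding Ball_def nbhd_Suc[OF Suc.prems(2)]
    by (auto simp: first_hit_eq_Nl_iff valid_nbrs(1)[OF Suc.prems])
qed

lemma first_hit_walk_hits:
  "valid w \<Longrightarrow> u \<in> univ (wstr w) \<Longrightarrow> first_hit_walk w r f u \<noteq> Nl \<Longrightarrow> \<exists>v\<in>univ (wstr w). first_hit_walk w r f u = f v"
proof (induction r arbitrary: u)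
  case (Suc r)
  show ?case
  proof (cases "f u = Nl")
    case True
    then have e: "first_hit_walk w (Suc r) f u = first_hit (first_hit_walk w r f) (ask_nbrs (wacc w) u)" by simp
    then obtain y where y: "y \<in> set (ask_nbrs (wacc w) u)" "first_hit_walk w (Suc r) f u = first_hit_walk w r f y"
      using first_hit_hits Suc.prems(3) by metis
    then show ?thesis using Suc.IH[OF Suc.prems(1), of y] Suc.prems(3) valid_nbrs(3)[OF Suc.prems(1,2)] by auto
  qed (use Suc.prems in auto)
qed auto

end

context hypothesis_class
begin

text \<open>In contrast to \<open>computable_first_hit\<close> the list is part of the program: the
  loop is unrolled, and each entry may have a program of its own.\<close>

lemma computable_first_hit_const:
  assumes "poly_bounded I (\<lambda>w a. dsize (inp w a))"
    and "\<And>x. x \<in> set xs \<Longrightarrow> computable I inp (\<lambda>w a. f w a x)"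
  shows "computable I inp (\<lambda>w a. first_hit (f w a) xs)"
  using assms(2)
proof (induction xs)
  case Nil
  show ?case using computable_const[OF assms(1)] by simp
next
  case (Cons x xs)
  have x: "computable I inp (\<lambda>w a. f w a x)" and xs: "computable I inp (\<lambda>w a. first_hit (f w a) xs)"
    using Cons by auto
  have "computable I inp (\<lambda>w a. if f w a x \<noteq> Nl then f w a x else first_hit (f w a) xs)"
    by (rule computable_if[OF x computable_cong[OF x] computable_cong[OF xs]]) auto
  then show ?case by simp
qed

lemma computable_on_pair_id:
  assumes inp: "poly_bounded I (\<lambda>w a. dsize (inp w a))"
    and J: "\<And>w a x. valid w \<Longrightarrow> J w (a, x) \<Longrightarrow> I w a"
    and e: "poly_bounded J (\<lambda>w a. dsize (e (snd a)))"
  shows "computable J (\<lambda>w (a, x). Pr (inp w a) (e x)) (\<lambda>w (a, x). Pr (inp w a) (e x))"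
proof (rule computable_id)
  have "poly_bounded J (\<lambda>w a. dsize (inp w (fst a)))"
    by (rule poly_bounded_mono[OF inp, of _ "\<lambda>w a. fst a"]) (use J in auto)
  then have "poly_bounded J (\<lambda>w a. Suc (dsize (inp w (fst a)) + dsize (e (snd a))))"
    using e by (intro poly_bounded_Suc poly_bounded_add)
  then show "poly_bounded J (\<lambda>w a. dsize (case a of (a, x) \<Rightarrow> Pr (inp w a) (e x)))"
    by (rule poly_bounded_le) auto
qed

lemma computable_first_hit_walk:
  assumes "computable (\<lambda>w (a, v). I w a \<and> v \<in> univ (wstr w)) (\<lambda>w (a, v). Pr (inp w a) (enc_nat v)) (\<lambda>w (a, v). f w a v)"
    and inp: "poly_bounded I (\<lambda>w a. dsize (inp w a))"
  shows "computable (\<lambda>w (a, v). I w a \<and> v \<in> univ (wstr w)) (\<lambda>w (a, v). Pr (inp w a) (enc_nat v))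
    (\<lambda>w (a, v). first_hit_walk w r (f w a) v)"
proof (induction r)
  case 0
  show ?case using assms by simp
next
  case (Suc r)
  let ?J = "\<lambda>w (a, v). I w a \<and> v \<in> univ (wstr w)"
  let ?K = "\<lambda>w ((a, u), v). I w a \<and> v \<in> univ (wstr w) \<and> u \<in> univ (wstr w)"
  let ?inp = "\<lambda>w (a, v). Pr (inp w a) (enc_nat v)"
  let ?inp2 = "\<lambda>w (a, v). Pr (?inp w a) (enc_nat v)"
  have id: "computable ?J ?inp ?inp"
    by (rule computable_on_pair_id[OF inp]) (auto intro: poly_bounded_enc_nat)
  have id2: "computable ?K ?inp2 ?inp2"
    by (rule computable_on_pair_id[OF computable_sizes(1)[OF id]]) (auto intro: poly_bounded_enc_nat)
  have "computable ?J ?inp (\<lambda>w a. enc_nat (snd a))"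
    by (rule computable_cong[OF computable_tl[OF id]]) auto
  from computable_ask_nbrs[OF this]
  have nbrs: "computable ?J ?inp (\<lambda>w a. enc_list enc_nat (ask_nbrs (wacc w) (snd a)))"
    unfolding enc_tuple_def by auto
  have "computable ?K ?inp2 (\<lambda>w ((a, u), v). Pr (inp w a) (enc_nat v))"
    by (rule computable_cong[OF computable_pair[OF computable_hd[OF computable_hd[OF id2]] computable_tl[OF id2]]]) auto
  moreover have "computable ?K (\<lambda>w ((a, u), v). Pr (inp w a) (enc_nat v)) (\<lambda>w (a, v). first_hit_walk w r (f w (fst a)) v)"
    by (rule computable_reindex[OF Suc.IH, where h = "\<lambda>w ((a, u), v). (a, v)"]) auto
  ultimately have body: "computable ?K ?inp2 (\<lambda>w (a, v). first_hit_walk w r (f w (fst a)) v)"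
    by (rule computable_trans)
  have hit: "computable ?J ?inp (\<lambda>w a. first_hit (first_hit_walk w r (f w (fst a))) (ask_nbrs (wacc w) (snd a)))"
    by (rule computable_first_hit[OF nbrs body]) (auto dest: valid_nbrs(3)[THEN subsetD])
  have "computable ?J ?inp (\<lambda>w a. if (case a of (a, v) \<Rightarrow> f w a v) \<noteq> Nl then (case a of (a, v) \<Rightarrow> f w a v)
      else first_hit (first_hit_walk w r (f w (fst a))) (ask_nbrs (wacc w) (snd a)))"
    by (rule computable_if[OF assms(1) computable_cong[OF assms(1)] computable_cong[OF hit]]) auto
  then show ?case by (rule computable_cong) auto
qed

end

text \<open>The search works for any finite list of local hypotheses and any search radius. Their
  suitable choice matters only for completeness and is made at the very end.\<close>

locale learner = hypothesis_class \<sigma> d P for \<sigma> d and P :: "'p num_preds" +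
  fixes k l :: nat and \<Phi> :: "'p fm list" and rad :: nat
  assumes query: "\<And>\<phi>. \<phi> \<in> set \<Phi> \<Longrightarrow> local_query (k + l) (\<lambda>B us. holds P B \<phi> [0..<k + l] us [] [])"
    and fo: "\<And>\<phi>. \<phi> \<in> set \<Phi> \<Longrightarrow> first_order \<phi>"
begin

section \<open>Checking hypotheses against the examples\<close>

definition hyp :: "'p fm \<Rightarrow> nat struct \<Rightarrow> nat list \<Rightarrow> bool" where
  "hyp \<phi> B us = holds P B \<phi> [0..<k + l] us [] []"

definition training_world :: "world \<Rightarrow> training \<Rightarrow> bool" where
  "training_world w T \<longleftrightarrow> is_training (wstr w) k T \<and> length T \<le> wsize w"

lemma training_world_univ:
  "training_world w T \<Longrightarrow> x \<in> set T \<Longrightarrow> u \<in> set (fst x) \<Longrightarrow> u \<in> univ (wstr w)"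
  by (cases x) (auto simp: training_world_def is_training_def tuples_iff)

definition enc_example :: "nat list \<times> bool \<Rightarrow> dat" where
  "enc_example = (\<lambda>(us, c). Pr (enc_tuple us) (enc_bool c))"

lemma enc_training_eq: "enc_training T = enc_list enc_example T"
  by (simp add: enc_training_def enc_example_def)

lemma poly_bounded_training: "poly_bounded training_world (\<lambda>w T. dsize (enc_training T))"
  unfolding enc_training_eq
proof (rule poly_bounded_enc_list)
  have "poly_bounded training_world (\<lambda>w a. wsize w ^ 1)" by (rule poly_bounded_power)
  then show "poly_bounded training_world (\<lambda>w T. length T)"
    by (rule poly_bounded_le) (simp add: training_world_def)
  show "poly_bounded training_world (\<lambda>w T. Suc (1 + k * (wsize w ^ 3 + 1) + 3))"
    by (intro poly_bounded_Suc poly_bounded_add poly_bounded_mult poly_bounded_power poly_bounded_const)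
  fix w T x assume w: "valid w" "training_world w T" "x \<in> set T"
  obtain us c where x: "x = (us, c)" by (cases x)
  then have us: "length us = k" "set us \<subseteq> univ (wstr w)"
    using w(2,3) by (auto simp: training_world_def is_training_def tuples_iff)
  have "dsize (enc_list enc_nat us) \<le> 1 + length us * (wsize w ^ 3 + 1)"
    by (rule dsize_enc_list) (use us w(1) in \<open>auto simp: valid_def\<close>)
  then have "dsize (enc_tuple us) \<le> 1 + k * (wsize w ^ 3 + 1)" by (simp add: us enc_tuple_def)
  then show "dsize (enc_example x) \<le> Suc (1 + k * (wsize w ^ 3 + 1) + 3)"
    using dsize_enc_bool[of c] by (simp add: x enc_example_def)
qed

text \<open>The inputs of the search at an intermediate stage: the examples together with the
  \<open>j\<close> parameters chosen so far.\<close>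

definition partial_input :: "nat \<Rightarrow> world \<Rightarrow> training \<times> nat list \<Rightarrow> bool" where
  "partial_input j w a \<longleftrightarrow> training_world w (fst a) \<and> snd a \<in> tuples (wstr w) j"

definition enc_input :: "world \<Rightarrow> training \<times> nat list \<Rightarrow> dat" where
  "enc_input w a = Pr (enc_training (fst a)) (enc_tuple (snd a))"

lemma poly_bounded_input: "poly_bounded (partial_input j) (\<lambda>w a. dsize (enc_input w a))"
proof -
  have "poly_bounded (partial_input j) (\<lambda>w a. dsize (enc_training (fst a)))"
    by (rule poly_bounded_mono[OF poly_bounded_training, of _ "\<lambda>w a. fst a"]) (simp add: partial_input_def)
  moreover have "poly_bounded (partial_input j) (\<lambda>w a. dsize (enc_tuple (snd a)))"
    by (rule poly_bounded_mono[OF poly_bounded_tuple[of j], of _ "\<lambda>w a. snd a"]) (simp add: partial_input_def)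
  ultimately show ?thesis unfolding enc_input_def by (auto intro: poly_bounded_Suc poly_bounded_add)
qed

lemma computable_input:
  "computable (partial_input j) enc_input (\<lambda>w a. enc_training (fst a))"
  "computable (partial_input j) enc_input (\<lambda>w a. enc_tuple (snd a))"
proof -
  note id = computable_id[OF poly_bounded_input]
  show "computable (partial_input j) enc_input (\<lambda>w a. enc_training (fst a))"
    by (rule computable_cong[OF computable_hd[OF id]]) (simp add: enc_input_def)
  show "computable (partial_input j) enc_input (\<lambda>w a. enc_tuple (snd a))"
    by (rule computable_cong[OF computable_tl[OF id]]) (simp add: enc_input_def)
qed

lemma computable_hyp:
  assumes \<phi>: "\<phi> \<in> set \<Phi>"
    and us: "computable I inp (\<lambda>w a. enc_tuple (us w a))" and vs: "computable I inp (\<lambda>w a. enc_tuple (vs w a))"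
    and I: "\<And>w a. valid w \<Longrightarrow> I w a \<Longrightarrow> us w a \<in> tuples (wstr w) k \<and> vs w a \<in> tuples (wstr w) l"
  shows "computable I inp (\<lambda>w a. enc_bool (hyp \<phi> (wstr w) (us w a @ vs w a)))"
proof -
  have nth: "computable I inp (\<lambda>w a. enc_nat ((us w a @ vs w a) ! j))" if "j \<in> set [0..<k + l]" for j
  proof (cases "j < k")
    case True
    have "computable I inp (\<lambda>w a. enc_nat (us w a ! j))"
      by (rule computable_nth[OF us[unfolded enc_tuple_def]]) (use I True in \<open>auto simp: tuples_iff\<close>)
    then show ?thesis
      by (rule computable_cong) (use I True in \<open>auto simp: tuples_iff nth_append\<close>)
  next
    case False
    have "computable I inp (\<lambda>w a. enc_nat (vs w a ! (j - k)))"
      by (rule computable_nth[OF vs[unfolded enc_tuple_def]]) (use I False that in \<open>auto simp: tuples_iff\<close>)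
    then show ?thesis
      by (rule computable_cong) (use I False in \<open>auto simp: tuples_iff nth_append\<close>)
  qed
  have "computable I inp (\<lambda>w a. enc_list enc_nat (map (\<lambda>j. (us w a @ vs w a) ! j) [0..<k + l]))"
    using computable_enc_list[where e = enc_nat and f = "\<lambda>w a j. (us w a @ vs w a) ! j",
        OF computable_sizes(1)[OF us] nth] .
  then have app: "computable I inp (\<lambda>w a. enc_tuple (us w a @ vs w a))"
  proof (rule computable_cong)
    fix w a assume "valid w" "I w a"
    then have "length (us w a @ vs w a) = k + l" using I by (auto simp: tuples_iff)
    then have "map ((!) (us w a @ vs w a)) [0..<k + l] = us w a @ vs w a" by (metis map_nth)
    then show "I w a \<and> inp w a = inp w a \<and> enc_tuple (us w a @ vs w a) =
        enc_list enc_nat (map (\<lambda>j. (us w a @ vs w a) ! j) [0..<k + l])"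
      using \<open>I w a\<close> by (simp add: enc_tuple_def)
  qed
  have q: "computable (\<lambda>w us. us \<in> tuples (wstr w) (k + l)) (\<lambda>w us. enc_tuple us) (\<lambda>w us. enc_bool (hyp \<phi> (wstr w) us))"
    using query[OF \<phi>] by (simp add: local_query_def hyp_def)
  have "computable I (\<lambda>w a. enc_tuple (us w a @ vs w a)) (\<lambda>w a. enc_bool (hyp \<phi> (wstr w) (us w a @ vs w a)))"
    by (rule computable_reindex[OF q, where h = "\<lambda>w a. us w a @ vs w a"]) (use I in \<open>auto simp: tuples_iff\<close>)
  with app show ?thesis by (rule computable_trans)
qed

definition consistent_hyp :: "world \<Rightarrow> training \<times> nat list \<Rightarrow> 'p fm \<Rightarrow> bool" where
  "consistent_hyp w a \<phi> \<longleftrightarrow> consistent (\<lambda>us. hyp \<phi> (wstr w) (us @ snd a)) (fst a)"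

lemma poly_bounded_example:
  "poly_bounded (\<lambda>w (a, x). partial_input j w a \<and> x \<in> set (fst a)) (\<lambda>w a. dsize (enc_example (snd a)))"
proof (rule poly_bounded_mono[OF poly_bounded_training, of _ "\<lambda>w a. fst (fst a)"])
  fix w and a :: "(training \<times> nat list) \<times> nat list \<times> bool"
  assume "case a of (a, x) \<Rightarrow> partial_input j w a \<and> x \<in> set (fst a)"
  then show "training_world w (fst (fst a)) \<and> dsize (enc_example (snd a)) \<le> dsize (enc_training (fst (fst a)))"
    by (auto simp: partial_input_def enc_training_eq intro: dsize_enc_list_member)
qed

lemma computable_example_id:
  "computable (\<lambda>w (a, x). partial_input j w a \<and> x \<in> set (fst a))
     (\<lambda>w (a, x). Pr (enc_input w a) (enc_example x)) (\<lambda>w (a, x). Pr (enc_input w a) (enc_example x))"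
  by (rule computable_on_pair_id[OF poly_bounded_input[of j]]) (use poly_bounded_example in auto)

lemma computable_consistent:
  assumes \<phi>: "\<phi> \<in> set \<Phi>"
  shows "computable (partial_input l) enc_input (\<lambda>w a. enc_bool (consistent_hyp w a \<phi>))"
proof -
  let ?J = "\<lambda>w (a, x). partial_input l w a \<and> x \<in> set (fst a)"
  let ?inp = "\<lambda>w (a, x). Pr (enc_input w a) (enc_example x)"
  note id = computable_example_id[of l]
  have us: "computable ?J ?inp (\<lambda>w a. enc_tuple (fst (snd a)))"
    by (rule computable_cong[OF computable_hd[OF computable_tl[OF id]]]) (auto simp: enc_example_def)
  have c: "computable ?J ?inp (\<lambda>w a. enc_bool (snd (snd a)))"
    by (rule computable_cong[OF computable_tl[OF computable_tl[OF id]]]) (auto simp: enc_example_def)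
  have vs: "computable ?J ?inp (\<lambda>w a. enc_tuple (snd (fst a)))"
    by (rule computable_cong[OF computable_tl[OF computable_hd[OF id]]]) (auto simp: enc_input_def)
  have "computable ?J ?inp (\<lambda>w a. enc_bool (hyp \<phi> (wstr w) (fst (snd a) @ snd (fst a))))"
    by (rule computable_hyp[OF \<phi> us vs]) (auto simp: partial_input_def training_world_def is_training_def)
  from computable_not[OF computable_eq[OF this c, simplified]]
  have "computable ?J ?inp (\<lambda>w a. enc_bool (hyp \<phi> (wstr w) (fst (snd a) @ snd (fst a)) \<noteq> snd (snd a)))" by simp
  then have body: "computable ?J ?inp (\<lambda>w (a, x). enc_bool (hyp \<phi> (wstr w) (fst x @ snd a) \<noteq> snd x))"
    by (rule computable_cong) auto
  have "computable (partial_input l) enc_input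
      (\<lambda>w a. first_hit (\<lambda>x. enc_bool (hyp \<phi> (wstr w) (fst x @ snd a) \<noteq> snd x)) (fst a))"
    by (rule computable_first_hit[OF computable_input(1)[unfolded enc_training_eq] body]) auto
  then have "computable (partial_input l) enc_input
      (\<lambda>w a. enc_bool (\<exists>x\<in>set (fst a). hyp \<phi> (wstr w) (fst x @ snd a) \<noteq> snd x))"
    by (simp only: first_hit_bool)
  from computable_not[OF this] show ?thesis
    by (rule computable_cong) (auto simp: consistent_hyp_def consistent_def)
qed

definition attempt :: "world \<Rightarrow> training \<times> nat list \<Rightarrow> dat" where
  "attempt w a = first_hit (\<lambda>\<phi>. if consistent_hyp w a \<phi> then enc_hypothesis \<phi> (snd a) else Nl) \<Phi>"

lemma computable_attempt: "computable (partial_input l) enc_input attempt"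
  unfolding attempt_def
proof (rule computable_first_hit_const[OF poly_bounded_input])
  fix \<phi> assume \<phi>: "\<phi> \<in> set \<Phi>"
  have h: "computable (partial_input l) enc_input (\<lambda>w a. enc_hypothesis \<phi> (snd a))"
    unfolding enc_hypothesis_def
    by (intro computable_pair computable_const poly_bounded_input computable_input)
  have "computable (partial_input l) enc_input
    (\<lambda>w a. if enc_bool (consistent_hyp w a \<phi>) \<noteq> Nl then enc_hypothesis \<phi> (snd a) else Nl)"
    by (rule computable_if[OF computable_consistent[OF \<phi>] computable_cong[OF h]
        computable_cong[OF computable_const[OF poly_bounded_input[of l]]]]) auto
  then show "computable (partial_input l) enc_input
    (\<lambda>w a. if consistent_hyp w a \<phi> then enc_hypothesis \<phi> (snd a) else Nl)" by simp
qed

section \<open>Searching for parameters\<close>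

definition candidates :: "world \<Rightarrow> training \<Rightarrow> nat set" where
  "candidates w T = insert 0 (\<Union>x\<in>set T. \<Union>u\<in>set (fst x). nbhd (wstr w) rad [u])"

definition try_candidates :: "world \<Rightarrow> training \<Rightarrow> (nat \<Rightarrow> dat) \<Rightarrow> dat" where
  "try_candidates w T f = (if f 0 \<noteq> Nl then f 0
     else first_hit (\<lambda>x. first_hit (first_hit_walk w rad f) (fst x)) T)"

lemma try_candidates_eq_Nl_iff:
  assumes "valid w" "training_world w T"
  shows "try_candidates w T f = Nl \<longleftrightarrow> (\<forall>v\<in>candidates w T. f v = Nl)"
proof -
  have "first_hit_walk w rad f u = Nl \<longleftrightarrow> (\<forall>v\<in>nbhd (wstr w) rad [u]. f v = Nl)"
    if "x \<in> set T" "u \<in> set (fst x)" for x u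
    by (rule first_hit_walk_eq_Nl_iff[OF assms(1) training_world_univ[OF assms(2) that]])
  then show ?thesis by (auto simp: try_candidates_def candidates_def first_hit_eq_Nl_iff)
qed

lemma try_candidates_hits:
  assumes "valid w" "training_world w T" "try_candidates w T f \<noteq> Nl"
  shows "\<exists>v\<in>univ (wstr w). try_candidates w T f = f v"
proof (cases "f 0 = Nl")
  case True
  then have e: "try_candidates w T f = first_hit (\<lambda>x. first_hit (first_hit_walk w rad f) (fst x)) T"
    by (simp add: try_candidates_def)
  then obtain x where x: "x \<in> set T" "try_candidates w T f = first_hit (first_hit_walk w rad f) (fst x)"
    using first_hit_hits[of "\<lambda>x. first_hit (first_hit_walk w rad f) (fst x)" T] assms(3) by auto
  then obtain u where u: "u \<in> set (fst x)" "try_candidates w T f = first_hit_walk w rad f u"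
    using first_hit_hits[of "first_hit_walk w rad f" "fst x"] assms(3) by auto
  have "u \<in> univ (wstr w)"
    by (rule training_world_univ[OF assms(2) x(1) u(1)])
  then show ?thesis using first_hit_walk_hits[OF assms(1), of u rad f] u(2) assms(3) by simp
qed (use assms in \<open>auto simp: try_candidates_def valid_def\<close>)

text \<open>Apart from the default element 0 there are nested loops over the examples, over the
  entries of an example and over the walks from an entry. Each loop pairs its current value with the
  input, and the bodies rearrange these pairs before calling the next stage.\<close>

lemma computable_try_candidates:
  assumes "computable (partial_input (Suc j)) enc_input F"
  shows "computable (partial_input j) enc_input (\<lambda>w a. try_candidates w (fst a) (\<lambda>v. F w (fst a, v # snd a)))"
proof -
  let ?I = "partial_input j"
  let ?f = "\<lambda>w a v. F w (fst a, v # snd a)"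
  let ?J = "\<lambda>w (a, v). ?I w a \<and> v \<in> univ (wstr w)"
  let ?inp = "\<lambda>w (a, v). Pr (enc_input w a) (enc_nat v)"
  note in_id = poly_bounded_input[of j]
  have id: "computable ?J ?inp ?inp"
    by (rule computable_on_pair_id[OF in_id]) (auto intro: poly_bounded_enc_nat)
  have "computable ?J ?inp (\<lambda>w (a, v). enc_input w (fst a, v # snd a))"
    by (rule computable_cong[OF computable_pair[OF computable_hd[OF computable_hd[OF id]]
        computable_pair[OF computable_tl[OF id] computable_tl[OF computable_hd[OF id]]]]])
      (auto simp: enc_input_def enc_tuple_def)
  moreover have "computable ?J (\<lambda>w (a, v). enc_input w (fst a, v # snd a)) (\<lambda>w (a, v). ?f w a v)"
    by (rule computable_reindex[OF assms, where h = "\<lambda>w (a, v). (fst a, v # snd a)"])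
      (auto simp: partial_input_def tuples_iff)
  ultimately have f: "computable ?J ?inp (\<lambda>w (a, v). ?f w a v)" by (rule computable_trans)
  have walk: "computable ?J ?inp (\<lambda>w (a, v). first_hit_walk w rad (?f w a) v)"
    by (rule computable_first_hit_walk[OF f in_id])
  have "computable ?I enc_input (\<lambda>w a. Pr (enc_input w a) (enc_nat 0))"
    by (rule computable_pair[OF computable_id[OF in_id] computable_const[OF in_id]])
  moreover have "computable ?I (\<lambda>w a. Pr (enc_input w a) (enc_nat 0)) (\<lambda>w a. ?f w a 0)"
    by (rule computable_reindex[OF f, where h = "\<lambda>w a. (a, 0)"]) (auto simp: valid_def)
  ultimately have f0: "computable ?I enc_input (\<lambda>w a. ?f w a 0)" by (rule computable_trans)
  let ?J2 = "\<lambda>w (a, x). ?I w a \<and> x \<in> set (fst a)"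
  let ?inp2 = "\<lambda>w (a, x). Pr (enc_input w a) (enc_example x)"
  let ?J3 = "\<lambda>w ((a, x), u). (?I w a \<and> x \<in> set (fst a)) \<and> u \<in> univ (wstr w)"
  let ?inp3 = "\<lambda>w (b, u). Pr (?inp2 w b) (enc_nat u)"
  note id2 = computable_example_id[of j]
  have id3: "computable ?J3 ?inp3 ?inp3"
    by (rule computable_on_pair_id[OF computable_sizes(1)[OF id2]]) (auto intro: poly_bounded_enc_nat)
  have "computable ?J3 ?inp3 (\<lambda>w ((a, x), u). Pr (enc_input w a) (enc_nat u))"
    by (rule computable_cong[OF computable_pair[OF computable_hd[OF computable_hd[OF id3]] computable_tl[OF id3]]]) auto
  moreover have "computable ?J3 (\<lambda>w ((a, x), u). Pr (enc_input w a) (enc_nat u))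
      (\<lambda>w (b, u). first_hit_walk w rad (?f w (fst b)) u)"
    by (rule computable_reindex[OF walk, where h = "\<lambda>w ((a, x), u). (a, u)"]) auto
  ultimately have body3: "computable ?J3 ?inp3 (\<lambda>w (b, u). first_hit_walk w rad (?f w (fst b)) u)"
    by (rule computable_trans)
  have list3: "computable ?J2 ?inp2 (\<lambda>w b. enc_list enc_nat (fst (snd b)))"
    by (rule computable_cong[OF computable_hd[OF computable_tl[OF id2]]]) (auto simp: enc_example_def enc_tuple_def)
  have "computable ?J2 ?inp2 (\<lambda>w b. first_hit (first_hit_walk w rad (?f w (fst b))) (fst (snd b)))"
    by (rule computable_first_hit[OF list3 body3])
      (auto simp: partial_input_def intro: training_world_univ)
  then have body2: "computable ?J2 ?inp2 (\<lambda>w (a, x). first_hit (first_hit_walk w rad (?f w a)) (fst x))"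
    by (rule computable_cong) auto
  have hit: "computable ?I enc_input (\<lambda>w a. first_hit (\<lambda>x. first_hit (first_hit_walk w rad (?f w a)) (fst x)) (fst a))"
    by (rule computable_first_hit[OF computable_input(1)[unfolded enc_training_eq] body2]) auto
  show ?thesis
    unfolding try_candidates_def
    by (rule computable_if[OF f0 computable_cong[OF f0] computable_cong[OF hit]]) auto
qed

text \<open>Unfolds into \<open>j\<close> nested searches, and \<open>j\<close> never exceeds the
  fixed number of parameters, so the time stays polynomial. New values are prepended, hence the
  parameters are chosen from the last to the first.\<close>

fun search :: "nat \<Rightarrow> world \<Rightarrow> training \<times> nat list \<Rightarrow> dat" where
  "search 0 w a = attempt w a"
| "search (Suc j) w a = try_candidates w (fst a) (\<lambda>v. search j w (fst a, v # snd a))"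

lemma computable_search: "i + j = l \<Longrightarrow> computable (partial_input i) enc_input (search j)"
proof (induction j arbitrary: i)
  case 0
  then show ?case using computable_attempt by simp
next
  case (Suc j)
  then show ?case using computable_try_candidates[OF Suc.IH[of "Suc i"]] by simp
qed

lemma search_hits:
  assumes "valid w" "training_world w T" "vs \<in> tuples (wstr w) i" "search j w (T, vs) \<noteq> Nl"
  shows "\<exists>vs'\<in>tuples (wstr w) (i + j). search j w (T, vs) = attempt w (T, vs')"
  using assms(3,4)
proof (induction j arbitrary: i vs)
  case (Suc j)
  then obtain v where "v \<in> univ (wstr w)" "search (Suc j) w (T, vs) = search j w (T, v # vs)"
    using try_candidates_hits[OF assms(1,2), of "\<lambda>v. search j w (T, v # vs)"] by auto
  then show ?case using Suc.IH[of "v # vs" "Suc i"] Suc.prems by (auto simp: tuples_Cons)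
qed auto

lemma search_complete:
  assumes "valid w" "training_world w T" "length vs' = j" "set vs' \<subseteq> candidates w T" "attempt w (T, vs' @ vs) \<noteq> Nl"
  shows "search j w (T, vs) \<noteq> Nl"
  using assms(3-)
proof (induction j arbitrary: vs vs')
  case (Suc j)
  \<comment> \<open>The last entry of the wanted tuple is the first one that the search
    chooses.\<close>
  then have "vs' = butlast vs' @ [last vs']" by (intro append_butlast_last_id[symmetric]) auto
  then obtain us v where v: "vs' = us @ [v]" by blast
  then have "search j w (T, v # vs) \<noteq> Nl" using Suc.IH[of us "v # vs"] Suc.prems by simp
  then show ?case
    using try_candidates_eq_Nl_iff[OF assms(1,2), of "\<lambda>v. search j w (T, v # vs)"] Suc.prems(2) v by auto
qed simp

definition learn :: "world \<Rightarrow> training \<Rightarrow> dat" where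
  "learn w T = search l w (T, [])"

lemma computable_learn: "computable training_world (\<lambda>w T. enc_training T) learn"
proof -
  have "computable training_world (\<lambda>w T. enc_training T) (\<lambda>w T. enc_input w (T, []))"
    unfolding enc_input_def fst_conv snd_conv
    by (intro computable_pair computable_id computable_const poly_bounded_training)
  moreover have "computable training_world (\<lambda>w T. enc_input w (T, [])) learn"
    by (rule computable_reindex[OF computable_search[of 0 l], where h = "\<lambda>w T. (T, [])"])
      (auto simp: learn_def partial_input_def tuples_iff)
  ultimately show ?thesis by (rule computable_trans)
qed

lemma attempt_hits:
  assumes "attempt w a \<noteq> Nl"
  shows "\<exists>\<phi>\<in>set \<Phi>. consistent_hyp w a \<phi> \<and> attempt w a = enc_hypothesis \<phi> (snd a)"
  using first_hit_hits[of "\<lambda>\<phi>. if consistent_hyp w a \<phi> then enc_hypothesis \<phi> (snd a) else Nl" \<Phi>] assms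
  unfolding attempt_def by (auto split: if_splits)

lemma learn_sound:
  assumes "valid w" "training_world w T" "learn w T \<noteq> Nl"
  obtains \<phi> vs where "\<phi> \<in> set \<Phi>" "vs \<in> tuples (wstr w) l" "learn w T = enc_hypothesis \<phi> vs"
    "consistent (\<lambda>us. hyp \<phi> (wstr w) (us @ vs)) T"
proof -
  have "[] \<in> tuples (wstr w) 0" by (simp add: tuples_iff)
  then obtain vs where vs: "vs \<in> tuples (wstr w) l" "learn w T = attempt w (T, vs)"
    using search_hits[OF assms(1,2), of "[]" 0 l] assms(3) by (auto simp: learn_def)
  then obtain \<phi> where "\<phi> \<in> set \<Phi>" "consistent_hyp w (T, vs) \<phi>" "attempt w (T, vs) = enc_hypothesis \<phi> vs"
    using attempt_hits[of w "(T, vs)"] assms(3) by auto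
  then show ?thesis using that vs by (simp add: consistent_hyp_def)
qed

lemma learn_complete:
  assumes "valid w" "training_world w T" "\<phi> \<in> set \<Phi>" "length vs = l" "set vs \<subseteq> candidates w T"
    "consistent (\<lambda>us. hyp \<phi> (wstr w) (us @ vs)) T"
  shows "learn w T \<noteq> Nl"
proof -
  have "attempt w (T, vs) \<noteq> Nl"
    using assms(3,6) by (auto simp: attempt_def first_hit_eq_Nl_iff consistent_hyp_def enc_hypothesis_def)
  then show ?thesis unfolding learn_def using search_complete[OF assms(1,2,4,5), of "[]"] by simp
qed

section \<open>Evaluating a returned hypothesis\<close>

definition eval_world :: "world \<Rightarrow> ('p fm \<times> nat list) \<times> nat list \<Rightarrow> bool" where
  "eval_world w = (\<lambda>((\<phi>, vs), us). \<phi> \<in> set \<Phi> \<and> vs \<in> tuples (wstr w) l \<and> us \<in> tuples (wstr w) k)"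

text \<open>The evaluator does not interpret the encoded formula. It compares the code with those of
  the finitely many hypotheses and runs the decision program of the one that matches; codes
  determine the formulas because these are first-order.\<close>

lemma computable_eval:
  "computable eval_world (\<lambda>w ((\<phi>, vs), us). Pr (enc_hypothesis \<phi> vs) (enc_tuple us))
     (\<lambda>w ((\<phi>, vs), us). enc_bool (hyp \<phi> (wstr w) (us @ vs)))"
proof -
  let ?inp = "\<lambda>w ((\<phi>, vs), us). Pr (enc_hypothesis \<phi> vs) (enc_tuple us)"
  have "poly_bounded eval_world (\<lambda>w a. dsize (enc_fm (fst (fst a))))"
    by (rule poly_bounded_le[OF poly_bounded_const[of _ "sum_list (map (\<lambda>\<phi>. dsize (enc_fm \<phi>)) \<Phi>)"]])
      (auto simp: eval_world_def intro!: member_le_sum_list)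
  moreover have "poly_bounded eval_world (\<lambda>w a. dsize (enc_tuple (snd (fst a))))"
    by (rule poly_bounded_mono[OF poly_bounded_tuple[of l], of _ "\<lambda>w a. snd (fst a)"]) (auto simp: eval_world_def)
  moreover have "poly_bounded eval_world (\<lambda>w a. dsize (enc_tuple (snd a)))"
    by (rule poly_bounded_mono[OF poly_bounded_tuple[of k], of _ "\<lambda>w a. snd a"]) (auto simp: eval_world_def)
  ultimately have "poly_bounded eval_world (\<lambda>w a. Suc (Suc (dsize (enc_fm (fst (fst a))) + dsize (enc_tuple (snd (fst a))))
     + dsize (enc_tuple (snd a))))"
    by (intro poly_bounded_Suc poly_bounded_add)
  then have sz: "poly_bounded eval_world (\<lambda>w a. dsize (?inp w a))"
    by (rule poly_bounded_le) (auto simp: enc_hypothesis_def)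
  note id = computable_id[OF sz]
  have fm: "computable eval_world ?inp (\<lambda>w a. enc_fm (fst (fst a)))"
    by (rule computable_cong[OF computable_hd[OF computable_hd[OF id]]]) (auto simp: enc_hypothesis_def)
  have vs: "computable eval_world ?inp (\<lambda>w a. enc_tuple (snd (fst a)))"
    by (rule computable_cong[OF computable_tl[OF computable_hd[OF id]]]) (auto simp: enc_hypothesis_def)
  have us: "computable eval_world ?inp (\<lambda>w a. enc_tuple (snd a))"
    by (rule computable_cong[OF computable_tl[OF id]]) auto
  have step: "computable eval_world ?inp (\<lambda>w a. enc_bool (fst (fst a) = \<phi> \<and> hyp \<phi> (wstr w) (snd a @ snd (fst a))))"
    if \<phi>: "\<phi> \<in> set \<Phi>" for \<phi>
  proof -
    have h: "computable eval_world ?inp (\<lambda>w a. enc_bool (hyp \<phi> (wstr w) (snd a @ snd (fst a))))"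
      by (rule computable_hyp[OF \<phi> us vs]) (auto simp: eval_world_def)
    have "computable eval_world ?inp (\<lambda>w a. if enc_bool (enc_fm (fst (fst a)) = enc_fm \<phi>) \<noteq> Nl
        then enc_bool (hyp \<phi> (wstr w) (snd a @ snd (fst a))) else Nl)"
      by (rule computable_if[OF computable_eq[OF fm computable_const[OF sz]] computable_cong[OF h]
            computable_cong[OF computable_const[OF sz]]]) auto
    then show ?thesis
    proof (rule computable_cong)
      fix w a assume "eval_world w a"
      moreover from this have "enc_fm (fst (fst a)) = enc_fm \<phi> \<longleftrightarrow> fst (fst a) = \<phi>"
        using fo \<phi> by (intro enc_fm_inject) (auto simp: eval_world_def)
      ultimately show "eval_world w a \<and> ?inp w a = ?inp w a \<and>
          enc_bool (fst (fst a) = \<phi> \<and> hyp \<phi> (wstr w) (snd a @ snd (fst a))) =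
          (if enc_bool (enc_fm (fst (fst a)) = enc_fm \<phi>) \<noteq> Nl
           then enc_bool (hyp \<phi> (wstr w) (snd a @ snd (fst a))) else Nl)"
        by (auto simp: enc_bool_def)
    qed
  qed
  have "computable eval_world ?inp (\<lambda>w a. first_hit (\<lambda>\<phi>. enc_bool (fst (fst a) = \<phi> \<and> hyp \<phi> (wstr w) (snd a @ snd (fst a)))) \<Phi>)"
    by (rule computable_first_hit_const[OF sz step])
  then show ?thesis
    unfolding first_hit_bool by (rule computable_cong) (auto simp: eval_world_def)
qed

end

section \<open>Assembling the learner and the evaluator\<close>

lemma valid_world:
  assumes B: "is_struct \<sigma> B" "univ B = {..<n}" "max_degree B \<le> d" "local_access B \<Omega>"
  shows "small_degree.valid \<sigma> d \<lparr>wstr = B, wacc = \<Omega>, wsize = nat \<lfloor>log 2 (real n)\<rfloor> + j + 2\<rparr>"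
    and "0 < n"
    and "small_degree.degree_at_most d B"
proof -
  show n: "0 < n" using B(1,2) unfolding is_struct_def by auto
  have fin: "finite (univ B)" using B(2) by simp
  have deg: "card (gaifman_nbrs B u) \<le> d" if "u \<in> univ B" for u
  proof -
    have "card (gaifman_nbrs B u) \<le> max_degree B"
      unfolding max_degree_def using fin that by (intro Max_ge) auto
    then show ?thesis using B(3) by simp
  qed
  show "small_degree.degree_at_most d B" using deg by (simp add: small_degree.degree_at_most_def)
  \<comment> \<open>Elements are below \<open>n\<close> and have at most \<open>?b + 1\<close> bits.
    The summand \<open>j\<close> of the size is free: the number of examples for the learner, 0 for
    the evaluator.\<close>
  let ?b = "nat \<lfloor>log 2 (real n)\<rfloor>"
  have "log 2 (real n) < real (Suc ?b)" using n by (simp add: real_nat_ceiling_ge) linarith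
  then have "real n < 2 powr real (Suc ?b)" using n by (simp add: log_less_iff)
  moreover have e: "2 powr real (Suc ?b) = (2 :: real) ^ Suc ?b" by (rule powr_realpow) simp
  ultimately have "real n < real (2 ^ Suc ?b)" unfolding e by simp
  then have n2: "n < 2 ^ Suc ?b" by (simp only: of_nat_less_iff)
  have "dsize (enc_nat u) \<le> (?b + j + 2) ^ 3" if "u \<in> univ B" for u
  proof -
    have "u < 2 ^ Suc ?b" using that B(2) n2 by simp
    then have "dsize (enc_nat u) \<le> 4 * Suc ?b + 1" by (rule dsize_enc_nat)
    also have "\<dots> \<le> 4 * (?b + j + 2)" by simp
    also have "\<dots> \<le> (?b + j + 2) ^ 2 * (?b + j + 2)"
      using power_mono[of 2 "?b + j + 2" 2] by (intro mult_le_mono1) simp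
    finally show ?thesis by (simp add: power3_eq_cube power2_eq_square)
  qed
  then show "small_degree.valid \<sigma> d \<lparr>wstr = B, wacc = \<Omega>, wsize = ?b + j + 2\<rparr>"
    using B n deg unfolding small_degree.valid_def by simp
qed

lemma wsize_power_le:
  assumes "0 < n" "p \<le> c"
  shows "real ((nat \<lfloor>log 2 (real n)\<rfloor> + j + 2) ^ p) \<le> (log 2 (real n) + real j + 2) ^ c"
proof -
  have l: "0 \<le> log 2 (real n)" using assms(1) by simp
  then have "real (nat \<lfloor>log 2 (real n)\<rfloor>) \<le> log 2 (real n)" by linarith
  then have "real ((nat \<lfloor>log 2 (real n)\<rfloor> + j + 2) ^ p) \<le> (log 2 (real n) + real j + 2) ^ p"
    by (simp only: of_nat_power of_nat_add) (intro power_mono, auto)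
  also have "\<dots> \<le> (log 2 (real n) + real j + 2) ^ c"
    using l assms(2) by (intro power_increasing) auto
  finally show ?thesis .
qed

lemma (in small_degree) computable_runs:
  assumes "computable I inp out"
  obtains c p where "\<And>w a. valid w \<Longrightarrow> I w a \<Longrightarrow> \<exists>m. runs (wacc w) c (inp w a) m (out w a) \<and> m \<le> wsize w ^ p"
proof -
  obtain c T where T: "poly_bounded I T" and c: "\<And>w a s. valid w \<Longrightarrow> I w a \<Longrightarrow> s 0 = inp w a \<Longrightarrow>
        \<exists>m s'. exec (wacc w) c s m s' \<and> s' 0 = out w a \<and> m \<le> T w a"
    by (rule computableE[OF assms]) (rule that, assumption+)
  obtain p where p: "\<And>w a. valid w \<Longrightarrow> I w a \<Longrightarrow> T w a \<le> wsize w ^ p"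
    using T unfolding poly_bounded_def by blast
  show ?thesis
  proof (rule that[of c p])
    fix w a assume *: "valid w" "I w a"
    from c[OF *, of "(\<lambda>_. Nl)(0 := inp w a)"] obtain m s' where
      "exec (wacc w) c ((\<lambda>_. Nl)(0 := inp w a)) m s'" "s' 0 = out w a" "m \<le> T w a" by auto
    then show "\<exists>m. runs (wacc w) c (inp w a) m (out w a) \<and> m \<le> wsize w ^ p"
      unfolding runs_def using p[OF *] order_trans by blast
  qed
qed

text \<open>Quantifiers enter \<open>bw\<close> only in formulas without counting terms. In the
  presence of a counting term, width at least 1 follows from well-formedness, which forbids counting
  over the empty tuple.\<close>

lemma bw_bounds:
  fixes \<phi> :: "'p fm"
  assumes "wf_fm \<sigma> P \<phi>" "bw \<phi> \<le> w"
  shows "\<forall>n\<in>count_widths \<phi>. n \<le> w" and "has_quant \<phi> \<Longrightarrow> 1 \<le> w"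
proof -
  have fin: "finite (count_widths \<phi>)" "finite (count_widths_tm t)" for \<phi> :: "'p fm" and t :: "'p tm"
    by (induction \<phi> and t) auto
  have pos: "wf_fm \<sigma> P \<phi> \<Longrightarrow> 0 \<notin> count_widths \<phi>" "wf_tm \<sigma> P t \<Longrightarrow> 0 \<notin> count_widths_tm t" for \<phi> :: "'p fm" and t
    by (induction \<phi> and t) auto
  show le: "\<forall>n\<in>count_widths \<phi>. n \<le> w"
    using assms(2) fin(1)[of \<phi>] unfolding bw_def by (auto split: if_splits)
  show "1 \<le> w" if "has_quant \<phi>"
  proof (cases "count_widths \<phi> = {}")
    case True
    then show ?thesis using assms(2) that by (simp add: bw_def)
  next
    case False
    then obtain n where "n \<in> count_widths \<phi>" by blast
    then have "n \<noteq> 0" "n \<le> w" using pos(1)[OF assms(1)] le by metis+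
    then show ?thesis by simp
  qed
qed

theorem theorem8:
  fixes \<sigma> :: signature and P :: "'p num_preds" and d k l r w :: nat
  assumes "is_num_preds P"
  shows "\<exists>(L :: com) (E :: com) (c :: nat).
    \<forall>(B :: nat struct) (\<Omega> :: access) (T :: training) (n :: nat).
      is_struct \<sigma> B \<and> univ B = {..<n} \<and> max_degree B \<le> d \<and> local_access B \<Omega> \<and>
      is_training B k T \<longrightarrow>
      (\<exists>time out. runs \<Omega> L (enc_training T) time out \<and>
         (out \<noteq> no_hypothesis \<longrightarrow>
            (\<exists>(\<phi> :: 'p fm) vs.
               out = enc_hypothesis \<phi> vs \<and>
               first_order \<phi> \<and> wf_fm \<sigma> P \<phi> \<and> svars \<phi> \<subseteq> {..<k + l} \<and>
               bool_comb (sphere_formulas \<sigma> P ((2 * w + 1) ^ r) {..<k + l}) \<phi> \<and>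
               vs \<in> tuples B l \<and>
               consistent (\<lambda>us. holds P B \<phi> ([0..<k] @ [k..<k + l]) (us @ vs) [] []) T \<and>
               (\<forall>us\<in>tuples B k.
                  \<exists>time'. runs \<Omega> E (Pr out (enc_tuple us)) time'
                      (enc_bool (holds P B \<phi> ([0..<k] @ [k..<k + l]) (us @ vs) [] [])) \<and>
                    real time' \<le> (log 2 (real n) + 2) ^ c))) \<and>
         ((\<exists>(\<phi> :: 'p fm) xs ys ks vs ns.
             wf_fm \<sigma> P \<phi> \<and> br \<phi> \<le> r \<and> bw \<phi> \<le> w \<and>
             length xs = k \<and> length ys = l \<and> distinct (xs @ ys) \<and> distinct ks \<and>
             svars \<phi> \<subseteq> set (xs @ ys) \<and> nvars \<phi> \<subseteq> set ks \<and>
             vs \<in> tuples B l \<and> length ns = length ks \<and> set ns \<subseteq> {0..n} \<and>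
             consistent (\<lambda>us. holds P B \<phi> (xs @ ys) (us @ vs) ks ns) T) \<longrightarrow>
          out \<noteq> no_hypothesis) \<and>
         real time \<le> (log 2 (real n) + real (length T) + 2) ^ c)"
proof -
  let ?R = "(2 * w + 1) ^ r"
  define s where "s = ?R - 1"
  have sR: "s < ?R" by (simp add: s_def)
  let ?m = "k + l"
  have idx: "[0..<k] @ [k..<k + l] = [0..<k + l]" by (simp add: upt_add_eq_append[of 0 k l, simplified])
  obtain \<Phi> :: "'p fm list" where
    \<Phi>: "\<And>\<phi>. \<phi> \<in> set \<Phi> \<Longrightarrow> first_order \<phi> \<and> wf_fm \<sigma> P \<phi> \<and> svars \<phi> \<subseteq> {..<?m} \<and>
       bool_comb (sphere_formulas \<sigma> P ?R {..<?m}) \<phi> \<and>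
       hypothesis_class.local_query \<sigma> d P ?m (\<lambda>B us. holds P B \<phi> [0..<?m] us [] [])"
    and separate: "\<And>B U U'. is_struct \<sigma> B \<Longrightarrow> small_degree.degree_at_most d B \<Longrightarrow>
       U \<subseteq> tuples B ?m \<Longrightarrow> U' \<subseteq> tuples B ?m \<Longrightarrow>
       \<forall>us\<in>U. \<forall>us'\<in>U'. \<not> isomorphic (sphere B s us) (sphere B s us') \<Longrightarrow>
       \<exists>\<phi>\<in>set \<Phi>. (\<forall>us\<in>U. holds P B \<phi> [0..<?m] us [] []) \<and> (\<forall>us\<in>U'. \<not> holds P B \<phi> [0..<?m] us [] [])"
    by (rule hypothesis_class.finite_hypotheses[OF sR, where \<sigma> = \<sigma> and P = P and m = ?m and d = d]) (rule that, assumption+)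
  \<comment> \<open>Each of the at most \<open>l\<close> near parameters may extend a chain from the
    examples by \<open>2 * s + 1\<close>.\<close>
  define rad where "rad = l * (2 * s + 1)"
  interpret learner \<sigma> d P k l \<Phi> rad
    by unfold_locales (use \<Phi> in blast)+
  obtain L p where L: "\<And>w T. valid w \<Longrightarrow> training_world w T \<Longrightarrow>
      \<exists>m. runs (wacc w) L (enc_training T) m (learn w T) \<and> m \<le> wsize w ^ p"
    by (rule computable_runs[OF computable_learn]) (rule that, assumption+)
  obtain E q where E: "\<And>w a. valid w \<Longrightarrow> eval_world w a \<Longrightarrow>
      \<exists>m. runs (wacc w) E ((\<lambda>((\<phi>, vs), us). Pr (enc_hypothesis \<phi> vs) (enc_tuple us)) a) m
         ((\<lambda>((\<phi>, vs), us). enc_bool (hyp \<phi> (wstr w) (us @ vs))) a) \<and> m \<le> wsize w ^ q"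
    by (rule computable_runs[OF computable_eval]) (rule that, assumption+)
  show ?thesis
  proof (rule exI[of _ L], rule exI[of _ E], rule exI[of _ "max p q"], intro allI impI, elim conjE)
    fix B :: "nat struct" and \<Omega> :: access and T :: training and n :: nat
    assume B: "is_struct \<sigma> B" "univ B = {..<n}" "max_degree B \<le> d" "local_access B \<Omega>"
      and T: "is_training B k T"
    \<comment> \<open>Two worlds over the same structure: the learner is measured with
      \<open>length T\<close>, the evaluator with 0, as its time must not depend on the number of
      examples.\<close>
    let ?w = "\<lambda>j. \<lparr>wstr = B, wacc = \<Omega>, wsize = nat \<lfloor>log 2 (real n)\<rfloor> + j + 2\<rparr>"
    let ?wT = "?w (length T)"
    note valid = valid_world(1)[OF B]
    have n: "0 < n" and deg: "degree_at_most B" using valid_world(2,3)[OF B] by simp_all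
    have gaif: "gaifman B \<subseteq> univ B \<times> univ B" by (rule gaifman_subset[OF B(1)])
    have tw: "training_world ?wT T" using T by (simp add: training_world_def)
    obtain time where time: "runs \<Omega> L (enc_training T) time (learn ?wT T)"
      "time \<le> (nat \<lfloor>log 2 (real n)\<rfloor> + length T + 2) ^ p"
      using L[OF valid tw] by auto
    have sound: "\<exists>(\<phi> :: 'p fm) vs.
               learn ?wT T = enc_hypothesis \<phi> vs \<and>
               first_order \<phi> \<and> wf_fm \<sigma> P \<phi> \<and> svars \<phi> \<subseteq> {..<k + l} \<and>
               bool_comb (sphere_formulas \<sigma> P ((2 * w + 1) ^ r) {..<k + l}) \<phi> \<and>
               vs \<in> tuples B l \<and>
               consistent (\<lambda>us. holds P B \<phi> ([0..<k] @ [k..<k + l]) (us @ vs) [] []) T \<and>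
               (\<forall>us\<in>tuples B k.
                  \<exists>time'. runs \<Omega> E (Pr (learn ?wT T) (enc_tuple us)) time'
                      (enc_bool (holds P B \<phi> ([0..<k] @ [k..<k + l]) (us @ vs) [] [])) \<and>
                    real time' \<le> (log 2 (real n) + 2) ^ max p q)"
      if ne: "learn ?wT T \<noteq> no_hypothesis"
    proof -
      obtain \<phi> vs where \<phi>: "\<phi> \<in> set \<Phi>" "vs \<in> tuples B l" "learn ?wT T = enc_hypothesis \<phi> vs"
        "consistent (\<lambda>us. hyp \<phi> B (us @ vs)) T"
        using learn_sound[OF valid tw] ne unfolding no_hypothesis_def by auto
      have "\<exists>time'. runs \<Omega> E (Pr (learn ?wT T) (enc_tuple us)) time'
                      (enc_bool (holds P B \<phi> ([0..<k] @ [k..<k + l]) (us @ vs) [] [])) \<and>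
                    real time' \<le> (log 2 (real n) + 2) ^ max p q" if us: "us \<in> tuples B k" for us
      proof -
        have "eval_world (?w 0) ((\<phi>, vs), us)" using \<phi> us by (simp add: eval_world_def)
        from E[OF valid this] obtain time' where time':
          "runs \<Omega> E (Pr (enc_hypothesis \<phi> vs) (enc_tuple us)) time' (enc_bool (hyp \<phi> B (us @ vs)))"
          "time' \<le> (nat \<lfloor>log 2 (real n)\<rfloor> + 0 + 2) ^ q" by auto
        have "real time' \<le> real ((nat \<lfloor>log 2 (real n)\<rfloor> + 0 + 2) ^ q)" using time'(2) by (simp only: of_nat_le_iff)
        also have "\<dots> \<le> (log 2 (real n) + real 0 + 2) ^ max p q" by (rule wsize_power_le[OF n]) simp
        finally have "real time' \<le> (log 2 (real n) + 2) ^ max p q" by simp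
        then show ?thesis using time'(1) unfolding \<phi>(3) idx hyp_def by blast
      qed
      then show ?thesis
        using \<phi> \<Phi>[OF \<phi>(1)] unfolding hyp_def idx by (intro exI[of _ \<phi>] exI[of _ vs]) blast
    qed
    have complete: "learn ?wT T \<noteq> no_hypothesis"
      if wf: "wf_fm \<sigma> P \<phi>" "br \<phi> \<le> r" "bw \<phi> \<le> w" and len: "length xs = k" "length ys = l"
        and dist: "distinct (xs @ ys)" and sv: "svars \<phi> \<subseteq> set (xs @ ys)" and vs: "vs \<in> tuples B l"
        and cons: "consistent (\<lambda>us. holds P B \<phi> (xs @ ys) (us @ vs) ks ns) T"
      for \<phi> :: "'p fm" and xs ys ks vs ns
    proof -
      let ?Us = "fst ` set T"
      let ?u = "\<lambda>us vs. upds (\<lambda>_. undefined) (xs @ ys) (us @ vs)"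
      have Us: "us \<in> tuples B k" if "us \<in> ?Us" for us using that T by (auto simp: is_training_def)
      obtain vs' where vs': "length vs' = length ys" "set vs' \<subseteq> univ B"
        "set vs' \<subseteq> insert 0 (ball B (length ys * (2 * s + 1)) (\<Union>us\<in>?Us. set us))"
        and repl: "\<And>us us'. us \<in> ?Us \<Longrightarrow> us' \<in> ?Us \<Longrightarrow>
          same_type B s (set (xs @ ys)) (?u us vs') (?u us' vs') \<Longrightarrow>
          same_type B s (set (xs @ ys)) (?u us vs) (?u us' vs)"
        by (rule replace_far_parameters[where B = B and xs = xs and ys = ys and Us = ?Us and vs = vs and a = 0 and s = s
             and \<beta> = "\<lambda>_. undefined"])
          (use gaif dist Us vs len n B(2) in \<open>auto simp: tuples_iff\<close>)
      have same: "holds P B \<phi> (xs @ ys) (us @ vs) ks ns \<longleftrightarrow> holds P B \<phi> (xs @ ys) (us' @ vs) ks ns"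
        if us: "us \<in> ?Us" "us' \<in> ?Us" and st: "same_type B s (set (xs @ ys)) (?u us vs) (?u us' vs)" for us us'
      proof -
        have "?u us vs ` set (xs @ ys) \<subseteq> univ B" if "us \<in> ?Us" for us
        proof -
          have l: "length (us @ vs) = length (xs @ ys)" "set (us @ vs) \<subseteq> univ B"
            using Us[OF that] vs len by (auto simp: tuples_iff)
          have "?u us vs ` set (xs @ ys) = set (us @ vs)"
            using map_upds[OF dist l(1), of "\<lambda>_. undefined"] by (metis set_map)
          then show ?thesis using l(2) by simp
        qed
        from this[OF us(1)] this[OF us(2)] show ?thesis
          unfolding holds_def using B(2) st[unfolded s_def]
          by (intro locality(1)[OF _ gaif wf(1) sv wf(2) bw_bounds[OF wf(1,3)]]) simp_all
      qed
      \<comment> \<open>Positive and negative examples, completed by the new parameters.\<close>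
      let ?P = "\<lambda>c. (\<lambda>us. us @ vs') ` {us. (us, c) \<in> set T}"
      have P: "?P c \<subseteq> tuples B ?m" for c
      proof
        fix z assume "z \<in> ?P c"
        then obtain us where "(us, c) \<in> set T" "z = us @ vs'" by blast
        moreover from this(1) have "us \<in> tuples B k" by (intro Us) force
        ultimately show "z \<in> tuples B ?m" using vs' len by (simp add: tuples_iff)
      qed
      \<comment> \<open>Isomorphic spheres with the new parameters would give equal types with the
        old ones, and then \<open>\<phi>\<close> could not tell a positive from a negative
        example.\<close>
      have "\<not> isomorphic (sphere B s (us @ vs')) (sphere B s (us' @ vs'))"
        if us: "(us, True) \<in> set T" "(us', False) \<in> set T" for us us'
      proof
        assume iso: "isomorphic (sphere B s (us @ vs')) (sphere B s (us' @ vs'))"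
        have U: "us \<in> ?Us" "us' \<in> ?Us" using us by force+
        have "same_type B s (set (xs @ ys)) (?u us vs') (?u us' vs')"
          by (rule isomorphic_imp_same_type[OF gaif _ _ _ _ dist iso])
            (use Us[OF U(1)] Us[OF U(2)] vs' len in \<open>auto simp: tuples_iff\<close>)
        then have "holds P B \<phi> (xs @ ys) (us @ vs) ks ns \<longleftrightarrow> holds P B \<phi> (xs @ ys) (us' @ vs) ks ns"
          by (intro same[OF U] repl[OF U])
        then show False using cons us unfolding consistent_def by fastforce
      qed
      then have "\<forall>us\<in>?P True. \<forall>us'\<in>?P False. \<not> isomorphic (sphere B s us) (sphere B s us')" by blast
      from separate[OF B(1) deg P P this]
      obtain \<phi>' where \<phi>': "\<phi>' \<in> set \<Phi>"
        and pos: "\<forall>us\<in>?P True. hyp \<phi>' B us" and neg: "\<forall>us\<in>?P False. \<not> hyp \<phi>' B us"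
        unfolding hyp_def by (elim bexE conjE)
      have "hyp \<phi>' B (us @ vs') = c" if "(us, c) \<in> set T" for us c
        using that pos neg by (cases c) simp_all
      then have "consistent (\<lambda>us. hyp \<phi>' B (us @ vs')) T" by (auto simp: consistent_def)
      moreover have "set vs' \<subseteq> candidates ?wT T"
      proof
        fix v assume "v \<in> set vs'"
        then consider "v = 0" | "v \<in> ball B rad (\<Union>us\<in>?Us. set us)"
          using vs'(3) unfolding len(2) rad_def by blast
        then show "v \<in> candidates ?wT T"
        proof cases
          case 2
          then obtain x u where xu: "x \<in> set T" "u \<in> set (fst x)" "v \<in> ball B rad {u}"
            unfolding ball_def by blast
          have "u \<in> univ B" using training_world_univ[OF tw xu(1,2)] by simp
          then have "v \<in> nbhd B rad [u]" using nbhd_eq_ball[OF gaif, of "[u]" rad] xu(3) by simp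
          then show ?thesis using xu(1,2) by (auto simp: candidates_def)
        qed (simp add: candidates_def)
      qed
      ultimately show ?thesis
        using learn_complete[OF valid tw \<phi>', of vs'] vs'(1) len unfolding no_hypothesis_def by simp
    qed
    have "real time \<le> real ((nat \<lfloor>log 2 (real n)\<rfloor> + length T + 2) ^ p)" using time(2) by (simp only: of_nat_le_iff)
    also have "\<dots> \<le> (log 2 (real n) + real (length T) + 2) ^ max p q" by (rule wsize_power_le[OF n]) simp
    finally have bound: "real time \<le> (log 2 (real n) + real (length T) + 2) ^ max p q" .
    show "\<exists>time out. runs \<Omega> L (enc_training T) time out \<and>
         (out \<noteq> no_hypothesis \<longrightarrow>
            (\<exists>(\<phi> :: 'p fm) vs.
               out = enc_hypothesis \<phi> vs \<and>
               first_order \<phi> \<and> wf_fm \<sigma> P \<phi> \<and> svars \<phi> \<subseteq> {..<k + l} \<and>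
               bool_comb (sphere_formulas \<sigma> P ((2 * w + 1) ^ r) {..<k + l}) \<phi> \<and>
               vs \<in> tuples B l \<and>
               consistent (\<lambda>us. holds P B \<phi> ([0..<k] @ [k..<k + l]) (us @ vs) [] []) T \<and>
               (\<forall>us\<in>tuples B k.
                  \<exists>time'. runs \<Omega> E (Pr out (enc_tuple us)) time'
                      (enc_bool (holds P B \<phi> ([0..<k] @ [k..<k + l]) (us @ vs) [] [])) \<and>
                    real time' \<le> (log 2 (real n) + 2) ^ max p q))) \<and>
         ((\<exists>(\<phi> :: 'p fm) xs ys ks vs ns.
             wf_fm \<sigma> P \<phi> \<and> br \<phi> \<le> r \<and> bw \<phi> \<le> w \<and>
             length xs = k \<and> length ys = l \<and> distinct (xs @ ys) \<and> distinct ks \<and>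
             svars \<phi> \<subseteq> set (xs @ ys) \<and> nvars \<phi> \<subseteq> set ks \<and>
             vs \<in> tuples B l \<and> length ns = length ks \<and> set ns \<subseteq> {0..n} \<and>
             consistent (\<lambda>us. holds P B \<phi> (xs @ ys) (us @ vs) ks ns) T) \<longrightarrow>
          out \<noteq> no_hypothesis) \<and>
         real time \<le> (log 2 (real n) + real (length T) + 2) ^ max p q"
    proof (intro exI[of _ time] exI[of _ "learn ?wT T"] conjI)
      show "runs \<Omega> L (enc_training T) time (learn ?wT T)" by (rule time(1))
      show "learn ?wT T \<noteq> no_hypothesis \<longrightarrow> (\<exists>(\<phi> :: 'p fm) vs.
               learn ?wT T = enc_hypothesis \<phi> vs \<and>
               first_order \<phi> \<and> wf_fm \<sigma> P \<phi> \<and> svars \<phi> \<subseteq> {..<k + l} \<and>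
               bool_comb (sphere_formulas \<sigma> P ((2 * w + 1) ^ r) {..<k + l}) \<phi> \<and>
               vs \<in> tuples B l \<and>
               consistent (\<lambda>us. holds P B \<phi> ([0..<k] @ [k..<k + l]) (us @ vs) [] []) T \<and>
               (\<forall>us\<in>tuples B k.
                  \<exists>time'. runs \<Omega> E (Pr (learn ?wT T) (enc_tuple us)) time'
                      (enc_bool (holds P B \<phi> ([0..<k] @ [k..<k + l]) (us @ vs) [] [])) \<and>
                    real time' \<le> (log 2 (real n) + 2) ^ max p q))"
        by (rule impI, rule sound)
    qed (use complete bound in blast)+
  qed
qed

end
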